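(* Let $\Pi$ be a self-contained $k$-witness problem, and suppose we have access to a deterministic decision oracle $\mathrm{ORA}$ for $\Pi$. There is a randomised algorithm which, given an instance of $\Pi$ with universe $U$ of size $n$, outputs every witness of the instance exactly once (and outputs nothing else), and whose expected number of calls to $\mathrm{ORA}$ is at most $2^{O(k)} \log^2 n \cdot N$, where $N$ is the total number of witnesses in the instance. Moreover, if an oracle call can be executed in time $g(k)\cdot n^{O(1)}$ for some computable function $g$, then the expected total running time of the algorithm is $2^{O(k)} \cdot g(k) \cdot n^{O(1)} \cdot N$.
   Context: A self-contained $k$-witness problem is one in which an instance consists of a universe $U$ of $n$ elements and a parameter $k$, together with a (implicitly specified) collection of $k$-element subsets of $U$ called witnesses, such that a decision procedure may be called on any subset $X \subseteq U$ to determine whether some witness of the original instance (with universe $U$) is contained in $X$. The deterministic decision oracle $\mathrm{ORA}(X)$ takes $X \subseteq U$ and returns $1$ if some witness $W$ satisfies $W \subseteq X$, and $0$ otherwise. Examples include $k$-Clique, $k$-Cycle and $k$-Path (witnesses being the vertex sets of the relevant subgraphs).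
   Formalization: In the bounds N, log n and n are read as max(1,N), max(1,log n), max(1,n), since for N = 0 or n = 1 the literal bound would allow no oracle call at all and no algorithm could be correct; an oracle call is taken to cost at least one time step. *)

theory Defs
  imports "HOL-Probability.Probability" "HOL-Library.Landau_Symbols"
begin

section \<open>Witness problems\<close>

text \<open>The universe of an instance is presented as an enumeration without repetitions, so that
  an algorithm can refer to its elements by the indices \<open>0, \<dots>, n - 1\<close>.\<close>

record ('i, 'a) witness_problem =
  instances :: "'i set"
  universe :: "'i \<Rightarrow> 'a list"
  param :: "'i \<Rightarrow> nat"
  witnesses :: "'i \<Rightarrow> 'a set set"

definition self_contained_k_witness_problem :: "('i, 'a) witness_problem \<Rightarrow> bool" where
  "self_contained_k_witness_problem \<Q> \<longleftrightarrow>
     (\<forall>I\<in>instances \<Q>. distinct (universe \<Q> I) \<and>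
        (\<forall>W\<in>witnesses \<Q> I. W \<subseteq> set (universe \<Q> I) \<and> card W = param \<Q> I))"

definition ORA :: "('i, 'a) witness_problem \<Rightarrow> 'i \<Rightarrow> 'a set \<Rightarrow> bool" where
  "ORA \<Q> I X \<longleftrightarrow> (\<exists>W\<in>witnesses \<Q> I. W \<subseteq> X)"

abbreviation univ_size :: "('i, 'a) witness_problem \<Rightarrow> 'i \<Rightarrow> nat" where
  "univ_size \<Q> I \<equiv> length (universe \<Q> I)"

abbreviation num_witnesses :: "('i, 'a) witness_problem \<Rightarrow> 'i \<Rightarrow> nat" where
  "num_witnesses \<Q> I \<equiv> card (witnesses \<Q> I)"


section \<open>Randomised oracle algorithms\<close>

text \<open>Programs are structured programs for a random access machine with uniform cost measure:
  variables and memory cells hold natural numbers, arithmetic is limited to addition and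
  truncated subtraction, and there is a source of fair coin flips.  A query to the oracle is
  written element by element onto a query tape (\<open>Ask\<close>) and then submitted (\<open>Call\<close>, which stores
  the answer as 1 or 0 and clears the tape).  Likewise, an item of output is written element by
  element (\<open>Write\<close>) and then delivered (\<open>Emit\<close>).\<close>

type_synonym vname = string

datatype aexp = N nat | V vname | Mem aexp | Plus aexp aexp | Minus aexp aexp

datatype bexp = Less aexp aexp | Not bexp | And bexp bexp

datatype com =
    Skip
  | Assign vname aexp
  | Store aexp aexp
  | Coin vname
  | Ask aexp
  | Call vname
  | Write aexp
  | Emit
  | Seq com com
  | Cond bexp com com
  | While bexp com

record config =
  vars :: "vname \<Rightarrow> nat"
  mem :: "nat \<Rightarrow> nat"
  coins :: "bool stream"
  query_tape :: "nat list"
  output_tape :: "nat list"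
  queries :: "nat set list"
  outputs :: "nat list list"
  steps :: nat

primrec aval :: "aexp \<Rightarrow> config \<Rightarrow> nat" where
  "aval (N c) s = c"
| "aval (V x) s = vars s x"
| "aval (Mem a) s = mem s (aval a s)"
| "aval (Plus a b) s = aval a s + aval b s"
| "aval (Minus a b) s = aval a s - aval b s"

primrec bval :: "bexp \<Rightarrow> config \<Rightarrow> bool" where
  "bval (Less a b) s \<longleftrightarrow> aval a s < aval b s"
| "bval (Not b) s \<longleftrightarrow> \<not> bval b s"
| "bval (And b c) s \<longleftrightarrow> bval b s \<and> bval c s"

abbreviation tick :: "config \<Rightarrow> config" where
  "tick s \<equiv> s\<lparr>steps := Suc (steps s)\<rparr>"

text \<open>The expressions of a program have bounded size, so charging one step for the evaluation
  of an expression changes the running time by a constant factor only.  The fields \<open>queries\<close> and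
  \<open>outputs\<close> record, in chronological order, the submitted queries and the delivered items.\<close>

inductive big_step :: "(nat set \<Rightarrow> bool) \<Rightarrow> com \<Rightarrow> config \<Rightarrow> config \<Rightarrow> bool"
  for ora :: "nat set \<Rightarrow> bool" where
  Skip: "big_step ora Skip s (tick s)"
| Assign: "big_step ora (Assign x a) s (tick (s\<lparr>vars := (vars s)(x := aval a s)\<rparr>))"
| Store: "big_step ora (Store a b) s (tick (s\<lparr>mem := (mem s)(aval a s := aval b s)\<rparr>))"
| Coin: "big_step ora (Coin x) s
    (tick (s\<lparr>vars := (vars s)(x := of_bool (shd (coins s))), coins := stl (coins s)\<rparr>))"
| Ask: "big_step ora (Ask a) s (tick (s\<lparr>query_tape := query_tape s @ [aval a s]\<rparr>))"
| Call: "big_step ora (Call x) s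
    (tick (s\<lparr>vars := (vars s)(x := of_bool (ora (set (query_tape s)))),
             query_tape := [],
             queries := queries s @ [set (query_tape s)]\<rparr>))"
| Write: "big_step ora (Write a) s (tick (s\<lparr>output_tape := output_tape s @ [aval a s]\<rparr>))"
| Emit: "big_step ora Emit s
    (tick (s\<lparr>output_tape := [], outputs := outputs s @ [output_tape s]\<rparr>))"
| Seq: "big_step ora c\<^sub>1 s s' \<Longrightarrow> big_step ora c\<^sub>2 s' s'' \<Longrightarrow> big_step ora (Seq c\<^sub>1 c\<^sub>2) s s''"
| CondTrue: "bval b s \<Longrightarrow> big_step ora c\<^sub>1 (tick s) s' \<Longrightarrow> big_step ora (Cond b c\<^sub>1 c\<^sub>2) s s'"
| CondFalse: "\<not> bval b s \<Longrightarrow> big_step ora c\<^sub>2 (tick s) s' \<Longrightarrow> big_step ora (Cond b c\<^sub>1 c\<^sub>2) s s'"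
| WhileFalse: "\<not> bval b s \<Longrightarrow> big_step ora (While b c) s (tick s)"
| WhileTrue: "bval b s \<Longrightarrow> big_step ora c (tick s) s' \<Longrightarrow> big_step ora (While b c) s' s'' \<Longrightarrow>
    big_step ora (While b c) s s''"

inductive_cases big_step_elims:
  "big_step ora Skip s t" "big_step ora (Assign x a) s t" "big_step ora (Store a b) s t"
  "big_step ora (Coin x) s t" "big_step ora (Ask a) s t" "big_step ora (Call x) s t"
  "big_step ora (Write a) s t" "big_step ora Emit s t" "big_step ora (Seq c\<^sub>1 c\<^sub>2) s t"
  "big_step ora (Cond b c\<^sub>1 c\<^sub>2) s t" "big_step ora (While b c) s t"

lemma big_step_deterministic:
  "big_step ora c s t \<Longrightarrow> big_step ora c s t' \<Longrightarrow> t' = t"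
proof (induction arbitrary: t' rule: big_step.induct)
  case (Seq c\<^sub>1 s s' c\<^sub>2 s'')
  from Seq.prems show ?case
    by (rule big_step_elims(9)) (metis Seq.IH)
next
  case (CondTrue b s c\<^sub>1 s' c\<^sub>2)
  from CondTrue.prems show ?case
    by (rule big_step_elims(10)) (metis CondTrue)+
next
  case (CondFalse b s c\<^sub>2 s' c\<^sub>1)
  from CondFalse.prems show ?case
    by (rule big_step_elims(10)) (metis CondFalse)+
next
  case (WhileFalse b s c)
  from WhileFalse.prems show ?case
    by (rule big_step_elims(11)) (metis WhileFalse)+
next
  case (WhileTrue b s c s' s'')
  from WhileTrue.prems show ?case
    by (rule big_step_elims(11)) (metis WhileTrue.hyps(1) WhileTrue.IH)+
qed (erule big_step_elims, simp)+

definition start :: "nat \<Rightarrow> nat \<Rightarrow> bool stream \<Rightarrow> config" where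
  "start n k \<omega> = \<lparr>vars = (\<lambda>_. 0)(''n'' := n, ''k'' := k), mem = (\<lambda>_. 0), coins = \<omega>,
     query_tape = [], output_tape = [], queries = [], outputs = [], steps = 0\<rparr>"

text \<open>Independence of the result from oracle and coins makes this computability in the
  ordinary sense.\<close>

definition computable :: "(nat \<Rightarrow> nat) \<Rightarrow> bool" where
  "computable g \<longleftrightarrow>
     (\<exists>P. \<forall>ora \<omega> k. \<exists>t. big_step ora P (start 0 k \<omega>) t \<and> vars t ''result'' = g k)"

definition coin_tape :: "bool stream measure" where
  "coin_tape = stream_space (measure_pmf (bernoulli_pmf (1 / 2)))"


section \<open>Running an algorithm on an instance\<close>

text \<open>Indices outside the range \<open>0, \<dots>, n - 1\<close> in a query are ignored.\<close>

definition decode :: "('i, 'a) witness_problem \<Rightarrow> 'i \<Rightarrow> nat set \<Rightarrow> 'a set" where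
  "decode \<Q> I S = (!) (universe \<Q> I) ` (S \<inter> {..<univ_size \<Q> I})"

definition terminates_in ::
  "com \<Rightarrow> ('i, 'a) witness_problem \<Rightarrow> 'i \<Rightarrow> bool stream \<Rightarrow> config \<Rightarrow> bool" where
  "terminates_in A \<Q> I \<omega> t \<longleftrightarrow>
     big_step (\<lambda>S. ORA \<Q> I (decode \<Q> I S)) A (start (univ_size \<Q> I) (param \<Q> I) \<omega>) t"

definition outputs_witnesses_once :: "('i, 'a) witness_problem \<Rightarrow> 'i \<Rightarrow> config \<Rightarrow> bool" where
  "outputs_witnesses_once \<Q> I t \<longleftrightarrow>
     (\<forall>xs\<in>set (outputs t). distinct xs \<and> set xs \<subseteq> {..<univ_size \<Q> I}) \<and>
     distinct (map (\<lambda>xs. decode \<Q> I (set xs)) (outputs t)) \<and>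
     set (map (\<lambda>xs. decode \<Q> I (set xs)) (outputs t)) = witnesses \<Q> I"

definition enumerates :: "com \<Rightarrow> ('i, 'a) witness_problem \<Rightarrow> 'i \<Rightarrow> bool" where
  "enumerates A \<Q> I \<longleftrightarrow>
     (AE \<omega> in coin_tape. \<exists>t. terminates_in A \<Q> I \<omega> t \<and> outputs_witnesses_once \<Q> I t)"

text \<open>Expected value of a quantity read off from the final configuration; the quantity counts
  as infinite for runs that do not terminate.\<close>

definition expected ::
  "com \<Rightarrow> ('i, 'a) witness_problem \<Rightarrow> 'i \<Rightarrow> (config \<Rightarrow> nat) \<Rightarrow> ennreal" where
  "expected A \<Q> I f =
     (\<integral>\<^sup>+\<omega>. (if \<exists>t. terminates_in A \<Q> I \<omega> t
           then of_nat (f (THE t. terminates_in A \<Q> I \<omega> t)) else \<infinity>) \<partial>coin_tape)"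

definition expected_calls :: "com \<Rightarrow> ('i, 'a) witness_problem \<Rightarrow> 'i \<Rightarrow> ennreal" where
  "expected_calls A \<Q> I = expected A \<Q> I (\<lambda>t. length (queries t))"

text \<open>\<open>\<tau> I X\<close> is the time for executing the oracle call \<open>ORA(X)\<close> on the instance \<open>I\<close>.\<close>

definition expected_time ::
  "com \<Rightarrow> ('i, 'a) witness_problem \<Rightarrow> ('i \<Rightarrow> 'a set \<Rightarrow> nat) \<Rightarrow> 'i \<Rightarrow> ennreal" where
  "expected_time A \<Q> \<tau> I =
     expected A \<Q> I (\<lambda>t. steps t + (\<Sum>S\<leftarrow>queries t. \<tau> I (decode \<Q> I S)))"

text \<open>An oracle call takes at least one step, and at most \<open>g(k) n\<^sup>d\<close> steps.  Here and in the
  bounds below, \<open>max 1\<close> only matters for degenerate instances (\<open>n \<le> 1\<close> or no witnesses).\<close>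

definition oracle_time_bound ::
  "('i, 'a) witness_problem \<Rightarrow> ('i \<Rightarrow> 'a set \<Rightarrow> nat) \<Rightarrow> (nat \<Rightarrow> nat) \<Rightarrow> nat \<Rightarrow> bool" where
  "oracle_time_bound \<Q> \<tau> g d \<longleftrightarrow>
     (\<forall>I\<in>instances \<Q>. \<forall>X\<subseteq>set (universe \<Q> I).
        1 \<le> \<tau> I X \<and> \<tau> I X \<le> g (param \<Q> I) * max 1 (univ_size \<Q> I) ^ d)"

definition calls_bound :: "(nat \<Rightarrow> real) \<Rightarrow> ('i, 'a) witness_problem \<Rightarrow> 'i \<Rightarrow> real" where
  "calls_bound h \<Q> I =
     2 powr h (param \<Q> I) * (max 1 (log 2 (univ_size \<Q> I)))\<^sup>2 * max 1 (num_witnesses \<Q> I)"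

definition time_bound ::
  "(nat \<Rightarrow> real) \<Rightarrow> (nat \<Rightarrow> nat) \<Rightarrow> nat \<Rightarrow> ('i, 'a) witness_problem \<Rightarrow> 'i \<Rightarrow> real" where
  "time_bound h g e \<Q> I =
     2 powr h (param \<Q> I) * g (param \<Q> I) * max 1 (univ_size \<Q> I) ^ e
       * max 1 (num_witnesses \<Q> I)"

end

theory Submission
  imports Defs
begin

text \<open>Every element \<open>u\<close> is sent to a uniformly random leaf of a complete binary tree with \<open>Q = 2\<^sup>L \<ge> n\<close>
  leaves, numbered in heap order.  Splitting the tree nodes one after another refines the trivial
  partition of the universe; finally elements at a common leaf are separated one by one.  The
  search keeps, for every stage of this refinement, the unions \<open>X\<close> of at most \<open>k\<close> cells that contain a
  witness.  When a cell inside \<open>X\<close> is split, the candidates are \<open>X\<close>, and \<open>X\<close> without either half.  A set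
  \<open>X\<close> at the next stage comes from exactly one \<open>X\<close> at the previous stage, so at the stage of
  singletons every witness appears exactly once, and nothing else does.

  Oracle calls are needed only if the split cell lies in \<open>X\<close>.  For a tree node \<open>i\<close> there are
  \<open>i\<close> cells, each of them has probability at most \<open>2 / i\<close>, and \<open>X\<close> corresponds to a set of \<open>s \<le> k\<close> cells
  that contains the cell \<open>i\<close> and the \<open>k\<close> cells of some witness.  The expected number of such sets is
  at most the sum of \<open>(i - 1 choose s - 1) (2 s / i)\<^sup>k \<le> 2\<^sup>k k e\<^sup>k / i\<close> over \<open>s\<close>, for every witness.  Summing
  over \<open>i\<close> gives the factor \<open>log n\<close>.  In the last phase \<open>X\<close> is determined by the set \<open>R\<close> of the least
  elements of its cells, and a given \<open>R\<close> covers the leaves of a witness \<open>W\<close> with probability at most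
  \<open>(\<bar>R\<bar> / Q)\<close> to the power \<open>\<bar>W - R\<bar>\<close>, so that the expected number of all \<open>R\<close> is \<open>2\<^bsup>O(k)\<^esup>\<close>.  The number of
  steps is at most a polynomial in \<open>n\<close> times the number of calls.\<close>


section \<open>Weakest preconditions and the program\<close>

text \<open>Randomness affects only the cost: the program terminates with the right output for every
  coin sequence. All of the combinatorics is therefore proved for an arbitrary leaf map
  \<open>h\<close>, and only the resulting bound is averaged at the end. The obstacle in averaging
  is that the sets \<open>X\<close> depend on \<open>h\<close>. Each active \<open>X\<close> is
  encoded injectively by an object from a family that does not mention \<open>h\<close>: a set of
  tree nodes above the leaves, a set of representatives at the leaves. The sums can then be
  exchanged, and what remains is the probability that a fixed object covers a fixed witness. The
  bound is small because the split cell must belong to \<open>X\<close>: this fixes one member of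
  the set of nodes and saves one factor \<open>i\<close>, without which the sum over
  \<open>i\<close> would be linear instead of logarithmic. Independent coins make the cells uneven,
  but spare the construction of balanced partitions. Collisions at the leaves cannot be excluded, so
  the final phase is unavoidable; \<open>Q \<ge> n\<close> keeps its cost bounded in terms of
  \<open>k\<close>. The machine can neither multiply nor divide, so all sides are tabulated in
  advance and rows are visited by adding \<open>Z\<close> to a pointer.\<close>

definition wp :: "(nat set \<Rightarrow> bool) \<Rightarrow> com \<Rightarrow> (config \<Rightarrow> bool) \<Rightarrow> config \<Rightarrow> bool" where
  "wp ora c P s \<longleftrightarrow> (\<exists>t. big_step ora c s t \<and> P t)"

lemma wp_simps [simp]:
  "wp ora Skip P s \<longleftrightarrow> P (tick s)"
  "wp ora (Assign x a) P s \<longleftrightarrow> P (tick (s\<lparr>vars := (vars s)(x := aval a s)\<rparr>))"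
  "wp ora (Store a b) P s \<longleftrightarrow> P (tick (s\<lparr>mem := (mem s)(aval a s := aval b s)\<rparr>))"
  "wp ora (Coin x) P s \<longleftrightarrow>
    P (tick (s\<lparr>vars := (vars s)(x := of_bool (shd (coins s))), coins := stl (coins s)\<rparr>))"
  "wp ora (Ask a) P s \<longleftrightarrow> P (tick (s\<lparr>query_tape := query_tape s @ [aval a s]\<rparr>))"
  "wp ora (Call x) P s \<longleftrightarrow>
    P (tick (s\<lparr>vars := (vars s)(x := of_bool (ora (set (query_tape s)))),
             query_tape := [], queries := queries s @ [set (query_tape s)]\<rparr>))"
  "wp ora (Write a) P s \<longleftrightarrow> P (tick (s\<lparr>output_tape := output_tape s @ [aval a s]\<rparr>))"
  "wp ora Emit P s \<longleftrightarrow> P (tick (s\<lparr>output_tape := [], outputs := outputs s @ [output_tape s]\<rparr>))"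
  "wp ora (Seq c d) P s \<longleftrightarrow> wp ora c (wp ora d P) s"
  "wp ora (Cond be c d) P s \<longleftrightarrow>
    (if bval be s then wp ora c P (tick s) else wp ora d P (tick s))"
  unfolding wp_def by (auto intro: big_step.intros elim!: big_step_elims)

lemma wp_Seq [simp]: "wp ora (Seq c d) P = wp ora c (wp ora d P)"
  by (rule ext) simp

text \<open>The measure is an argument of the invariant and not a function of the state, so that it
  may depend on data that the state does not show directly, such as the depth reached or the list of
  pending entries.\<close>

lemma wp_While_variant:
  assumes "Inv (m :: nat) s"
    and step: "\<And>m s. Inv m s \<Longrightarrow> bval b s \<Longrightarrow> wp ora c (\<lambda>t. \<exists>m'<m. Inv m' t) (tick s)"
    and fin: "\<And>m s. Inv m s \<Longrightarrow> \<not> bval b s \<Longrightarrow> P (tick s)"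
  shows "wp ora (While b c) P s"
  using assms(1)
proof (induction m arbitrary: s rule: less_induct)
  case (less m)
  show ?case
  proof (cases "bval b s")
    case True
    from step[OF less.prems True] obtain t m' where t: "big_step ora c (tick s) t" "m' < m" "Inv m' t"
      unfolding wp_def by auto
    from less.IH[OF t(2,3)] obtain t' where "big_step ora (While b c) t t'" "P t'"
      unfolding wp_def by auto
    with t(1) True show ?thesis unfolding wp_def by (auto intro: big_step.WhileTrue)
  next
    case False
    with fin[OF less.prems False] show ?thesis
      unfolding wp_def by (auto intro: big_step.WhileFalse)
  qed
qed

lemma wp_While:
  fixes m :: "config \<Rightarrow> nat"
  assumes "Inv s"
    and "\<And>s. Inv s \<Longrightarrow> bval b s \<Longrightarrow> wp ora c (\<lambda>t. Inv t \<and> m t < m s) (tick s)"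
    and "\<And>s. Inv s \<Longrightarrow> \<not> bval b s \<Longrightarrow> P (tick s)"
  shows "wp ora (While b c) P s"
proof (rule wp_While_variant[where Inv = "\<lambda>i s. Inv s \<and> i = m s" and m = "m s"])
  fix i s assume "Inv s \<and> i = m s" and "bval b s"
  then show "wp ora c (\<lambda>t. \<exists>i'<i. Inv t \<and> i' = m t) (tick s)"
    using assms(2)[of s] by (simp add: conj_commute)
qed (use assms in auto)

section \<open>Derived commands and the text of the enumeration program\<close>

definition Eq :: "aexp \<Rightarrow> aexp \<Rightarrow> bexp" where
  "Eq a b = And (Not (Less a b)) (Not (Less b a))"

lemma bval_Eq [simp]: "bval (Eq a b) s \<longleftrightarrow> aval a s = aval b s"
  by (auto simp: Eq_def)

primrec block :: "com list \<Rightarrow> com" where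
  "block [] = Skip"
| "block (c # cs) = Seq c (block cs)"

definition incr :: "vname \<Rightarrow> aexp \<Rightarrow> com" where
  "incr x a = Assign x (Plus (V x) a)"

lemma wp_incr [simp]:
  "wp ora (incr x a) P s \<longleftrightarrow> P (tick (s\<lparr>vars := (vars s)(x := vars s x + aval a s)\<rparr>))"
  by (simp add: incr_def)

text \<open>Memory layout: row \<open>u < n\<close> starts at \<open>u Z\<close>, where \<open>Z = Q + n\<close>; its cell \<open>0\<close> holds the leaf of \<open>u\<close>
  and its cell \<open>i\<close> tells on which side of the split in step \<open>i\<close> the element \<open>u\<close> lies (0 if on neither).
  From \<open>n Z\<close> on there is a queue of entries of length \<open>n + 2\<close>: a step, the number of cells, and the
  indicator of a set of elements.\<close>

definition query_all :: com where
  "query_all = block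
    [While (Less (V ''u'') (V ''n'')) (Seq (Ask (V ''u'')) (incr ''u'' (N 1))),
     Call ''r'']"

definition size_up :: com where
  "size_up = block
    [Assign ''Q'' (N 1),
     While (Less (V ''Q'') (V ''n'')) (incr ''Q'' (V ''Q'')),
     Assign ''Z'' (Plus (V ''Q'') (V ''n''))]"

definition walk :: com where
  "walk = block
    [Assign ''v'' (N 1),
     While (Less (V ''v'') (V ''Q'')) (block
       [Coin ''b'',
        Store (Plus (V ''p'') (V ''v'')) (Plus (V ''b'') (N 1)),
        Assign ''v'' (Plus (Plus (V ''v'') (V ''v'')) (V ''b''))]),
     Store (V ''p'') (V ''v'')]"

text \<open>\<open>q\<close> runs through the starts of the rows \<open>w < u\<close>, where the
  leaves are stored. Earlier rows suffice, because step \<open>Q + w\<close> puts on side 2 only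
  elements larger than \<open>w\<close>; the columns after \<open>Q + u\<close> keep their initial
  0.\<close>

definition peel :: com where
  "peel = block
    [Assign ''w'' (N 0), Assign ''q'' (N 0),
     While (Less (V ''w'') (V ''u'')) (block
       [Cond (Eq (Mem (V ''q'')) (V ''v''))
          (Store (Plus (Plus (V ''p'') (V ''Q'')) (V ''w'')) (N 2)) Skip,
        incr ''w'' (N 1), incr ''q'' (V ''Z'')]),
     Store (Plus (Plus (V ''p'') (V ''Q'')) (V ''u'')) (N 1)]"

definition fill_table :: com where
  "fill_table = block
    [Assign ''u'' (N 0), Assign ''p'' (N 0),
     While (Less (V ''u'') (V ''n''))
       (block [walk, peel, incr ''u'' (N 1), incr ''p'' (V ''Z'')])]"

definition mark :: "vname \<Rightarrow> aexp" where
  "mark x = Plus (Plus (V x) (N 2)) (V ''u'')"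

definition init_queue :: com where
  "init_queue = block
    [Assign ''h'' (V ''p''), Assign ''t'' (Plus (Plus (V ''p'') (V ''n'')) (N 2)),
     Store (V ''h'') (N 1), Store (Plus (V ''h'') (N 1)) (N 1),
     Assign ''u'' (N 0),
     While (Less (V ''u'') (V ''n'')) (Seq (Store (mark ''h'') (N 1)) (incr ''u'' (N 1)))]"

definition scan :: com where
  "scan = block
    [Assign ''a'' (N 0), Assign ''b'' (N 0), Assign ''u'' (N 0), Assign ''p'' (V ''i''),
     While (Less (V ''u'') (V ''n'')) (block
       [Cond (Less (N 0) (Mem (mark ''h'')))
          (Cond (Eq (Mem (V ''p'')) (N 1)) (Assign ''a'' (N 1))
            (Cond (Eq (Mem (V ''p'')) (N 2)) (Assign ''b'' (N 1)) Skip)) Skip,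
        incr ''u'' (N 1), incr ''p'' (V ''Z'')])]"

text \<open>The candidate is written behind the tail of the queue while it is put on the query tape.
  Only a positive answer moves the tail; otherwise the next candidate overwrites it, which is why
  the indicator is also cleared explicitly.\<close>

definition push :: "nat \<Rightarrow> com" where
  "push j = block
    [Store (V ''t'') (Plus (V ''i'') (N 1)), Store (Plus (V ''t'') (N 1)) (V ''c''),
     Assign ''u'' (N 0), Assign ''p'' (V ''i''),
     While (Less (V ''u'') (V ''n'')) (block
       [Cond (And (Less (N 0) (Mem (mark ''h''))) (Not (Eq (Mem (V ''p'')) (N j))))
          (Seq (Store (mark ''t'') (N 1)) (Ask (V ''u'')))
          (Store (mark ''t'') (N 0)),
        incr ''u'' (N 1), incr ''p'' (V ''Z'')]),
     Call ''r'',
     Cond (Less (N 0) (V ''r'')) (incr ''t'' (Plus (V ''n'') (N 2))) Skip]"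

definition output_head :: com where
  "output_head = block
    [Assign ''u'' (N 0),
     While (Less (V ''u'') (V ''n'')) (Seq
       (Cond (Less (N 0) (Mem (mark ''h''))) (Write (V ''u'')) Skip) (incr ''u'' (N 1))),
     Emit]"

definition pop :: com where
  "pop = incr ''h'' (Plus (V ''n'') (N 2))"

text \<open>The unchanged set reuses the head entry in place. It is known to contain a witness
  already, so no oracle call is made for it.\<close>

definition advance :: com where
  "advance = Cond (Less (V ''c'') (V ''k''))
    (Seq (Store (V ''h'') (Plus (V ''i'') (N 1))) (Store (Plus (V ''h'') (N 1)) (Plus (V ''c'') (N 1))))
    pop"

definition branch :: com where
  "branch = block [push 1, push 2, advance]"

definition process_head :: com where
  "process_head = block
    [Assign ''i'' (Mem (V ''h'')), Assign ''c'' (Mem (Plus (V ''h'') (N 1))),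
     Cond (Less (V ''i'') (V ''Z''))
       (Seq scan
         (Cond (And (Less (N 0) (V ''a'')) (Less (N 0) (V ''b'')))
           branch
           (Store (V ''h'') (Plus (V ''i'') (N 1)))))
       (Seq output_head pop)]"

definition search_all :: com where
  "search_all = While (Less (V ''h'') (V ''t'')) process_head"

text \<open>The first query establishes that the root of the search contains a witness. For
  \<open>k = 0\<close> a positive answer means that the empty set is the only witness; this case is
  separate because the root already consists of one cell.\<close>

definition enumerate_witnesses :: com where
  "enumerate_witnesses = block
    [query_all,
     Cond (Less (N 0) (V ''r''))
       (Cond (Less (N 0) (V ''k'')) (block [size_up, fill_table, init_queue, search_all]) Emit)
       Skip]"

section \<open>The search tree of a sequence of splits\<close>

locale search =
  fixes n k :: nat and side :: "nat \<Rightarrow> nat \<Rightarrow> nat" and ora :: "nat set \<Rightarrow> bool"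
begin

definition part :: "nat \<Rightarrow> nat \<Rightarrow> nat set" where
  "part i j = {u. side i u = j}"

definition active :: "nat \<Rightarrow> nat set \<Rightarrow> bool" where
  "active i X \<longleftrightarrow> X \<inter> part i 1 \<noteq> {} \<and> X \<inter> part i 2 \<noteq> {}"

text \<open>\<open>m\<close> counts the steps that are left, \<open>i\<close> is the next step and
  \<open>c\<close> the number of cells that make up \<open>X\<close>. The three recursions follow
  the same tree; they describe the output, the oracle calls and the rounds of the main loop.\<close>

primrec leaves :: "nat \<Rightarrow> nat \<Rightarrow> nat \<Rightarrow> nat set \<Rightarrow> nat set list" where
  "leaves 0 i c X = [X]"
| "leaves (Suc m) i c X =
    (if active i X then
       (if c < k then leaves m (Suc i) (Suc c) X else [])
       @ (if ora (X - part i 1) then leaves m (Suc i) c (X - part i 1) else [])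
       @ (if ora (X - part i 2) then leaves m (Suc i) c (X - part i 2) else [])
     else leaves m (Suc i) c X)"

primrec ncalls :: "nat \<Rightarrow> nat \<Rightarrow> nat \<Rightarrow> nat set \<Rightarrow> nat" where
  "ncalls 0 i c X = 0"
| "ncalls (Suc m) i c X =
    (if active i X then
       2 + (if c < k then ncalls m (Suc i) (Suc c) X else 0)
       + (if ora (X - part i 1) then ncalls m (Suc i) c (X - part i 1) else 0)
       + (if ora (X - part i 2) then ncalls m (Suc i) c (X - part i 2) else 0)
     else ncalls m (Suc i) c X)"

primrec niter :: "nat \<Rightarrow> nat \<Rightarrow> nat \<Rightarrow> nat set \<Rightarrow> nat" where
  "niter 0 i c X = 1"
| "niter (Suc m) i c X =
    1 + (if active i X then
       (if c < k then niter m (Suc i) (Suc c) X else 0)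
       + (if ora (X - part i 1) then niter m (Suc i) c (X - part i 1) else 0)
       + (if ora (X - part i 2) then niter m (Suc i) c (X - part i 2) else 0)
     else niter m (Suc i) c X)"

text \<open>An active node has at most three children and makes two calls, so its two additional
  branches are paid for by calls. The tree thus decomposes into at most
  \<open>1 + ncalls m i c X\<close> chains, each with at most \<open>m + 1\<close> nodes.\<close>

lemma niter_le: "niter m i c X \<le> (m + 1) * (1 + ncalls m i c X)"
proof (induction m arbitrary: i c X)
  case (Suc m)
  let ?f = "\<lambda>b c X. if b then niter m (Suc i) c X else 0"
  let ?g = "\<lambda>b c X. if b then ncalls m (Suc i) c X else 0"
  have *: "?f b c X \<le> (m + 1) * (1 + ?g b c X)" for b c X
    using Suc.IH[of "Suc i" c X] by auto
  show ?case
  proof (cases "active i X")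
    case True
    let ?s = "?g (c < k) (Suc c) X + ?g (ora (X - part i 1)) c (X - part i 1)
                + ?g (ora (X - part i 2)) c (X - part i 2)"
    have "niter (Suc m) i c X \<le> 1 + (m + 1) * (3 + ?s)"
      using *[of "c < k" "Suc c" X] *[of "ora (X - part i 1)" c "X - part i 1"]
        *[of "ora (X - part i 2)" c "X - part i 2"] True
      by (simp add: algebra_simps)
    \<comment> \<open>\<open>3 + ?s\<close> equals \<open>1 + ncalls (Suc m) i c X\<close>: the
      three units of the children are the unit of the parent and its two calls.\<close>
    also have "\<dots> \<le> (Suc m + 1) * (1 + ncalls (Suc m) i c X)"
      using True by (simp add: algebra_simps)
    finally show ?thesis .
  next
    case False
    with Suc.IH[of "Suc i" c X] show ?thesis by simp
  qed
qed auto

end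

text \<open>The labels of cells change from step to step, so cells of different steps can only be
  compared through the equivalence relation that the labels induce.\<close>

lemma card_image_same_kernel:
  assumes "\<And>u w. u \<in> Y \<Longrightarrow> w \<in> Y \<Longrightarrow> f u = f w \<longleftrightarrow> g u = g w"
  shows "card (f ` Y) = card (g ` Y)"
proof -
  have "bij_betw (\<lambda>x. g (SOME u. u \<in> Y \<and> f u = x)) (f ` Y) (g ` Y)"
  proof -
    have *: "g (SOME w. w \<in> Y \<and> f w = f u) = g u" if "u \<in> Y" for u
      using someI[of "\<lambda>w. w \<in> Y \<and> f w = f u" u] that assms by blast
    show ?thesis
      unfolding bij_betw_def inj_on_def using * assms by (force simp: image_image)
  qed
  then show ?thesis by (rule bij_betw_same_card)
qed

text \<open>\<open>cl i u\<close> is the cell of \<open>u\<close> before step \<open>i\<close>, and step \<open>i\<close> splits the cell \<open>v i\<close>.\<close>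

locale split_tree = search +
  fixes T :: nat and cl :: "nat \<Rightarrow> nat \<Rightarrow> nat" and v :: "nat \<Rightarrow> nat" and \<W> :: "nat set set"
  assumes k_pos: "k > 0"
    and witness: "\<And>W. W \<in> \<W> \<Longrightarrow> W \<subseteq> {..<n} \<and> card W = k"
    and ora: "\<And>X. X \<subseteq> {..<n} \<Longrightarrow> ora X \<longleftrightarrow> (\<exists>W\<in>\<W>. W \<subseteq> X)"
    and side_le: "\<And>i u. 1 \<le> i \<Longrightarrow> i < T \<Longrightarrow> u < n \<Longrightarrow> side i u \<le> 2"
    and side_pos: "\<And>i u. 1 \<le> i \<Longrightarrow> i < T \<Longrightarrow> u < n \<Longrightarrow> side i u \<noteq> 0 \<longleftrightarrow> cl i u = v i"
    and cl_Suc: "\<And>i u w. 1 \<le> i \<Longrightarrow> i < T \<Longrightarrow> u < n \<Longrightarrow> w < n \<Longrightarrow>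
      cl (Suc i) u = cl (Suc i) w \<longleftrightarrow> cl i u = cl i w \<and> side i u = side i w"
    and cl_first: "\<And>u w. u < n \<Longrightarrow> w < n \<Longrightarrow> cl 1 u = cl 1 w"
    and cl_last: "\<And>u w. u < n \<Longrightarrow> w < n \<Longrightarrow> cl T u = cl T w \<Longrightarrow> u = w"
begin

text \<open>A set is judged by its own stage alone, without the history of the search. This is what
  allows it to be encoded and counted later.\<close>

definition nodes :: "nat \<Rightarrow> nat set set" where
  "nodes i = {X. X \<subseteq> {..<n} \<and> (\<forall>u\<in>X. \<forall>w<n. cl i w = cl i u \<longrightarrow> w \<in> X)
     \<and> card (cl i ` X) \<le> k \<and> (\<exists>W\<in>\<W>. W \<subseteq> X)}"

text \<open>The descendants of \<open>X\<close> at stage \<open>j\<close>: coarsening the cells of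
  \<open>Y\<close> to stage \<open>i\<close> gives the cells of \<open>X\<close>. Descent becomes an
  equation between label sets, and paths in the search tree need not be mentioned.\<close>

definition below :: "nat \<Rightarrow> nat set \<Rightarrow> nat \<Rightarrow> nat set set" where
  "below i X j = {Y \<in> nodes j. cl i ` Y = cl i ` X}"

lemma nodesD:
  assumes "X \<in> nodes i"
  shows "X \<subseteq> {..<n}" "\<And>u w. u \<in> X \<Longrightarrow> w < n \<Longrightarrow> cl i w = cl i u \<Longrightarrow> w \<in> X"
    "card (cl i ` X) \<le> k" "finite X"
  using assms unfolding nodes_def by (auto intro: finite_subset)

lemma finite_nodes: "finite (nodes i)"
  by (rule finite_subset[of _ "Pow {..<n}"]) (auto simp: nodes_def)

text \<open>A node is a union of cells, so it is recovered from their labels.\<close>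

lemma nodes_eqI:
  assumes "X \<in> nodes i" "X' \<in> nodes i" "cl i ` X = cl i ` X'"
  shows "X = X'"
proof -
  have "A \<subseteq> B" if "A \<in> nodes i" "B \<in> nodes i" and im: "cl i ` A = cl i ` B" for A B
  proof
    fix u assume "u \<in> A"
    then obtain w where "w \<in> B" "cl i u = cl i w" using im by (metis imageE imageI)
    then show "u \<in> B" using nodesD(2)[OF that(2)] nodesD(1)[OF that(1)] \<open>u \<in> A\<close> by auto
  qed
  with assms show ?thesis by (metis subset_antisym)
qed

lemma card_cl_Suc:
  assumes "1 \<le> i" "i < T" "Y \<subseteq> {..<n}"
  shows "card (cl (Suc i) ` Y) = card (cl i ` Y) + (if active i Y then 1 else 0)"
proof -
  \<comment> \<open>If \<open>Y\<close> misses one half, equal old labels force equal sides, so old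
    and new labels have the same kernel on \<open>Y\<close>.\<close>
  have same: "card (cl (Suc i) ` Y) = card (cl i ` Y)" if "\<not> active i Y" "Y \<subseteq> {..<n}" for Y
  proof (rule card_image_same_kernel)
    fix u w assume uw: "u \<in> Y" "w \<in> Y"
    then have lt: "u < n" "w < n" using that by auto
    have "side i u = side i w" if "cl i u = cl i w"
    proof -
      have "side i u = 0 \<longleftrightarrow> side i w = 0"
        using side_pos[of i] assms lt that by metis
      moreover have "side i u \<le> 2" "side i w \<le> 2" using side_le assms lt by auto
      moreover have "\<not> (side i u = 1 \<and> side i w = 2)" "\<not> (side i u = 2 \<and> side i w = 1)"
        using \<open>\<not> active i Y\<close> uw unfolding active_def part_def by auto
      ultimately show ?thesis by linarith
    qed
    then show "cl (Suc i) u = cl (Suc i) w \<longleftrightarrow> cl i u = cl i w"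
      using cl_Suc[of i u w] assms lt by blast
  qed
  show ?thesis
  proof (cases "active i Y")
    case True
    then obtain a b where ab: "a \<in> Y" "side i a = 1" "b \<in> Y" "side i b = 2"
      unfolding active_def part_def by auto
    let ?Z = "Y - part i 1"
    have fin: "finite Y" using assms finite_subset by blast
    have cla: "cl i a = v i" "cl i b = v i"
      using side_pos[of i a] side_pos[of i b] ab assms by auto
    \<comment> \<open>All elements of \<open>Y\<close> on side 1 share one new label that no other
      element has; without them the set is inactive and \<open>same\<close> applies.\<close>
    have "cl (Suc i) ` Y = insert (cl (Suc i) a) (cl (Suc i) ` ?Z)"
    proof -
      have "cl (Suc i) u = cl (Suc i) a" if "u \<in> Y" "side i u = 1" for u
        using cl_Suc[of i u a] side_pos[of i u] that cla ab assms by auto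
      then show ?thesis using ab(1) unfolding part_def by blast
    qed
    moreover have "cl (Suc i) a \<notin> cl (Suc i) ` ?Z"
    proof
      assume "cl (Suc i) a \<in> cl (Suc i) ` ?Z"
      then obtain x where x: "x \<in> Y" "side i x \<noteq> 1" "cl (Suc i) a = cl (Suc i) x"
        by (auto simp: part_def)
      then have "side i a = side i x" using cl_Suc[of i a x] ab(1) assms by (meson lessThan_iff subsetD)
      then show False using x ab by simp
    qed
    ultimately have "card (cl (Suc i) ` Y) = Suc (card (cl (Suc i) ` ?Z))"
      using fin by (simp add: card_insert_if)
    also have "card (cl (Suc i) ` ?Z) = card (cl i ` ?Z)"
      using assms by (intro same) (auto simp: active_def)
    also have "cl i ` ?Z = cl i ` Y"
    proof -
      have "cl i u \<in> cl i ` ?Z" if "u \<in> Y" for u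
      proof (cases "side i u = 1")
        case True
        then have "cl i u = cl i b" using side_pos[of i u] that assms cla by auto
        then show ?thesis using ab by (auto simp: part_def)
      qed (use that in \<open>auto simp: part_def\<close>)
      then show ?thesis by blast
    qed
    finally show ?thesis using True by simp
  qed (use same assms in auto)
qed

text \<open>A new label amounts to an old label together with a side. Outside the split cell the
  side is 0, and inside it \<open>hit\<close> says which sides occur.\<close>

lemma cl_image_Suc:
  assumes i: "1 \<le> i" "i < T" and XY: "X \<subseteq> {..<n}" "Y \<subseteq> {..<n}" "cl i ` Y = cl i ` X"
    and hit: "\<And>j. j \<in> {1, 2} \<Longrightarrow> X \<inter> part i j = {} \<longleftrightarrow> Y \<inter> part i j = {}"
  shows "cl (Suc i) ` Y = cl (Suc i) ` X"
proof -
  have "cl (Suc i) ` A \<subseteq> cl (Suc i) ` B"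
    if "A \<subseteq> {..<n}" "B \<subseteq> {..<n}" and im: "cl i ` A = cl i ` B"
      and hit: "\<And>j. j \<in> {1, 2} \<Longrightarrow> A \<inter> part i j = {} \<longleftrightarrow> B \<inter> part i j = {}" for A B
  proof
    fix x assume "x \<in> cl (Suc i) ` A"
    then obtain u where u: "u \<in> A" "x = cl (Suc i) u" by auto
    then have un: "u < n" using that by auto
    obtain w where w: "w \<in> B" "cl i u = cl i w" using im u by (metis imageE imageI)
    then have wn: "w < n" using that by auto
    show "x \<in> cl (Suc i) ` B"
    proof (cases "side i u = 0")
      case True
      then have "side i w = 0" using side_pos[of i] i un wn w by metis
      then show ?thesis using cl_Suc[of i u w] True i un wn w u by auto
    next
      case False
      then have j: "side i u \<in> {1, 2}" using side_le[of i u] i un by auto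
      then have "A \<inter> part i (side i u) \<noteq> {}" using u by (auto simp: part_def)
      then obtain w' where w': "w' \<in> B" "side i w' = side i u"
        using hit[OF j] by (auto simp: part_def)
      then have "w' < n" using that by auto
      moreover have "cl i w' = cl i u"
        using side_pos[of i] False w' i un \<open>w' < n\<close> by metis
      ultimately show ?thesis using cl_Suc[of i u w'] i un u w' by auto
    qed
  qed
  from this[of X Y] this[of Y X] show ?thesis using assms by auto
qed

lemma cl_image_Suc_D:
  assumes "1 \<le> i" "i < T" and "X \<subseteq> {..<n}" "Y \<subseteq> {..<n}" "cl (Suc i) ` Y = cl (Suc i) ` X"
  shows "cl i ` Y = cl i ` X"
proof -
  have "cl i ` A \<subseteq> cl i ` B"
    if "A \<subseteq> {..<n}" "B \<subseteq> {..<n}" and im: "cl (Suc i) ` A = cl (Suc i) ` B" for A B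
  proof
    fix x assume "x \<in> cl i ` A"
    then obtain u where u: "u \<in> A" "x = cl i u" by auto
    then obtain w where "w \<in> B" "cl (Suc i) u = cl (Suc i) w" using im by (metis imageE imageI)
    then show "x \<in> cl i ` B" using cl_Suc[of i u w] u that assms by auto
  qed
  from this[of X Y] this[of Y X] show ?thesis using assms by auto
qed

text \<open>The other half remains and still represents the split cell, so no old label is
  lost.\<close>

lemma cl_image_remove:
  assumes i: "1 \<le> i" "i < T" and X: "X \<subseteq> {..<n}" "active i X" and j: "j \<in> {1, 2}"
  shows "cl i ` (X - part i j) = cl i ` X"
proof -
  obtain b where b: "b \<in> X - part i j" "side i b \<noteq> 0"
  proof -
    have "X \<inter> part i (3 - j) \<noteq> {}" using X(2) j unfolding active_def by auto
    then obtain b where "b \<in> X" "side i b = 3 - j" by (auto simp: part_def)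
    then show ?thesis using that[of b] j by (auto simp: part_def)
  qed
  have "cl i u \<in> cl i ` (X - part i j)" if "u \<in> X" for u
  proof (cases "side i u = j")
    case True
    then have "cl i u = v i" using side_pos[of i u] j i that X by auto
    moreover have "cl i b = v i" using side_pos[of i b] b i X by auto
    ultimately show ?thesis using b by (metis imageI)
  qed (use that in \<open>auto simp: part_def\<close>)
  then show ?thesis by blast
qed

lemma nodes_keep:
  assumes "1 \<le> i" "i < T" "X \<in> nodes i" "active i X \<Longrightarrow> card (cl i ` X) < k"
  shows "X \<in> nodes (Suc i)"
proof -
  note X = nodesD[OF assms(3)]
  have "card (cl (Suc i) ` X) \<le> k" using card_cl_Suc[of i X] X(1,3) assms(1,2,4) by (simp add: Suc_le_eq)
  moreover have "w \<in> X" if "u \<in> X" "w < n" "cl (Suc i) w = cl (Suc i) u" for u w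
    using that cl_Suc[of i w u] X(1) X(2)[of u w] assms(1,2) by blast
  moreover have "\<exists>W\<in>\<W>. W \<subseteq> X" using assms(3) unfolding nodes_def by simp
  ultimately show ?thesis using X(1) unfolding nodes_def mem_Collect_eq by blast
qed

text \<open>Removing a half trades the split cell for its other half, so the number of cells stays
  the same; the positive oracle answer supplies the witness.\<close>

lemma nodes_remove:
  assumes i: "1 \<le> i" "i < T" and X: "X \<in> nodes i" "active i X" and j: "j \<in> {1, 2}"
    and ora_j: "ora (X - part i j)"
  shows "X - part i j \<in> nodes (Suc i)" "card (cl (Suc i) ` (X - part i j)) = card (cl i ` X)"
proof -
  have "\<not> active i (X - part i j)" using j by (auto simp: active_def)
  moreover have sub: "X - part i j \<subseteq> {..<n}" using nodesD(1)[OF X(1)] by auto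
  ultimately show c: "card (cl (Suc i) ` (X - part i j)) = card (cl i ` X)"
    using card_cl_Suc[of i "X - part i j"] cl_image_remove[of i X j] assms nodesD(1)[OF X(1)] by simp
  have "\<exists>W\<in>\<W>. W \<subseteq> X - part i j" using ora[OF sub] ora_j by simp
  moreover have "w \<in> X - part i j"
    if "u \<in> X - part i j" "w < n" "cl (Suc i) w = cl (Suc i) u" for u w
  proof -
    have "cl i w = cl i u" "side i w = side i u"
      using that cl_Suc[of i w u] i nodesD(1)[OF X(1)] by blast+
    then show ?thesis using nodesD(2)[OF X(1), of u w] that by (simp add: part_def)
  qed
  moreover have "card (cl (Suc i) ` (X - part i j)) \<le> k" using c nodesD(3)[OF X(1)] by simp
  ultimately show "X - part i j \<in> nodes (Suc i)"
    using sub unfolding nodes_def mem_Collect_eq by blast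
qed

text \<open>Stage \<open>Suc i\<close> refines stage \<open>i\<close>, so a descendant of a child is
  a descendant of the parent.\<close>

lemma below_mono:
  assumes "1 \<le> i" "i < T" "X' \<subseteq> {..<n}" "X \<subseteq> {..<n}" "cl i ` X' = cl i ` X"
  shows "below (Suc i) X' j \<subseteq> below i X j"
proof
  fix Y assume "Y \<in> below (Suc i) X' j"
  then have Y: "Y \<in> nodes j" "cl (Suc i) ` Y = cl (Suc i) ` X'" unfolding below_def by auto
  then have "cl i ` Y = cl i ` X'"
    using cl_image_Suc_D[OF assms(1,2,3) nodesD(1)[OF Y(1)] Y(2)] by simp
  then show "Y \<in> below i X j" using Y(1) assms(5) unfolding below_def by simp
qed

text \<open>A descendant determines the labels of its ancestor at stage \<open>i\<close> and thereby
  the ancestor itself. This is why nothing is found twice.\<close>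

lemma below_disjoint:
  assumes "X \<in> nodes i" "X' \<in> nodes i" "X \<noteq> X'"
  shows "below i X j \<inter> below i X' j = {}"
  using nodes_eqI[OF assms(1,2)] assms(3) unfolding below_def by auto

lemma below_self: "X \<in> nodes i \<Longrightarrow> X \<in> below i X i"
  unfolding below_def by auto

lemma parts_disjoint: "part i 1 \<inter> part i 2 = {}"
  by (auto simp: part_def)

lemma finite_below [simp]: "finite (below i X j)"
  unfolding below_def using finite_nodes by simp

text \<open>Every active node is charged its two calls. The descendants of different children are
  different, so the recursive sums add up to a count in which each node occurs once.\<close>

lemma ncalls_le:
  assumes "1 \<le> i" "i + m = T" "X \<in> nodes i" "c = card (cl i ` X)"
  shows "ncalls m i c X \<le> 2 * (\<Sum>j=i..<T. card {Y \<in> below i X j. active j Y})"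
  using assms
proof (induction m arbitrary: i c X)
  case 0
  show ?case by simp
next
  case (Suc m)
  define f where "f i X j = card {Y \<in> below i X j. active j Y}" for i X j
  have i: "1 \<le> i" "i < T" using Suc.prems by auto
  note Xn = nodesD(1)[OF Suc.prems(3)]
  have sum_split: "(\<Sum>j=i..<T. f i X j) = f i X i + (\<Sum>j=Suc i..<T. f i X j)"
    using i by (simp add: sum.atLeast_Suc_lessThan)
  have IH: "ncalls m (Suc i) c' X' \<le> 2 * (\<Sum>j=Suc i..<T. f (Suc i) X' j)"
    if "X' \<in> nodes (Suc i)" "c' = card (cl (Suc i) ` X')" for c' X'
    using Suc.IH[of "Suc i" X' c'] that Suc.prems(1,2) unfolding f_def by simp
  show ?case
  proof (cases "active i X")
    case False
    have X': "X \<in> nodes (Suc i)" "c = card (cl (Suc i) ` X)"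
      using nodes_keep[OF i Suc.prems(3)] False card_cl_Suc[OF i Xn] Suc.prems by auto
    have "f (Suc i) X j \<le> f i X j" for j
      unfolding f_def using below_mono[of i X X j] i Xn by (intro card_mono) auto
    then have "(\<Sum>j=Suc i..<T. f (Suc i) X j) \<le> (\<Sum>j=Suc i..<T. f i X j)" by (intro sum_mono)
    then have "ncalls (Suc m) i c X \<le> 2 * (\<Sum>j=i..<T. f i X j)"
      using IH[OF X'] False sum_split by simp
    then show ?thesis unfolding f_def .
  next
    case True
    \<comment> \<open>\<open>K\<close> consists of the children that are visited; the three
      candidates are distinct because \<open>X\<close> meets both halves.\<close>
    define K where "K = (if c < k then {X} else {}) \<union> (if ora (X - part i 1) then {X - part i 1} else {})
      \<union> (if ora (X - part i 2) then {X - part i 2} else {})"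
    have ne: "X \<noteq> X - part i 1" "X \<noteq> X - part i 2" "X - part i 1 \<noteq> X - part i 2"
      using True parts_disjoint[of i] unfolding active_def by blast+
    have KN: "Y \<in> nodes (Suc i)" "cl i ` Y = cl i ` X" if YK: "Y \<in> K" for Y
    proof -
      consider "Y = X" "c < k" | j where "Y = X - part i j" "ora (X - part i j)" "j \<in> {1, 2}"
        using YK unfolding K_def by (auto split: if_splits simp del: One_nat_def)
      then have "Y \<in> nodes (Suc i) \<and> cl i ` Y = cl i ` X"
      proof cases
        case 1
        then show ?thesis using nodes_keep[OF i Suc.prems(3)] Suc.prems(4) by simp
      next
        case 2
        then show ?thesis
          using nodes_remove(1)[OF i Suc.prems(3) True 2(3,2)] cl_image_remove[OF i Xn True 2(3)]
          by simp
      qed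
      then show "Y \<in> nodes (Suc i)" "cl i ` Y = cl i ` X" by auto
    qed
    have finK: "finite K" by (auto simp: K_def)
    have fK: "(\<Sum>Y\<in>K. f (Suc i) Y j) \<le> f i X j" for j
    proof -
      have "(\<Sum>Y\<in>K. f (Suc i) Y j) = card (\<Union>Y\<in>K. {Y' \<in> below (Suc i) Y j. active j Y'})"
        unfolding f_def
      proof (rule card_UN_disjoint[symmetric])
        show "\<forall>Y\<in>K. \<forall>Y'\<in>K. Y \<noteq> Y' \<longrightarrow>
            {Z \<in> below (Suc i) Y j. active j Z} \<inter> {Z \<in> below (Suc i) Y' j. active j Z} = {}"
          using KN(1) below_disjoint[of _ "Suc i" _ j] by blast
      qed (use finK in auto)
      also have "\<dots> \<le> f i X j"
        unfolding f_def
      proof (rule card_mono)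
        show "(\<Union>Y\<in>K. {Y' \<in> below (Suc i) Y j. active j Y'}) \<subseteq> {Y \<in> below i X j. active j Y}"
        proof clarify
          fix Y Y' assume "Y \<in> K" "Y' \<in> below (Suc i) Y j" "active j Y'"
          then show "Y' \<in> below i X j"
            using below_mono[OF i nodesD(1)[OF KN(1)] Xn KN(2), of Y j] by (rule_tac subsetD)
        qed
      qed simp
      finally show ?thesis .
    qed
    define g where "g Y = (\<Sum>j=Suc i..<T. f (Suc i) Y j)" for Y
    have "f i X i \<ge> 1"
    proof -
      have "X \<in> {Y \<in> below i X i. active i Y}" using True below_self[OF Suc.prems(3)] by auto
      then have "card {Y \<in> below i X i. active i Y} > 0" by (subst card_gt_0_iff) auto
      then show ?thesis unfolding f_def by simp
    qed
    moreover have "(\<Sum>Y\<in>K. g Y) \<le> (\<Sum>j=Suc i..<T. f i X j)"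
    proof -
      have "(\<Sum>Y\<in>K. g Y) = (\<Sum>j=Suc i..<T. \<Sum>Y\<in>K. f (Suc i) Y j)"
        unfolding g_def by (rule sum.swap)
      also have "\<dots> \<le> (\<Sum>j=Suc i..<T. f i X j)" by (intro sum_mono fK)
      finally show ?thesis .
    qed
    moreover have "ncalls (Suc m) i c X \<le> 2 + 2 * (\<Sum>Y\<in>K. g Y)"
    proof -
      have 1: "ncalls m (Suc i) (Suc c) X \<le> 2 * g X" if "c < k"
        unfolding g_def using that nodes_keep[OF i Suc.prems(3)] card_cl_Suc[OF i Xn] True Suc.prems(4)
        by (intro IH) auto
      have 2: "ncalls m (Suc i) c (X - part i j) \<le> 2 * g (X - part i j)"
        if "ora (X - part i j)" "j \<in> {1, 2}" for j
        unfolding g_def using nodes_remove[OF i Suc.prems(3) True that(2,1)] Suc.prems(4)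
        by (intro IH) auto
      have "(\<Sum>Y\<in>K. g Y) = (if c < k then g X else 0)
          + (if ora (X - part i 1) then g (X - part i 1) else 0)
          + (if ora (X - part i 2) then g (X - part i 2) else 0)"
        unfolding K_def
        by (cases "c < k"; cases "ora (X - part i 1)"; cases "ora (X - part i 2)")
           (simp_all add: ne ne[symmetric] del: One_nat_def)
      then show ?thesis
        using True 1 2[of 1] 2[of 2]
        by (cases "c < k"; cases "ora (X - part i 1)"; cases "ora (X - part i 2)")
           (simp_all del: One_nat_def)
    qed
    ultimately have "ncalls (Suc m) i c X \<le> 2 * (\<Sum>j=i..<T. f i X j)" using sum_split by simp
    then show ?thesis unfolding f_def .
  qed
qed

text \<open>At the last stage the cells are singletons, so a node has at most \<open>k\<close>
  elements and contains a witness with \<open>k\<close> elements: it is this witness.\<close>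

lemma nodes_last:
  assumes "T \<ge> 1"
  shows "nodes T = \<W>"
proof -
  have inj: "inj_on (cl T) X" if "X \<subseteq> {..<n}" for X
    using that cl_last by (meson inj_onI lessThan_iff subset_iff)
  have "X \<in> \<W>" if "X \<in> nodes T" for X
  proof -
    from that obtain W where W: "W \<in> \<W>" "W \<subseteq> X" unfolding nodes_def by auto
    have "card X \<le> card W"
      using nodesD(1,3)[OF that] inj[of X] witness[OF W(1)] by (simp add: card_image)
    then have "W = X" using W nodesD(4)[OF that] by (simp add: card_seteq)
    then show ?thesis using W by simp
  qed
  moreover have "W \<in> nodes T" if "W \<in> \<W>" for W
    using witness[OF that] inj[of W] that cl_last unfolding nodes_def
    by (auto simp: card_image)
  ultimately show ?thesis by auto
qed

text \<open>For completeness let \<open>Y\<close> be a witness below \<open>X\<close>. If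
  \<open>Y\<close> meets both halves, it meets \<open>c + 1\<close> new cells with only
  \<open>k\<close> elements, so \<open>c < k\<close> and \<open>X\<close> itself is kept. Otherwise
  \<open>Y\<close> avoids a half and survives its removal, and the oracle agrees because
  \<open>Y\<close> is a witness. Disjointness of the children gives distinctness.\<close>

lemma leaves_eq:
  assumes "1 \<le> i" "i + m = T" "X \<in> nodes i" "c = card (cl i ` X)"
  shows "distinct (leaves m i c X) \<and> set (leaves m i c X) = below i X T"
  using assms
proof (induction m arbitrary: i c X)
  case 0
  then show ?case using nodes_eqI[of _ T X] below_self[of X T] unfolding below_def by auto
next
  case (Suc m)
  have i: "1 \<le> i" "i < T" using Suc.prems by auto
  note Xn = nodesD(1)[OF Suc.prems(3)]
  have IH: "distinct (leaves m (Suc i) c' X') \<and> set (leaves m (Suc i) c' X') = below (Suc i) X' T"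
    if "X' \<in> nodes (Suc i)" "c' = card (cl (Suc i) ` X')" for c' X'
    using Suc.IH[of "Suc i" X' c'] that Suc.prems by auto
  \<comment> \<open>The last clause holds because \<open>Y\<close> has an element in every cell of
    \<open>X\<close>, in particular in the split cell if \<open>X\<close> meets it.\<close>
  have hits: "Y \<subseteq> X" "Y \<subseteq> {..<n}" "card Y \<le> k" "ora Y"
    "X \<inter> (part i 1 \<union> part i 2) \<noteq> {} \<Longrightarrow> Y \<inter> (part i 1 \<union> part i 2) \<noteq> {}"
    if Y: "Y \<in> below i X T" for Y
  proof -
    have YT: "Y \<in> nodes T" "cl i ` Y = cl i ` X" using Y unfolding below_def by auto
    show Yn: "Y \<subseteq> {..<n}" using nodesD(1)[OF YT(1)] .
    show "card Y \<le> k" "ora Y"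
      using YT(1) nodes_last i witness ora[OF Yn] by auto
    show "Y \<subseteq> X"
    proof
      fix u assume "u \<in> Y"
      then obtain w where "w \<in> X" "cl i u = cl i w" using YT(2) by (metis imageE imageI)
      then show "u \<in> X" using nodesD(2)[OF Suc.prems(3)] Yn \<open>u \<in> Y\<close> by auto
    qed
    assume "X \<inter> (part i 1 \<union> part i 2) \<noteq> {}"
    then obtain x where x: "x \<in> X" "side i x \<noteq> 0" unfolding part_def by fastforce
    then obtain y where y: "y \<in> Y" "cl i y = cl i x" using YT(2) by (metis imageE imageI)
    then have "side i y \<noteq> 0" using side_pos[of i] x i Xn Yn by (metis lessThan_iff subsetD)
    then have "side i y \<in> {1, 2}" using side_le[of i y] i y Yn by auto
    then show "Y \<inter> (part i 1 \<union> part i 2) \<noteq> {}" using y by (auto simp: part_def)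
  qed
  show ?case
  proof (cases "active i X")
    case False
    have X': "X \<in> nodes (Suc i)" "c = card (cl (Suc i) ` X)"
      using nodes_keep[OF i Suc.prems(3)] False card_cl_Suc[OF i Xn] Suc.prems by auto
    have "below i X T \<subseteq> below (Suc i) X T"
    proof
      fix Y assume Y: "Y \<in> below i X T"
      have "cl (Suc i) ` Y = cl (Suc i) ` X"
      proof (rule cl_image_Suc[OF i Xn hits(2)[OF Y]])
        show "cl i ` Y = cl i ` X" using Y unfolding below_def by auto
        show "X \<inter> part i j = {} \<longleftrightarrow> Y \<inter> part i j = {}" if "j \<in> {1, 2}" for j
          using hits(1,5)[OF Y] False that unfolding active_def by blast
      qed
      then show "Y \<in> below (Suc i) X T" using Y unfolding below_def by auto
    qed
    then have "below (Suc i) X T = below i X T" using below_mono[of i X X T] i Xn by auto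
    then show ?thesis using IH[OF X'] False by simp
  next
    case True
    let ?X = "\<lambda>j. X - part i j"
    have ne: "X \<noteq> ?X 1" "X \<noteq> ?X 2" "?X 1 \<noteq> ?X 2"
      using True parts_disjoint[of i] unfolding active_def by blast+
    have keep: "X \<in> nodes (Suc i) \<and> Suc c = card (cl (Suc i) ` X)" if "c < k"
      using that nodes_keep[OF i Suc.prems(3)] card_cl_Suc[OF i Xn] True Suc.prems(4) by auto
    have rem: "?X j \<in> nodes (Suc i) \<and> c = card (cl (Suc i) ` ?X j)"
      if "ora (?X j)" "j \<in> {1, 2}" for j
      using nodes_remove[OF i Suc.prems(3) True that(2,1)] Suc.prems(4) by auto
    let ?bk = "if c < k then below (Suc i) X T else {}"
    let ?b = "\<lambda>j. if ora (?X j) then below (Suc i) (?X j) T else {}"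
    have disj: "?bk \<inter> ?b 1 = {}" "?bk \<inter> ?b 2 = {}" "?b 1 \<inter> ?b 2 = {}"
      using below_disjoint[of X "Suc i" "?X 1" T] below_disjoint[of X "Suc i" "?X 2" T]
        below_disjoint[of "?X 1" "Suc i" "?X 2" T] keep rem[of 1] rem[of 2] ne by auto
    have "?bk \<union> ?b 1 \<union> ?b 2 = below i X T"
    proof
      show "?bk \<union> ?b 1 \<union> ?b 2 \<subseteq> below i X T"
      proof -
        have "below (Suc i) (?X j) T \<subseteq> below i X T" if "j \<in> {1, 2}" for j
          using cl_image_remove[OF i Xn True that] i Xn by (intro below_mono) auto
        from this[of 1] this[of 2] show ?thesis using below_mono[of i X X T] i Xn by auto
      qed
      show "below i X T \<subseteq> ?bk \<union> ?b 1 \<union> ?b 2"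
      proof
        fix Y assume Y: "Y \<in> below i X T"
        have YT: "Y \<in> nodes T" "cl i ` Y = cl i ` X" using Y unfolding below_def by auto
        note h = hits[OF Y]
        show "Y \<in> ?bk \<union> ?b 1 \<union> ?b 2"
        proof (cases "active i Y")
          case aY: True
          have "finite Y" using h(2) finite_subset by blast
          then have "card (cl (Suc i) ` Y) \<le> k" using h(3) card_image_le[of Y "cl (Suc i)"] by simp
          then have "c < k" using card_cl_Suc[OF i h(2)] aY YT(2) Suc.prems(4) by simp
          moreover have "cl (Suc i) ` Y = cl (Suc i) ` X"
            using True aY unfolding active_def
            by (intro cl_image_Suc[OF i Xn h(2) YT(2)]) auto
          ultimately show ?thesis using YT unfolding below_def by auto
        next
          case False
          have "\<exists>j\<in>{1,2}. Y \<inter> part i j = {}" using False unfolding active_def by auto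
          then obtain j where j: "j \<in> {1, 2}" "Y \<inter> part i j = {}" by blast
          have sub: "Y \<subseteq> ?X j" using h(1) j by auto
          have subn: "?X j \<subseteq> {..<n}" using Xn by auto
          have "ora (?X j)" using h(4) sub ora[OF h(2)] ora[OF subn] by blast
          moreover have "cl (Suc i) ` Y = cl (Suc i) ` ?X j"
          proof (rule cl_image_Suc[OF i subn h(2)])
            show "cl i ` Y = cl i ` ?X j" using YT(2) cl_image_remove[OF i Xn True j(1)] by simp
            \<comment> \<open>\<open>Y\<close> meets the split cell but not side \<open>j\<close>,
              so it meets the other side, exactly like the set \<open>X - part i j\<close>.\<close>
            have *: "Y \<inter> (part i 1 \<union> part i 2) \<noteq> {}" using h(5) True unfolding active_def by auto
            show "?X j \<inter> part i l = {} \<longleftrightarrow> Y \<inter> part i l = {}" if "l \<in> {1, 2}" for l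
              using * j that sub True parts_disjoint[of i] unfolding active_def by auto
          qed
          ultimately show ?thesis using YT j unfolding below_def by auto
        qed
      qed
    qed
    then have un: "?bk \<union> (?b 1 \<union> ?b 2) = below i X T" by (simp only: Un_assoc)
    define l0 where "l0 = (if c < k then leaves m (Suc i) (Suc c) X else [])"
    define l where "l j = (if ora (?X j) then leaves m (Suc i) c (?X j) else [])" for j
    have l0: "distinct l0" "set l0 = ?bk"
      using IH[of X "Suc c"] keep unfolding l0_def by auto
    have l: "distinct (l j)" "set (l j) = ?b j" if "j \<in> {1, 2}" for j
      using IH[of "?X j" c] rem[of j] that unfolding l_def by auto
    have "leaves (Suc m) i c X = l0 @ l 1 @ l 2"
      using True unfolding l0_def l_def by simp
    moreover have "set l0 \<inter> set (l 1) = {}" "set l0 \<inter> set (l 2) = {}" "set (l 1) \<inter> set (l 2) = {}"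
      using disj l0(2) l(2)[of 1] l(2)[of 2] by blast+
    moreover have "set l0 \<union> (set (l 1) \<union> set (l 2)) = below i X T"
      using un l0(2) l(2)[of 1] l(2)[of 2] by blast
    ultimately show ?thesis
      using l0(1) l(1)[of 1] l(1)[of 2] by (simp add: Int_Un_distrib)
  qed
qed

text \<open>Before the first step there is a single cell, so every nonempty set descends from the
  whole universe; witnesses are nonempty because \<open>k > 0\<close>.\<close>

lemma root:
  assumes "T \<ge> 1" "W \<in> \<W>"
  shows "distinct (leaves (T - 1) 1 1 {..<n})" "set (leaves (T - 1) 1 1 {..<n}) = \<W>"
    "ncalls (T - 1) 1 1 {..<n} \<le> 2 * (\<Sum>j=1..<T. card {Y \<in> nodes j. active j Y})"
proof -
  have "n > 0" using witness[OF assms(2)] k_pos by (cases n) auto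
  have im: "cl 1 ` Y = {cl 1 0}" if "Y \<subseteq> {..<n}" "Y \<noteq> {}" for Y
  proof -
    have "cl 1 u = cl 1 0" if "u \<in> Y" for u
      using cl_first[of u 0] \<open>n > 0\<close> \<open>Y \<subseteq> {..<n}\<close> that by blast
    then have "cl 1 ` Y = (\<lambda>_. cl 1 0) ` Y" by (intro image_cong refl)
    then show ?thesis using \<open>Y \<noteq> {}\<close> by (simp add: image_constant_conv)
  qed
  have im': "cl 1 ` {..<n} = {cl 1 0}" using \<open>n > 0\<close> by (intro im) auto
  have c: "1 = card (cl 1 ` {..<n})" unfolding im' by simp
  have "card (cl 1 ` {..<n}) \<le> k" using k_pos unfolding im' by simp
  then have root: "{..<n} \<in> nodes 1"
    using witness[OF assms(2)] assms(2) unfolding nodes_def by blast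
  have "below 1 {..<n} T = nodes T"
  proof -
    have "Y \<noteq> {}" if "Y \<in> nodes T" for Y
      using that k_pos witness nodes_last[OF assms(1)] by fastforce
    then have "cl 1 ` Y = cl 1 ` {..<n}" if "Y \<in> nodes T" for Y
      using im[OF nodesD(1)[OF that]] that unfolding im' by simp
    then show ?thesis unfolding below_def by blast
  qed
  then show "distinct (leaves (T - 1) 1 1 {..<n})" "set (leaves (T - 1) 1 1 {..<n}) = \<W>"
    using leaves_eq[OF _ _ root c, of "T - 1"] assms(1) nodes_last[OF assms(1)] by auto
  have "ncalls (T - 1) 1 1 {..<n} \<le> 2 * (\<Sum>j=1..<T. card {Y \<in> below 1 {..<n} j. active j Y})"
    using ncalls_le[OF _ _ root c, of "T - 1"] assms(1) by simp
  also have "\<dots> \<le> 2 * (\<Sum>j=1..<T. card {Y \<in> nodes j. active j Y})"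
    using finite_nodes by (intro mult_left_mono sum_mono card_mono) (auto simp: below_def)
  finally show "ncalls (T - 1) 1 1 {..<n} \<le> 2 * (\<Sum>j=1..<T. card {Y \<in> nodes j. active j Y})" .
qed

end

section \<open>Splits along a random binary tree\<close>

text \<open>Halving climbs the heap until the value drops below \<open>2 * i\<close>. For
  \<open>1 \<le> i \<le> x\<close> the result is the ancestor of \<open>x\<close> on the cut
  \<open>{i..<2 * i}\<close>; the case \<open>i = 0\<close> secures termination.\<close>

fun anc :: "nat \<Rightarrow> nat \<Rightarrow> nat" where
  "anc i x = (if x < 2 * i \<or> i = 0 then x else anc i (x div 2))"

declare anc.simps [simp del]

lemma anc_small: "x < 2 * i \<Longrightarrow> anc i x = x"
  by (simp add: anc.simps)

lemma anc_step: "1 \<le> i \<Longrightarrow> 2 * i \<le> x \<Longrightarrow> anc i x = anc i (x div 2)"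
  by (simp add: anc.simps[of i x])

lemma anc_bounds: "1 \<le> i \<Longrightarrow> i \<le> x \<Longrightarrow> i \<le> anc i x \<and> anc i x < 2 * i"
proof (induction i x rule: anc.induct)
  case (1 i x)
  then show ?case by (cases "x < 2 * i") (auto simp: anc_small anc_step)
qed

text \<open>The cut at \<open>Suc i\<close> arises from the cut at \<open>i\<close> by replacing the
  node \<open>i\<close> with its children; all other nodes are common to both.\<close>

lemma anc_Suc:
  "1 \<le> i \<Longrightarrow> i < x \<Longrightarrow>
    anc i x = (if anc (Suc i) x = 2 * i \<or> anc (Suc i) x = 2 * i + 1 then i else anc (Suc i) x)"
proof (induction x rule: less_induct)
  case (less x)
  consider "x < 2 * i" | "x = 2 * i \<or> x = 2 * i + 1" | "2 * Suc i \<le> x" by fastforce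
  then show ?case
  proof cases
    case 1
    then show ?thesis by (simp add: anc_small)
  next
    case 2
    then have "anc i x = anc i i" using less.prems by (auto simp: anc_step)
    also have "\<dots> = i" using less.prems by (simp add: anc_small)
    finally show ?thesis using 2 by (auto simp: anc_small)
  next
    case 3
    then have "anc i x = anc i (x div 2)" "anc (Suc i) x = anc (Suc i) (x div 2)"
      using less.prems by (auto intro!: anc_step)
    moreover have "x div 2 < x" "i < x div 2" using 3 by auto
    ultimately show ?thesis using less.IH[of "x div 2"] less.prems by simp
  qed
qed

text \<open>Passing to a child at least doubles the number of a node, so the bounds for the two
  children of \<open>i\<close>, added and halved, give the bound for \<open>i\<close>. After
  division by \<open>Q\<close> this is the estimate \<open>2 / y\<close> for the probability of a
  cell.\<close>

lemma card_anc_fiber: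
  assumes "1 \<le> i" "i \<le> Q" "i \<le> y" "y < 2 * i"
  shows "card {x \<in> {Q..<2 * Q}. anc i x = y} * y \<le> 2 * Q"
  using assms(2,1,3,4)
proof (induction arbitrary: y rule: inc_induct)
  case base
  have "{x \<in> {Q..<2 * Q}. anc Q x = y} = {y}" using base by (auto simp: anc_small)
  then show ?case using base by simp
next
  case (step i)
  define f where "f j y = {x \<in> {Q..<2 * Q}. anc j x = y}" for j y
  have fin: "finite (f j y)" for j y by (simp add: f_def)
  have x: "anc i x = (if anc (Suc i) x = 2 * i \<or> anc (Suc i) x = 2 * i + 1 then i else anc (Suc i) x)"
    if "x \<in> {Q..<2 * Q}" for x
    using that step by (intro anc_Suc) auto
  have IH: "card (f (Suc i) y) * y \<le> 2 * Q" if "Suc i \<le> y" "y < 2 * Suc i" for y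
    using step.IH that unfolding f_def by simp
  show ?case
  proof (cases "y = i")
    case False
    have "Suc i \<le> y" using False step by simp
    then have "f i y = f (Suc i) y" using x step.prems unfolding f_def by auto
    then show ?thesis using IH[of y] \<open>Suc i \<le> y\<close> step.prems unfolding f_def by simp
  next
    case True
    \<comment> \<open>\<open>i\<close> is not on the cut at \<open>Suc i\<close>, so it can arise
      only from one of its children.\<close>
    have bd: "anc (Suc i) x \<noteq> i" if "x \<in> {Q..<2 * Q}" for x
      using anc_bounds[of "Suc i" x] that step by auto
    have "f i i \<subseteq> f (Suc i) (2 * i) \<union> f (Suc i) (2 * i + 1)"
    proof
      fix z assume "z \<in> f i i"
      then have "z \<in> {Q..<2 * Q}" "anc i z = i" by (auto simp: f_def)
      then show "z \<in> f (Suc i) (2 * i) \<union> f (Suc i) (2 * i + 1)"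
        using x[of z] bd[of z] by (auto simp: f_def split: if_splits)
    qed
    then have "card (f i i) \<le> card (f (Suc i) (2 * i)) + card (f (Suc i) (2 * i + 1))"
      using fin by (meson card_Un_le card_mono finite_UnI le_trans)
    then have "2 * (card (f i i) * i) \<le> card (f (Suc i) (2 * i)) * (2 * i) + card (f (Suc i) (2 * i + 1)) * (2 * i + 1)"
      using mult_le_mono1[of "card (f i i)" _ "2 * i"] by (fastforce simp: algebra_simps)
    also have "\<dots> \<le> 2 * Q + 2 * Q"
      using step by (intro add_mono IH) auto
    finally show ?thesis using True unfolding f_def by (simp add: mult.commute)
  qed
qed

text \<open>The splits are along a binary tree in heap order: node \<open>i\<close> has children \<open>2 i\<close> and \<open>2 i + 1\<close>,
  and the leaves are \<open>Q, \<dots>, 2 Q - 1\<close>.  Before step \<open>i < Q\<close> the cells are the sets of elements below the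
  nodes \<open>i, \<dots>, 2 i - 1\<close>, and step \<open>i\<close> splits node \<open>i\<close>.  Step \<open>Q + j\<close> separates the element \<open>j\<close> from the
  larger elements at the same leaf; its singleton cell gets the label \<open>2 Q + j\<close>.\<close>

definition heap_side :: "nat \<Rightarrow> nat \<Rightarrow> nat" where
  "heap_side i x = (if anc i x = i then if anc (Suc i) x = 2 * i then 1 else 2 else 0)"

definition leaf_side :: "nat \<Rightarrow> (nat \<Rightarrow> nat) \<Rightarrow> nat \<Rightarrow> nat \<Rightarrow> nat" where
  "leaf_side Q h i u = (if i < Q then heap_side i (h u)
     else if u = i - Q then 1 else if i - Q < u \<and> h u = h (i - Q) then 2 else 0)"

definition leaf_cell :: "nat \<Rightarrow> (nat \<Rightarrow> nat) \<Rightarrow> nat \<Rightarrow> nat \<Rightarrow> nat" where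
  "leaf_cell Q h i u = (if i < Q then anc i (h u) else if u < i - Q then 2 * Q + u else h u)"

definition split_cell :: "nat \<Rightarrow> (nat \<Rightarrow> nat) \<Rightarrow> nat \<Rightarrow> nat" where
  "split_cell Q h i = (if i < Q then i else h (i - Q))"

text \<open>\<open>S\<close> stands for the label set of an active node. The candidates
  \<open>S\<close> are independent of \<open>h\<close>; only the covering condition involves
  it.\<close>

definition heap_covers :: "nat \<Rightarrow> nat \<Rightarrow> (nat \<Rightarrow> nat) \<Rightarrow> nat set \<Rightarrow> nat set set" where
  "heap_covers k i h W = {S. S \<subseteq> {i..<2 * i} \<and> i \<in> S \<and> card S \<le> k \<and> (\<forall>w\<in>W. anc i (h w) \<in> S)}"

text \<open>\<open>R\<close> stands for one representative per cell. Comparing leaves instead of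
  cells weakens the condition, but makes it independent of the step.\<close>

definition leaf_covers :: "nat \<Rightarrow> nat \<Rightarrow> (nat \<Rightarrow> nat) \<Rightarrow> nat set \<Rightarrow> nat set set" where
  "leaf_covers n k h W = {R. R \<subseteq> {..<n} \<and> card R \<le> k \<and> h ` W \<subseteq> h ` R}"

text \<open>The factor 2 counts the calls of an active node. The factor \<open>k\<close> is there
  because a fixed \<open>R\<close> encodes a node that is active in step \<open>Q + j\<close> only
  for its own members \<open>j\<close>.\<close>

definition call_bound :: "nat \<Rightarrow> nat \<Rightarrow> nat \<Rightarrow> nat set set \<Rightarrow> (nat \<Rightarrow> nat) \<Rightarrow> nat" where
  "call_bound n k Q \<W> h = 2 * (\<Sum>W\<in>\<W>.
    (\<Sum>i=1..<Q. card (heap_covers k i h W)) + k * card (leaf_covers n k h W))"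

section \<open>Active nodes for a fixed leaf map, encoded by covers of witnesses\<close>

locale leaf_tree =
  fixes n k Q :: nat and h :: "nat \<Rightarrow> nat" and ora :: "nat set \<Rightarrow> bool" and \<W> :: "nat set set"
  assumes kpos: "k > 0" and Q: "1 \<le> Q"
    and h: "\<And>u. u < n \<Longrightarrow> Q \<le> h u \<and> h u < 2 * Q"
    and witness': "\<And>W. W \<in> \<W> \<Longrightarrow> W \<subseteq> {..<n} \<and> card W = k"
    and ora': "\<And>X. X \<subseteq> {..<n} \<Longrightarrow> ora X \<longleftrightarrow> (\<exists>W\<in>\<W>. W \<subseteq> X)"
begin

lemma heap_cell_Suc:
  assumes "1 \<le> i" "i < Q" "u < n" "w < n"
  shows "anc (Suc i) (h u) = anc (Suc i) (h w) \<longleftrightarrow>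
    anc i (h u) = anc i (h w) \<and> heap_side i (h u) = heap_side i (h w)"
proof -
  have "anc (Suc i) (h u) \<noteq> i" "anc (Suc i) (h w) \<noteq> i"
    using anc_bounds[of "Suc i" "h u"] anc_bounds[of "Suc i" "h w"] h[of u] h[of w] assms by auto
  moreover note anc_Suc[of i "h u"] anc_Suc[of i "h w"]
  moreover have "i < h u" "i < h w" using assms h[of u] h[of w] by auto
  ultimately show ?thesis
    using assms(1) unfolding heap_side_def by (auto split: if_splits)
qed

lemma leaf_cell_Suc:
  assumes "1 \<le> i" "i < Q + n" "u < n" "w < n"
  shows "leaf_cell Q h (Suc i) u = leaf_cell Q h (Suc i) w \<longleftrightarrow>
    leaf_cell Q h i u = leaf_cell Q h i w \<and> leaf_side Q h i u = leaf_side Q h i w"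
proof (cases "i < Q")
  case True
  \<comment> \<open>For \<open>Suc i = Q\<close> the definition of \<open>leaf_cell\<close> has
    switched to the leaf itself, which is its own ancestor on the last cut.\<close>
  have "leaf_cell Q h (Suc i) x = anc (Suc i) (h x)" if "x < n" for x
    using True h[OF that] by (auto simp: leaf_cell_def anc_small)
  then show ?thesis
    using True heap_cell_Suc[OF assms(1) True assms(3,4)] assms(3,4)
    by (simp add: leaf_cell_def leaf_side_def)
next
  case False
  then show ?thesis using h[of u] h[of w] assms
    unfolding leaf_cell_def leaf_side_def by (auto simp: less_Suc_eq Suc_diff_le)
qed

text \<open>The labels \<open>2 * Q + u\<close> of separated elements exceed every leaf number, so a
  singleton is never confused with a leaf that is still to be split.\<close>

sublocale split_tree n k "leaf_side Q h" ora "Q + n" "leaf_cell Q h" "split_cell Q h" \<W>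
proof
  fix i u assume "1 \<le> i" "i < Q + n" "u < n"
  show "leaf_side Q h i u \<le> 2" by (simp add: leaf_side_def heap_side_def)
  show "leaf_side Q h i u \<noteq> 0 \<longleftrightarrow> leaf_cell Q h i u = split_cell Q h i"
  proof (cases "i < Q")
    case False
    then have "i - Q < n" using \<open>i < Q + n\<close> by simp
    then show ?thesis
      using False h[of u] h[of "i - Q"] \<open>u < n\<close>
      by (auto simp: leaf_side_def leaf_cell_def split_cell_def)
  qed (simp add: leaf_side_def heap_side_def leaf_cell_def split_cell_def)
next
  fix u w assume "u < n" "w < n"
  then show "leaf_cell Q h 1 u = leaf_cell Q h 1 w"
    using Q h[of u] h[of w] anc_bounds[of 1 "h u"] anc_bounds[of 1 "h w"]
    by (auto simp: leaf_cell_def)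
  show "u = w" if "leaf_cell Q h (Q + n) u = leaf_cell Q h (Q + n) w"
    using that \<open>u < n\<close> \<open>w < n\<close> by (simp add: leaf_cell_def)
qed (use kpos witness' ora' leaf_cell_Suc in auto)

lemma finite_witnesses: "finite \<W>"
  by (rule finite_subset[of _ "Pow {..<n}"]) (use witness' in auto)

lemma active_cell:
  assumes "1 \<le> i" "i < Q + n" "Y \<subseteq> {..<n}" "active i Y"
  shows "split_cell Q h i \<in> leaf_cell Q h i ` Y"
proof -
  obtain u where u: "u \<in> Y" "leaf_side Q h i u = 1" using assms(4) by (auto simp: active_def part_def)
  then have "u < n" using assms(3) by auto
  then have "leaf_cell Q h i u = split_cell Q h i" using side_pos[of i u] u assms by simp
  then show ?thesis using u by (metis imageI)
qed

text \<open>By \<open>nodes_eqI\<close> a node is encoded by its labels. These contain the split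
  node \<open>i\<close> and cover a witness inside the node.\<close>

lemma card_active_heap:
  assumes i: "1 \<le> i" "i < Q"
  shows "card {Y \<in> nodes i. active i Y} \<le>
    (\<Sum>W\<in>\<W>. card (heap_covers k i h W))"
proof -
  let ?F = "heap_covers k i h"
  have fin: "finite (?F W)" for W
    by (rule finite_subset[of _ "Pow {i..<2 * i}"]) (auto simp: heap_covers_def)
  have cell: "leaf_cell Q h i u = anc i (h u)" for u using i by (simp add: leaf_cell_def)
  have "card {Y \<in> nodes i. active i Y} = card ((\<lambda>Y. leaf_cell Q h i ` Y) ` {Y \<in> nodes i. active i Y})"
  proof (rule card_image[symmetric], rule inj_onI)
    fix Y Y' assume "Y \<in> {Y \<in> nodes i. active i Y}" "Y' \<in> {Y \<in> nodes i. active i Y}"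
      "leaf_cell Q h i ` Y = leaf_cell Q h i ` Y'"
    then show "Y = Y'" using nodes_eqI[of Y i Y'] by simp
  qed
  also have "\<dots> \<le> card (\<Union>W\<in>\<W>. ?F W)"
  proof (rule card_mono)
    show "(\<lambda>Y. leaf_cell Q h i ` Y) ` {Y \<in> nodes i. active i Y} \<subseteq> (\<Union>W\<in>\<W>. ?F W)"
    proof clarify
      fix Y assume Y: "Y \<in> nodes i" "active i Y"
      obtain W where W: "W \<in> \<W>" "W \<subseteq> Y" using Y(1) by (auto simp: nodes_def)
      have "leaf_cell Q h i ` Y \<subseteq> {i..<2 * i}"
      proof clarify
        fix u assume "u \<in> Y"
        then have "i \<le> h u" using nodesD(1)[OF Y(1)] h[of u] i by auto
        then show "leaf_cell Q h i u \<in> {i..<2 * i}" using anc_bounds[of i "h u"] i by (simp add: cell)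
      qed
      moreover have "i \<in> leaf_cell Q h i ` Y"
        using active_cell[of i Y] Y nodesD(1)[OF Y(1)] i by (simp add: split_cell_def)
      moreover have "\<forall>w\<in>W. anc i (h w) \<in> leaf_cell Q h i ` Y"
        using W unfolding cell by blast
      ultimately show "leaf_cell Q h i ` Y \<in> (\<Union>W\<in>\<W>. ?F W)"
        using W nodesD(3)[OF Y(1)] unfolding heap_covers_def by blast
    qed
  qed (use fin finite_witnesses in simp)
  also have "\<dots> \<le> (\<Sum>W\<in>\<W>. card (?F W))"
    by (rule card_UN_le[OF finite_witnesses])
  finally show ?thesis .
qed

text \<open>Here the labels themselves involve \<open>h\<close>, so a node is encoded by the least
  elements of its cells. The element \<open>j\<close> is one of them: an active node contains the
  split cell, which is the cell of \<open>j\<close>, and all elements smaller than \<open>j\<close>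
  are singletons by then.\<close>

lemma card_active_leaf:
  assumes j: "j < n"
  shows "card {Y \<in> nodes (Q + j). active (Q + j) Y} \<le>
    (\<Sum>W\<in>\<W>. card {R. R \<subseteq> {..<n} \<and> card R \<le> k \<and> h ` W \<subseteq> h ` R \<and> j \<in> R})"
proof -
  let ?F = "\<lambda>W. {R. R \<subseteq> {..<n} \<and> card R \<le> k \<and> h ` W \<subseteq> h ` R \<and> j \<in> R}"
  define c where "c = leaf_cell Q h (Q + j)"
  have c: "c u = (if u < j then 2 * Q + u else h u)" for u by (simp add: c_def leaf_cell_def)
  define rep where "rep Y = {u \<in> Y. \<forall>w\<in>Y. w < u \<longrightarrow> c w \<noteq> c u}" for Y
  have rep_inj: "inj_on c (rep Y)" for Y
    unfolding rep_def by (rule inj_onI) (metis (mono_tags, lifting) linorder_neqE_nat mem_Collect_eq)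
  have rep_ex: "\<exists>r\<in>rep Y. c r = c u" if "u \<in> Y" for u Y
  proof -
    let ?r = "LEAST r. r \<in> Y \<and> c r = c u"
    have r: "?r \<in> Y" "c ?r = c u" using LeastI[of "\<lambda>r. r \<in> Y \<and> c r = c u" u] that by auto
    have "c w \<noteq> c ?r" if "w \<in> Y" "w < ?r" for w
      using not_less_Least[OF that(2)] that(1) r(2) by simp
    then show ?thesis using r unfolding rep_def by blast
  qed
  have rep_image: "c ` rep Y = c ` Y" for Y
    using rep_ex[of _ Y] unfolding rep_def by (auto simp: image_iff) metis
  have fin: "finite (?F W)" for W
    by (rule finite_subset[of _ "Pow {..<n}"]) auto
  have "card {Y \<in> nodes (Q + j). active (Q + j) Y} = card (rep ` {Y \<in> nodes (Q + j). active (Q + j) Y})"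
  proof (rule card_image[symmetric], rule inj_onI)
    fix Y Y' assume "Y \<in> {Y \<in> nodes (Q + j). active (Q + j) Y}" "Y' \<in> {Y \<in> nodes (Q + j). active (Q + j) Y}"
      "rep Y = rep Y'"
    then show "Y = Y'" using nodes_eqI[of Y "Q + j" Y'] rep_image[of Y] rep_image[of Y']
      unfolding c_def by simp
  qed
  also have "\<dots> \<le> card (\<Union>W\<in>\<W>. ?F W)"
  proof (rule card_mono)
    show "rep ` {Y \<in> nodes (Q + j). active (Q + j) Y} \<subseteq> (\<Union>W\<in>\<W>. ?F W)"
    proof clarify
      fix Y assume Y: "Y \<in> nodes (Q + j)" "active (Q + j) Y"
      note Yn = nodesD(1)[OF Y(1)]
      obtain W where W: "W \<in> \<W>" "W \<subseteq> Y" using Y(1) by (auto simp: nodes_def)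
      have "rep Y \<subseteq> {..<n}" using Yn by (auto simp: rep_def)
      moreover have "card (rep Y) \<le> k"
        using card_image[OF rep_inj[of Y]] rep_image[of Y] nodesD(3)[OF Y(1)] unfolding c_def by simp
      moreover have "h ` W \<subseteq> h ` rep Y"
      proof clarify
        fix w assume "w \<in> W"
        then have w: "w \<in> Y" "w < n" using W Yn by auto
        obtain r where r: "r \<in> rep Y" "c r = c w" using rep_ex[OF w(1)] by auto
        then have "r < n" using Yn by (auto simp: rep_def)
        \<comment> \<open>Equal labels are either both of the form \<open>2 * Q + u\<close>, so that
          the elements coincide, or both leaves, since leaves are smaller than
          \<open>2 * Q\<close>.\<close>
        then have "h r = h w" using r(2) h[of r] h[of w] w(2) by (auto simp: c split: if_splits)
        then show "h w \<in> h ` rep Y" using r(1) by (metis imageI)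
      qed
      moreover have "j \<in> rep Y"
      proof -
        have "h j \<in> c ` Y"
          using active_cell[of "Q + j" Y] Y Yn j Q by (simp add: split_cell_def c_def)
        then obtain u where u: "u \<in> Y" "c u = h j" by force
        have "j \<in> Y" using nodesD(2)[OF Y(1) u(1), of j] j u(2) unfolding c_def[symmetric] by (simp add: c)
        moreover have "c w \<noteq> c j" if "w < j" for w using that h[OF j] by (simp add: c)
        ultimately show ?thesis unfolding rep_def by blast
      qed
      ultimately show "rep Y \<in> (\<Union>W\<in>\<W>. ?F W)" using W by blast
    qed
  qed (use fin finite_witnesses in simp)
  also have "\<dots> \<le> (\<Sum>W\<in>\<W>. card (?F W))"
    by (rule card_UN_le[OF finite_witnesses])
  finally show ?thesis .
qed

text \<open>Double counting of the pairs with \<open>j \<in> R\<close>: the sum over all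
  \<open>n\<close> steps costs only a factor \<open>card R \<le> k\<close>.\<close>

lemma sum_card_active_leaf:
  "(\<Sum>j<n. card {Y \<in> nodes (Q + j). active (Q + j) Y}) \<le>
    (\<Sum>W\<in>\<W>. k * card (leaf_covers n k h W))"
proof -
  let ?G = "leaf_covers n k h"
  have fin: "finite (?G W)" for W
    by (rule finite_subset[of _ "Pow {..<n}"]) (auto simp: leaf_covers_def)
  have "(\<Sum>j<n. card {Y \<in> nodes (Q + j). active (Q + j) Y}) \<le> (\<Sum>j<n. \<Sum>W\<in>\<W>. card {R \<in> ?G W. j \<in> R})"
    by (rule sum_mono) (use card_active_leaf in \<open>simp add: leaf_covers_def conj_assoc\<close>)
  also have "\<dots> = (\<Sum>W\<in>\<W>. \<Sum>j<n. card {R \<in> ?G W. j \<in> R})" by (rule sum.swap)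
  also have "\<dots> \<le> (\<Sum>W\<in>\<W>. k * card (?G W))"
  proof (rule sum_mono)
    fix W
    have "(\<Sum>j<n. card {R \<in> ?G W. j \<in> R}) = (\<Sum>R\<in>?G W. card {j \<in> {..<n}. j \<in> R})"
      using fin[of W] by (intro sum_multicount_gen) auto
    also have "\<dots> \<le> (\<Sum>R\<in>?G W. k)"
    proof (rule sum_mono)
      fix R assume "R \<in> ?G W"
      then have "{j \<in> {..<n}. j \<in> R} = R" "card R \<le> k" by (auto simp: leaf_covers_def)
      then show "card {j \<in> {..<n}. j \<in> R} \<le> k" by simp
    qed
    finally show "(\<Sum>j<n. card {R \<in> ?G W. j \<in> R}) \<le> k * card (?G W)" by (simp add: mult.commute)
  qed
  finally show ?thesis .
qed

lemma ncalls_root_le: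
  assumes "\<W> \<noteq> {}"
  shows "ncalls (Q + n - 1) 1 1 {..<n} \<le> call_bound n k Q \<W> h"
proof -
  obtain W where "W \<in> \<W>" using assms by auto
  let ?a = "\<lambda>i. card {Y \<in> nodes i. active i Y}"
  have "ncalls (Q + n - 1) 1 1 {..<n} \<le> 2 * (\<Sum>i=1..<Q + n. ?a i)"
    using root(3)[OF _ \<open>W \<in> \<W>\<close>] Q by simp
  also have "(\<Sum>i=1..<Q + n. ?a i) = (\<Sum>i=1..<Q. ?a i) + (\<Sum>j<n. ?a (Q + j))"
  proof -
    have "(\<Sum>i=1..<Q + n. ?a i) = (\<Sum>i=1..<Q. ?a i) + (\<Sum>i=Q..<Q + n. ?a i)"
      using Q by (intro sum.atLeastLessThan_concat[symmetric]) auto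
    also have "(\<Sum>i=Q..<Q + n. ?a i) = (\<Sum>j<n. ?a (Q + j))"
      using sum.shift_bounds_nat_ivl[of ?a 0 Q n] by (simp add: add.commute lessThan_atLeast0)
    finally show ?thesis .
  qed
  also have "2 * \<dots> \<le> 2 * ((\<Sum>i=1..<Q. \<Sum>W\<in>\<W>. card (heap_covers k i h W))
      + (\<Sum>W\<in>\<W>. k * card (leaf_covers n k h W)))"
    by (intro mult_left_mono add_mono sum_mono card_active_heap sum_card_active_leaf) auto
  also have "\<dots> = call_bound n k Q \<W> h"
    unfolding call_bound_def by (subst sum.swap) (simp add: sum.distrib)
  finally show ?thesis .
qed

end

section \<open>Counting the random leaf assignments that make a step active\<close>

text \<open>A single term of the exponential series is at most its sum. This replaces an estimate of
  factorials by Stirling's formula.\<close>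

lemma power_div_fact_le_exp: "0 \<le> x \<Longrightarrow> x ^ m / fact m \<le> exp (x :: real)"
proof -
  assume x: "0 \<le> x"
  have s: "(\<lambda>n. x ^ n / fact n) sums exp x"
    using exp_converges[of x] by (simp add: divide_inverse mult.commute)
  have "x ^ m / fact m = (\<Sum>n\<in>{m}. x ^ n / fact n)" by simp
  also have "\<dots> \<le> (\<Sum>n. x ^ n / fact n)"
    using x s by (intro sum_le_suminf) (auto simp: sums_iff)
  finally show ?thesis using s by (simp add: sums_iff)
qed

lemma binomial_le_power_div_fact: "real (n choose m) \<le> real n ^ m / fact m"
proof -
  have "real ((n choose m) * fact m) \<le> real (n ^ m)"
    using binomial_fact_pow[of n m] by (simp only: of_nat_le_iff)
  then show ?thesis by (simp add: field_simps)
qed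

lemma sum_card_swap:
  assumes "finite A" "finite B"
  shows "(\<Sum>a\<in>A. card {b \<in> B. P a b}) = (\<Sum>b\<in>B. card {a \<in> A. P a b})"
  using assms by (intro sum_multicount_gen) auto

lemma sum_by_card:
  fixes g :: "nat \<Rightarrow> real"
  assumes "finite F" "\<And>S. S \<in> F \<Longrightarrow> card S \<in> T" "finite T"
  shows "(\<Sum>S\<in>F. g (card S)) = (\<Sum>s\<in>T. real (card {S \<in> F. card S = s}) * g s)"
proof -
  have "(\<Sum>S\<in>F. g (card S)) = (\<Sum>s\<in>T. \<Sum>S\<in>{S \<in> F. card S = s}. g (card S))"
    using assms by (intro sum.group[symmetric]) auto
  then show ?thesis by simp
qed

text \<open>If \<open>s > i\<close>, the binomial coefficient is 0. Otherwise
  \<open>s / i \<le> 1\<close>, so the exponent \<open>k\<close> may be lowered to \<open>s\<close>;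
  the binomial then cancels \<open>i ^ (s - 1)\<close>, one factor \<open>1 / i\<close> is left, and
  \<open>s ^ (s - 1) / fact (s - 1)\<close> is at most \<open>exp k\<close>.\<close>

lemma heap_term_le:
  assumes s: "1 \<le> s" "s \<le> k" and i: "1 \<le> i"
  shows "real ((i - 1) choose (s - 1)) * (2 * real s / real i) ^ k \<le> 2 ^ k * real k * exp (real k) / real i"
proof (cases "s \<le> i")
  case False
  then have zero: "(i - 1) choose (s - 1) = 0" using s i by (intro binomial_eq_0) auto
  show ?thesis unfolding zero by simp
next
  case True
  have ip: "real i > 0" using i by simp
  have "(2 * real s / real i) ^ k = 2 ^ k * (real s / real i) ^ k"
    by (simp add: power_mult_distrib power_divide)
  also have "\<dots> \<le> 2 ^ k * (real s / real i) ^ s"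
    using s i True by (intro mult_left_mono power_decreasing) auto
  also have "\<dots> = 2 ^ k * (real s ^ (s - 1) * real s) / (real i ^ (s - 1) * real i)"
    using s by (cases s) (simp_all add: power_divide mult.commute)
  finally have 1: "(2 * real s / real i) ^ k \<le> 2 ^ k * (real s ^ (s - 1) * real s) / (real i ^ (s - 1) * real i)" .
  have 2: "real ((i - 1) choose (s - 1)) \<le> real i ^ (s - 1) / fact (s - 1)"
  proof -
    have "real (i - 1) ^ (s - 1) \<le> real i ^ (s - 1)" by (intro power_mono) auto
    then show ?thesis
      using binomial_le_power_div_fact[of "i - 1" "s - 1"]
      by (meson divide_right_mono fact_ge_zero order_trans)
  qed
  have "real ((i - 1) choose (s - 1)) * (2 * real s / real i) ^ k
      \<le> real i ^ (s - 1) / fact (s - 1) * (2 ^ k * (real s ^ (s - 1) * real s) / (real i ^ (s - 1) * real i))"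
    by (intro mult_mono 1 2) auto
  also have "\<dots> = 2 ^ k * real s * (real s ^ (s - 1) / fact (s - 1)) / real i"
    using ip by simp
  also have "\<dots> \<le> 2 ^ k * real k * exp (real k) / real i"
  proof -
    have "real s ^ (s - 1) / fact (s - 1) \<le> exp (real s)" by (rule power_div_fact_le_exp) simp
    also have "\<dots> \<le> exp (real k)" using s by simp
    finally show ?thesis using s ip
      by (intro divide_right_mono mult_mono) auto
  qed
  finally show ?thesis .
qed

text \<open>Extensional functions, so that there are exactly \<open>Q ^ n\<close> of them and
  expectations become finite averages.\<close>

definition leaf_maps :: "nat \<Rightarrow> nat \<Rightarrow> (nat \<Rightarrow> nat) set" where
  "leaf_maps n Q = PiE {..<n} (\<lambda>_. {Q..<2 * Q})"

lemma finite_leaf_maps [simp]: "finite (leaf_maps n Q)"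
  unfolding leaf_maps_def by (intro finite_PiE) auto

text \<open>The elements of \<open>W\<close> choose their leaves independently, and each of them
  falls below \<open>S\<close> with probability at most \<open>2 * card S / i\<close> by
  \<open>card_anc_fiber\<close>.\<close>

lemma card_leaf_maps_heap:
  assumes W: "W \<subseteq> {..<n}" "card W = k" and i: "1 \<le> i" "i < Q" and S: "S \<subseteq> {i..<2 * i}"
  shows "real (card {h \<in> leaf_maps n Q. \<forall>w\<in>W. anc i (h w) \<in> S}) \<le> real Q ^ n * (2 * real (card S) / real i) ^ k"
proof -
  define B where "B = {x \<in> {Q..<2 * Q}. anc i x \<in> S}"
  have kn: "k \<le> n" using card_mono[of "{..<n}" W] W by simp
  have finW: "finite W" using W finite_subset by blast
  have "{h \<in> leaf_maps n Q. \<forall>w\<in>W. anc i (h w) \<in> S} = PiE {..<n} (\<lambda>u. if u \<in> W then B else {Q..<2 * Q})"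
  proof (rule set_eqI)
    fix h
    have "h \<in> leaf_maps n Q \<and> (\<forall>w\<in>W. anc i (h w) \<in> S) \<longleftrightarrow>
        (\<forall>u\<in>{..<n}. h u \<in> (if u \<in> W then B else {Q..<2 * Q})) \<and> h \<in> extensional {..<n}"
      unfolding leaf_maps_def PiE_iff B_def using W(1)
      by (cases "h \<in> extensional {..<n}") (auto split: if_splits)
    then show "h \<in> {h \<in> leaf_maps n Q. \<forall>w\<in>W. anc i (h w) \<in> S} \<longleftrightarrow>
        h \<in> PiE {..<n} (\<lambda>u. if u \<in> W then B else {Q..<2 * Q})"
      unfolding PiE_iff by simp
  qed
  then have "card {h \<in> leaf_maps n Q. \<forall>w\<in>W. anc i (h w) \<in> S} = (\<Prod>u<n. card (if u \<in> W then B else {Q..<2 * Q}))"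
    by (simp add: card_PiE)
  also have "\<dots> = (\<Prod>u\<in>{..<n} - W. Q) * (\<Prod>u\<in>W. card B)"
  proof -
    have "(\<Prod>u<n. card (if u \<in> W then B else {Q..<2 * Q}))
        = (\<Prod>u\<in>{..<n} - W. card (if u \<in> W then B else {Q..<2 * Q})) * (\<Prod>u\<in>W. card (if u \<in> W then B else {Q..<2 * Q}))"
      by (rule prod.subset_diff[OF W(1)]) simp
    then show ?thesis by simp
  qed
  also have "\<dots> = Q ^ (n - k) * card B ^ k"
    using W finW by (simp add: card_Diff_subset)
  finally have c: "card {h \<in> leaf_maps n Q. \<forall>w\<in>W. anc i (h w) \<in> S} = Q ^ (n - k) * card B ^ k" .
  have finS: "finite S" using S finite_subset by blast
  have "real (card B) \<le> (\<Sum>y\<in>S. real (card {x \<in> {Q..<2 * Q}. anc i x = y}))"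
  proof -
    have "B = (\<Union>y\<in>S. {x \<in> {Q..<2 * Q}. anc i x = y})" by (auto simp: B_def)
    then have "card B \<le> (\<Sum>y\<in>S. card {x \<in> {Q..<2 * Q}. anc i x = y})"
      using card_UN_le[OF finS] by simp
    then show ?thesis by (metis of_nat_le_iff of_nat_sum)
  qed
  also have "\<dots> \<le> (\<Sum>y\<in>S. 2 * real Q / real i)"
  proof (rule sum_mono)
    fix y assume "y \<in> S"
    then have y: "i \<le> y" "y < 2 * i" using S by auto
    have "card {x \<in> {Q..<2 * Q}. anc i x = y} * i \<le> card {x \<in> {Q..<2 * Q}. anc i x = y} * y"
      using y by simp
    also have "\<dots> \<le> 2 * Q" using card_anc_fiber[OF i(1) _ y] i by simp
    finally have "real (card {x \<in> {Q..<2 * Q}. anc i x = y} * i) \<le> real (2 * Q)" by (simp only: of_nat_le_iff)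
    then show "real (card {x \<in> {Q..<2 * Q}. anc i x = y}) \<le> 2 * real Q / real i"
      using i by (simp add: field_simps)
  qed
  finally have "real (card B) \<le> real Q * (2 * real (card S) / real i)" by (simp add: mult_ac)
  then have "real (card B) ^ k \<le> (real Q * (2 * real (card S) / real i)) ^ k" by (intro power_mono) auto
  also have "\<dots> = real Q ^ k * (2 * real (card S) / real i) ^ k" by (rule power_mult_distrib)
  finally have "real Q ^ (n - k) * real (card B) ^ k \<le> real Q ^ (n - k) * (real Q ^ k * (2 * real (card S) / real i) ^ k)"
    by (intro mult_left_mono) auto
  also have "\<dots> = real Q ^ n * (2 * real (card S) / real i) ^ k"
    using kn by (simp add: mult.assoc[symmetric] power_add[symmetric])
  finally show ?thesis unfolding c by simp
qed

text \<open>After exchanging the sums, the sets \<open>S\<close> are grouped by their size. As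
  \<open>i\<close> is a forced member, at most \<open>(i - 1) choose (s - 1)\<close> of them have
  size \<open>s\<close>. The second factor \<open>k\<close> is the number of sizes.\<close>

lemma sum_heap_le:
  assumes W: "W \<subseteq> {..<n}" "card W = k" and i: "1 \<le> i" "i < Q"
  shows "(\<Sum>h\<in>leaf_maps n Q. real (card (heap_covers k i h W)))
    \<le> real Q ^ n * (real k ^ 2 * 2 ^ k * exp (real k) / real i)"
proof -
  define F where "F = {S. S \<subseteq> {i..<2 * i} \<and> i \<in> S \<and> card S \<le> k}"
  have finF: "finite F" unfolding F_def by (rule finite_subset[of _ "Pow {i..<2 * i}"]) auto
  have cardF: "card S \<in> {1..k}" if "S \<in> F" for S
  proof -
    have "finite S" "S \<noteq> {}" using that finite_subset[of S "{i..<2 * i}"] by (auto simp: F_def)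
    then show ?thesis using that card_gt_0_iff[of S] by (auto simp: F_def)
  qed
  have count: "card {S \<in> F. card S = s} \<le> (i - 1) choose (s - 1)" if "1 \<le> s" for s
  proof -
    have "card {S \<in> F. card S = s} = card ((\<lambda>S. S - {i}) ` {S \<in> F. card S = s})"
      by (intro card_image[symmetric] inj_onI) (auto simp: F_def)
    also have "\<dots> \<le> card {T. T \<subseteq> {i<..<2 * i} \<and> card T = s - 1}"
    proof (rule card_mono)
      show "(\<lambda>S. S - {i}) ` {S \<in> F. card S = s} \<subseteq> {T. T \<subseteq> {i<..<2 * i} \<and> card T = s - 1}"
        by (auto simp: F_def card_Diff_singleton_if)
    qed (rule finite_subset[of _ "Pow {i<..<2 * i}"], auto)
    also have "\<dots> = (i - 1) choose (s - 1)" by (simp add: n_subsets)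
    finally show ?thesis .
  qed
  have "(\<Sum>h\<in>leaf_maps n Q. real (card {S \<in> F. \<forall>w\<in>W. anc i (h w) \<in> S}))
      = (\<Sum>S\<in>F. real (card {h \<in> leaf_maps n Q. \<forall>w\<in>W. anc i (h w) \<in> S}))"
    unfolding of_nat_sum[symmetric] of_nat_eq_iff by (rule sum_card_swap) (simp_all add: finF)
  also have "\<dots> \<le> (\<Sum>S\<in>F. real Q ^ n * (2 * real (card S) / real i) ^ k)"
    by (intro sum_mono card_leaf_maps_heap W i) (auto simp: F_def)
  also have "\<dots> = real Q ^ n * (\<Sum>S\<in>F. (2 * real (card S) / real i) ^ k)"
    by (rule sum_distrib_left[symmetric])
  also have "(\<Sum>S\<in>F. (2 * real (card S) / real i) ^ k)
      = (\<Sum>s\<in>{1..k}. real (card {S \<in> F. card S = s}) * (2 * real s / real i) ^ k)"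
    by (rule sum_by_card) (use finF cardF in auto)
  also have "real Q ^ n * \<dots> \<le> real Q ^ n * (\<Sum>s\<in>{1..k}. 2 ^ k * real k * exp (real k) / real i)"
  proof (intro mult_left_mono sum_mono)
    fix s assume s: "s \<in> {1..k}"
    have "real (card {S \<in> F. card S = s}) * (2 * real s / real i) ^ k
        \<le> real ((i - 1) choose (s - 1)) * (2 * real s / real i) ^ k"
      using count[of s] s by (intro mult_right_mono) auto
    also have "\<dots> \<le> 2 ^ k * real k * exp (real k) / real i"
      using s i by (intro heap_term_le) auto
    finally show "real (card {S \<in> F. card S = s}) * (2 * real s / real i) ^ k
        \<le> 2 ^ k * real k * exp (real k) / real i" .
  qed auto
  also have "(\<Sum>s\<in>{1..k}. 2 ^ k * real k * exp (real k) / real i) = real k ^ 2 * 2 ^ k * exp (real k) / real i"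
    by (simp add: power2_eq_square)
  finally show ?thesis by (simp add: heap_covers_def F_def conj_assoc)
qed

text \<open>Once \<open>h\<close> is fixed on \<open>R\<close>, every element of
  \<open>W - R\<close> has at most \<open>card R\<close> admissible leaves, and all elements outside
  \<open>R \<union> W\<close> are free.\<close>

lemma card_leaf_maps_cover:
  assumes W: "W \<subseteq> {..<n}" and R: "R \<subseteq> {..<n}" and Q: "1 \<le> Q"
  shows "real (card {h \<in> leaf_maps n Q. h ` W \<subseteq> h ` R}) \<le> real Q ^ n * (real (card R) / real Q) ^ card (W - R)"
proof -
  let ?B = "{Q..<2 * Q}"
  define c where "c = card (W - R)"
  have fin: "finite W" "finite R" using W R finite_subset by blast+
  have le: "card R + c \<le> n"
  proof -
    have "card R + c = card (R \<union> (W - R))" unfolding c_def using fin by (intro card_Un_disjoint[symmetric]) auto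
    also have "\<dots> \<le> card {..<n}" using W R by (intro card_mono) auto
    finally show ?thesis by simp
  qed
  define f where "f g u = (if u \<in> R then {g u} else if u \<in> W then g ` R else ?B)" for g :: "nat \<Rightarrow> nat" and u
  have "{h \<in> leaf_maps n Q. h ` W \<subseteq> h ` R} \<subseteq> (\<Union>g\<in>PiE R (\<lambda>_. ?B). PiE {..<n} (f g))"
  proof
    fix h assume h: "h \<in> {h \<in> leaf_maps n Q. h ` W \<subseteq> h ` R}"
    have "restrict h R \<in> PiE R (\<lambda>_. ?B)" using h R by (auto simp: leaf_maps_def PiE_iff)
    moreover have "restrict h R ` R = h ` R" by auto
    then have "h \<in> PiE {..<n} (f (restrict h R))"
      using h by (auto simp: leaf_maps_def f_def PiE_iff)
    ultimately show "h \<in> (\<Union>g\<in>PiE R (\<lambda>_. ?B). PiE {..<n} (f g))" by blast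
  qed
  moreover have finf: "finite (f g u)" for g u using fin by (simp add: f_def)
  ultimately have "card {h \<in> leaf_maps n Q. h ` W \<subseteq> h ` R} \<le> card (\<Union>g\<in>PiE R (\<lambda>_. ?B). PiE {..<n} (f g))"
    using fin by (intro card_mono) (auto intro!: finite_PiE)
  also have "\<dots> \<le> (\<Sum>g\<in>PiE R (\<lambda>_. ?B). card (PiE {..<n} (f g)))"
    using fin by (intro card_UN_le finite_PiE) auto
  also have "\<dots> \<le> (\<Sum>g\<in>PiE R (\<lambda>_. ?B). card R ^ c * Q ^ (n - (card R + c)))"
  proof (rule sum_mono)
    fix g
    have U: "{..<n} = R \<union> ((W - R) \<union> ({..<n} - (R \<union> W)))" using W R by auto
    have "card (PiE {..<n} (f g)) = (\<Prod>u<n. card (f g u))" by (simp add: card_PiE)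
    also have "\<dots> = (\<Prod>u\<in>R. card (f g u)) * ((\<Prod>u\<in>W - R. card (f g u)) * (\<Prod>u\<in>{..<n} - (R \<union> W). card (f g u)))"
    proof -
      have "(\<Prod>u<n. card (f g u)) = (\<Prod>u\<in>R \<union> ((W - R) \<union> ({..<n} - (R \<union> W))). card (f g u))"
        by (rule arg_cong[OF U, of "prod (\<lambda>u. card (f g u))"])
      also have "\<dots> = (\<Prod>u\<in>R. card (f g u)) * (\<Prod>u\<in>(W - R) \<union> ({..<n} - (R \<union> W)). card (f g u))"
        using fin by (intro prod.union_disjoint) auto
      also have "(\<Prod>u\<in>(W - R) \<union> ({..<n} - (R \<union> W)). card (f g u)) =
          (\<Prod>u\<in>W - R. card (f g u)) * (\<Prod>u\<in>{..<n} - (R \<union> W). card (f g u))"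
        using fin by (intro prod.union_disjoint) auto
      finally show ?thesis .
    qed
    also have "(\<Prod>u\<in>R. card (f g u)) = 1" by (simp add: f_def)
    also have "(\<Prod>u\<in>W - R. card (f g u)) = card (g ` R) ^ c"
      by (simp add: f_def c_def)
    also have "(\<Prod>u\<in>{..<n} - (R \<union> W). card (f g u)) = Q ^ (n - (card R + c))"
    proof -
      have "card ({..<n} - (R \<union> W)) = n - card (R \<union> W)" using fin W R by (simp add: card_Diff_subset)
      also have "card (R \<union> W) = card R + c"
        unfolding c_def using fin card_Un_disjoint[of R "W - R"] by simp
      finally show ?thesis by (simp add: f_def)
    qed
    also have "1 * (card (g ` R) ^ c * Q ^ (n - (card R + c))) \<le> card R ^ c * Q ^ (n - (card R + c))"
      using card_image_le[OF fin(2), of g] by (simp add: power_mono)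
    finally show "card (PiE {..<n} (f g)) \<le> card R ^ c * Q ^ (n - (card R + c))" .
  qed
  also have "\<dots> = Q ^ card R * (card R ^ c * Q ^ (n - (card R + c)))"
    using fin by (simp add: card_PiE)
  finally have "real (card {h \<in> leaf_maps n Q. h ` W \<subseteq> h ` R}) \<le> real (Q ^ card R * (card R ^ c * Q ^ (n - (card R + c))))"
    by (simp only: of_nat_le_iff)
  also have "\<dots> = real (card R) ^ c * real Q ^ (n - c)"
  proof -
    have "n - c = card R + (n - (card R + c))" using le by simp
    then show ?thesis by (simp add: power_add)
  qed
  also have "\<dots> = real Q ^ n * (real (card R) / real Q) ^ c"
    using le Q by (simp add: power_divide power_diff)
  finally show ?thesis unfolding c_def .
qed

text \<open>Since \<open>card R \<le> card W\<close>, the exponent \<open>card (W - R)\<close> may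
  be lowered to \<open>card (R - W)\<close>. Then \<open>R\<close> is split into
  \<open>R \<inter> W\<close>, with at most \<open>2 ^ k\<close> choices, and
  \<open>D = R - W\<close>. For \<open>card D = d\<close> the sum is at most
  \<open>(n choose d) * (k / Q) ^ d\<close>, and \<open>n \<le> Q\<close> reduces this to
  \<open>k ^ d / fact d\<close>.\<close>

lemma sum_leaf_le:
  assumes W: "W \<subseteq> {..<n}" "card W = k" and Q: "1 \<le> Q" "n \<le> Q"
  shows "(\<Sum>h\<in>leaf_maps n Q. real (card (leaf_covers n k h W)))
    \<le> real Q ^ n * (2 ^ k * (real k + 1) * exp (real k))"
proof -
  define G where "G = {R. R \<subseteq> {..<n} \<and> card R \<le> k}"
  have finG: "finite G" unfolding G_def by (rule finite_subset[of _ "Pow {..<n}"]) auto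
  have finW: "finite W" using W finite_subset by blast
  have kQ: "k \<le> Q" using card_mono[of "{..<n}" W] W Q by simp
  define g where "g d = (real k / real Q) ^ d" for d :: nat
  have "(\<Sum>h\<in>leaf_maps n Q. real (card {R \<in> G. h ` W \<subseteq> h ` R}))
      = (\<Sum>R\<in>G. real (card {h \<in> leaf_maps n Q. h ` W \<subseteq> h ` R}))"
    unfolding of_nat_sum[symmetric] of_nat_eq_iff by (rule sum_card_swap) (simp_all add: finG)
  also have "\<dots> \<le> (\<Sum>R\<in>G. real Q ^ n * g (card (R - W)))"
  proof (rule sum_mono)
    fix R assume R: "R \<in> G"
    then have finR: "finite R" using finite_subset[of R "{..<n}"] by (auto simp: G_def)
    have "card (R - W) \<le> card (W - R)"
    proof -
      have "card (R - W) + card (R \<inter> W) = card R" "card (W - R) + card (W \<inter> R) = card W"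
        using finR finW by (metis card_Diff_subset_Int card_Int_Diff add.commute)+
      then show ?thesis using R W by (simp add: G_def Int_commute)
    qed
    have "real (card {h \<in> leaf_maps n Q. h ` W \<subseteq> h ` R}) \<le> real Q ^ n * (real (card R) / real Q) ^ card (W - R)"
      using R W Q by (intro card_leaf_maps_cover) (auto simp: G_def)
    also have "(real (card R) / real Q) ^ card (W - R) \<le> (real k / real Q) ^ card (W - R)"
      using R Q by (intro power_mono divide_right_mono) (auto simp: G_def)
    also have "\<dots> \<le> g (card (R - W))"
      unfolding g_def using \<open>card (R - W) \<le> card (W - R)\<close> kQ Q by (intro power_decreasing) auto
    finally show "real (card {h \<in> leaf_maps n Q. h ` W \<subseteq> h ` R}) \<le> real Q ^ n * g (card (R - W))"
      by (simp add: mult_left_mono)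
  qed
  also have "\<dots> = real Q ^ n * (\<Sum>R\<in>G. g (card (R - W)))" by (rule sum_distrib_left[symmetric])
  also have "(\<Sum>R\<in>G. g (card (R - W))) \<le> 2 ^ k * (real k + 1) * exp (real k)"
  proof -
    have "(\<Sum>R\<in>G. g (card (R - W))) = (\<Sum>(T, D)\<in>(\<lambda>R. (R \<inter> W, R - W)) ` G. g (card D))"
      by (subst sum.reindex) (auto intro!: inj_onI)
    also have "\<dots> \<le> (\<Sum>(T, D)\<in>Pow W \<times> G. g (card D))"
    proof (rule sum_mono2)
      show "(\<lambda>R. (R \<inter> W, R - W)) ` G \<subseteq> Pow W \<times> G"
      proof clarify
        fix R assume R: "R \<in> G"
        then have "card (R - W) \<le> card R"
          using finite_subset[of R "{..<n}"] by (intro card_mono) (auto simp: G_def)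
        then show "R \<inter> W \<in> Pow W \<and> R - W \<in> G" using R by (auto simp: G_def)
      qed
    qed (use finW finG in \<open>auto simp: g_def\<close>)
    also have "\<dots> = 2 ^ k * (\<Sum>D\<in>G. g (card D))"
      using finW W by (simp add: sum.cartesian_product[symmetric] card_Pow)
    also have "(\<Sum>D\<in>G. g (card D)) = (\<Sum>d\<in>{..k}. real (card {D \<in> G. card D = d}) * g d)"
      by (rule sum_by_card) (use finG in \<open>auto simp: G_def\<close>)
    also have "\<dots> \<le> (\<Sum>d\<in>{..k}. exp (real k))"
    proof (rule sum_mono)
      fix d assume d: "d \<in> {..k}"
      have "{D \<in> G. card D = d} = {D. D \<subseteq> {..<n} \<and> card D = d}" using d by (auto simp: G_def)
      then have "card {D \<in> G. card D = d} = n choose d" by (simp add: n_subsets)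
      then have "real (card {D \<in> G. card D = d}) * g d \<le> real n ^ d / fact d * g d"
        using binomial_le_power_div_fact[of n d] by (intro mult_right_mono) (auto simp: g_def)
      also have "\<dots> \<le> real Q ^ d / fact d * g d"
        using Q by (intro mult_right_mono divide_right_mono power_mono) (auto simp: g_def)
      also have "\<dots> = real k ^ d / fact d" using Q by (simp add: g_def power_divide)
      also have "\<dots> \<le> exp (real k)" by (rule power_div_fact_le_exp) simp
      finally show "real (card {D \<in> G. card D = d}) * g d \<le> exp (real k)" .
    qed
    finally show ?thesis by (simp add: algebra_simps)
  qed
  finally show ?thesis by (simp add: leaf_covers_def G_def conj_assoc mult_left_mono)
qed

section \<open>Correctness of the search loop\<close>

definition listing :: "nat \<Rightarrow> nat set \<Rightarrow> nat list" where
  "listing n X = filter (\<lambda>u. u \<in> X) [0..<n]"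

lemma listing_simps [simp]:
  "listing 0 X = []" "listing n {} = []"
  "listing (Suc n) X = (if n \<in> X then listing n X @ [n] else listing n X)"
  "distinct (listing n X)" "set (listing n X) = X \<inter> {..<n}"
  by (auto simp: listing_def)

definition same_io :: "config \<Rightarrow> config \<Rightarrow> bool" where
  "same_io s t \<longleftrightarrow> coins t = coins s \<and> query_tape t = query_tape s \<and>
     output_tape t = output_tape s \<and> queries t = queries s \<and> outputs t = outputs s"

definition same_vars :: "vname list \<Rightarrow> (vname \<Rightarrow> nat) \<Rightarrow> (vname \<Rightarrow> nat) \<Rightarrow> bool" where
  "same_vars xs f g \<longleftrightarrow> (\<forall>x. x \<notin> set xs \<longrightarrow> g x = f x)"

lemma same_vars_refl [simp]: "same_vars xs f f"
  by (simp add: same_vars_def)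

lemma same_vars_upd [simp]: "x \<in> set xs \<Longrightarrow> same_vars xs f (g(x := a)) \<longleftrightarrow> same_vars xs f g"
  by (auto simp: same_vars_def)

lemma same_varsD: "same_vars xs f g \<Longrightarrow> x \<notin> set xs \<Longrightarrow> g x = f x"
  by (simp add: same_vars_def)

context search
begin

definition marks :: "(nat \<Rightarrow> nat) \<Rightarrow> nat \<Rightarrow> nat set \<Rightarrow> bool" where
  "marks m a X \<longleftrightarrow> (\<forall>u<n. m (a + 2 + u) = of_bool (u \<in> X))"

text \<open>Column 0, which holds the leaves, is left out: the search reads only sides.\<close>

definition table :: "nat \<Rightarrow> (nat \<Rightarrow> nat) \<Rightarrow> bool" where
  "table Z m \<longleftrightarrow> (\<forall>u<n. \<forall>i. 1 \<le> i \<longrightarrow> i < Z \<longrightarrow> m (u * Z + i) = side i u)"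

text \<open>\<open>p\<close> moves by \<open>Z\<close> and thus stays in column \<open>i\<close> of
  the table. The two flags together decide \<open>active i X\<close>.\<close>

lemma wp_scan:
  assumes vars: "vars s ''n'' = n" "vars s ''Z'' = Z" "vars s ''i'' = i" and i: "1 \<le> i" "i < Z"
    and tab: "table Z (mem s)" and X: "marks (mem s) (vars s ''h'') X" "X \<subseteq> {..<n}"
    and post: "\<And>t. same_vars [''a'', ''b'', ''u'', ''p''] (vars s) (vars t) \<Longrightarrow> same_io s t \<Longrightarrow> mem t = mem s \<Longrightarrow>
      (0 < vars t ''a'' \<longleftrightarrow> X \<inter> part i 1 \<noteq> {}) \<Longrightarrow> (0 < vars t ''b'' \<longleftrightarrow> X \<inter> part i 2 \<noteq> {}) \<Longrightarrow>
      steps t \<le> steps s + 10 * n + 10 \<Longrightarrow> P t"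
  shows "wp ora scan P s"
proof -
  define Inv where "Inv t \<longleftrightarrow> same_vars [''a'', ''b'', ''u'', ''p''] (vars s) (vars t) \<and> same_io s t \<and>
      mem t = mem s \<and> vars t ''u'' \<le> n \<and> vars t ''p'' = vars t ''u'' * Z + i \<and>
      (0 < vars t ''a'' \<longleftrightarrow> (\<exists>w<vars t ''u''. w \<in> X \<and> side i w = 1)) \<and>
      (0 < vars t ''b'' \<longleftrightarrow> (\<exists>w<vars t ''u''. w \<in> X \<and> side i w = 2)) \<and>
      steps t \<le> steps s + 4 + 8 * vars t ''u''" for t :: config
  show ?thesis unfolding scan_def
    apply simp
    apply (rule wp_While[where Inv = Inv and m = "\<lambda>t. n - vars t ''u''"])
    subgoal using vars by (simp add: Inv_def same_io_def)
    subgoal for t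
    proof -
      assume I: "Inv t" and cond: "bval (Less (V ''u'') (V ''n'')) t"
      have "same_vars [''a'', ''b'', ''u'', ''p''] (vars s) (vars t)" using I by (simp add: Inv_def)
      note same = same_varsD[OF this]
      have u_le: "vars t ''u'' \<le> n" using I by (simp add: Inv_def)
      have v: "vars t ''n'' = n" "vars t ''Z'' = Z" "vars t ''h'' = vars s ''h''"
        and u: "vars t ''u'' < n"
        using cond vars same u_le by (simp_all del: wp_simps)
      have side: "mem s (vars t ''u'' * Z + i) = side i (vars t ''u'')"
        using tab u i by (auto simp: table_def)
      have mk: "mem s (vars s ''h'' + 2 + vars t ''u'') = of_bool (vars t ''u'' \<in> X)"
        using X(1) u by (auto simp: marks_def)
      have ex: "(\<exists>w<Suc (vars t ''u''). w \<in> X \<and> side i w = j) \<longleftrightarrow>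
          (\<exists>w<vars t ''u''. w \<in> X \<and> side i w = j) \<or> vars t ''u'' \<in> X \<and> side i (vars t ''u'') = j" for j
        by (auto simp: less_Suc_eq)
      have I': "same_vars [''a'', ''b'', ''u'', ''p''] (vars s) (vars t)" "same_io s t" "mem t = mem s"
        "vars t ''p'' = vars t ''u'' * Z + i"
        "0 < vars t ''a'' \<longleftrightarrow> (\<exists>w<vars t ''u''. w \<in> X \<and> side i w = 1)"
        "0 < vars t ''b'' \<longleftrightarrow> (\<exists>w<vars t ''u''. w \<in> X \<and> side i w = 2)"
        and st: "steps t \<le> steps s + 4 + 8 * vars t ''u''"
        using I unfolding Inv_def by blast+
      have io: "same_io s t'" if "same_io t t'" for t'
        using that I'(2) by (simp add: same_io_def)
      consider "vars t ''u'' \<notin> X" | "vars t ''u'' \<in> X" "side i (vars t ''u'') = 1"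
        | "vars t ''u'' \<in> X" "side i (vars t ''u'') = 2"
        | "vars t ''u'' \<in> X" "side i (vars t ''u'') \<noteq> 1" "side i (vars t ''u'') \<noteq> 2" by blast
      then show ?thesis
        by cases (use u st in \<open>simp_all add: mark_def Inv_def v side mk[simplified] ex[simplified] I' io same_io_def[of t]
          diff_less_mono2\<close>)
    qed
    subgoal for t
    proof -
      assume I: "Inv t" and cond: "\<not> bval (Less (V ''u'') (V ''n'')) t"
      have "same_vars [''a'', ''b'', ''u'', ''p''] (vars s) (vars t)" using I by (simp add: Inv_def)
      note same = same_varsD[OF this]
      have u_le: "vars t ''u'' \<le> n" using I by (simp add: Inv_def)
      have u: "vars t ''u'' = n"
        using cond vars same u_le by simp
      have "(\<exists>w<n. w \<in> X \<and> side i w = j) \<longleftrightarrow> X \<inter> part i j \<noteq> {}" for j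
        using X(2) by (auto simp: part_def)
      then show ?thesis using I unfolding Inv_def u wp_simps
        by (intro post) (simp_all add: same_io_def)
    qed
    done
qed

text \<open>The entry behind the tail is complete whatever the oracle answers; the new value of
  \<open>t\<close> alone decides whether it belongs to the queue.\<close>

lemma wp_push:
  assumes vars: "vars s ''n'' = n" "vars s ''Z'' = Z" "vars s ''i'' = i" and i: "1 \<le> i" "i < Z"
    and tab: "table Z (mem s)" and X: "marks (mem s) (vars s ''h'') X" "X \<subseteq> {..<n}"
    and h: "n * Z \<le> vars s ''h''" "vars s ''h'' + n + 2 \<le> vars s ''t''" and qt: "query_tape s = []"
    and post: "\<And>t. same_vars [''u'', ''p'', ''r'', ''t''] (vars s) (vars t) \<Longrightarrow>
      coins t = coins s \<Longrightarrow> query_tape t = [] \<Longrightarrow> output_tape t = output_tape s \<Longrightarrow>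
      outputs t = outputs s \<Longrightarrow> queries t = queries s @ [X - part i j] \<Longrightarrow>
      (\<forall>a<vars s ''t''. mem t a = mem s a) \<Longrightarrow> mem t (vars s ''t'') = Suc i \<Longrightarrow>
      mem t (Suc (vars s ''t'')) = vars s ''c'' \<Longrightarrow> marks (mem t) (vars s ''t'') (X - part i j) \<Longrightarrow>
      vars t ''t'' = vars s ''t'' + (if ora (X - part i j) then n + 2 else 0) \<Longrightarrow>
      steps t \<le> steps s + 10 * n + 20 \<Longrightarrow> P t"
  shows "wp ora (push j) P s"
proof -
  define Inv where "Inv t \<longleftrightarrow> same_vars [''u'', ''p''] (vars s) (vars t) \<and> coins t = coins s \<and>
      output_tape t = output_tape s \<and> queries t = queries s \<and> outputs t = outputs s \<and>
      vars t ''u'' \<le> n \<and> vars t ''p'' = vars t ''u'' * Z + i \<and>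
      set (query_tape t) = {w \<in> X - part i j. w < vars t ''u''} \<and>
      (\<forall>a<vars s ''t''. mem t a = mem s a) \<and> mem t (vars s ''t'') = Suc i \<and>
      mem t (Suc (vars s ''t'')) = vars s ''c'' \<and>
      (\<forall>w<vars t ''u''. mem t (vars s ''t'' + 2 + w) = of_bool (w \<in> X - part i j)) \<and>
      steps t \<le> steps s + 4 + 8 * vars t ''u''" for t :: config
  show ?thesis unfolding push_def
    apply simp
    apply (rule wp_While[where Inv = Inv and m = "\<lambda>t. n - vars t ''u''"])
    subgoal using vars qt by (simp add: Inv_def)
    subgoal for t
    proof -
      assume I: "Inv t" and cond: "bval (Less (V ''u'') (V ''n'')) t"
      have "same_vars [''u'', ''p''] (vars s) (vars t)" using I by (simp add: Inv_def)
      note same = same_varsD[OF this]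
      have u_le: "vars t ''u'' \<le> n" using I by (simp add: Inv_def)
      have v: "vars t ''n'' = n" "vars t ''Z'' = Z" "vars t ''h'' = vars s ''h''"
          "vars t ''t'' = vars s ''t''"
        and u: "vars t ''u'' < n"
        using cond vars same u_le by (simp_all del: wp_simps)
      \<comment> \<open>The table ends at \<open>n * Z\<close>, before the area that is being
        written, so its entries are still intact.\<close>
      have "vars t ''u'' * Z + i < vars s ''t''"
      proof -
        have "vars t ''u'' * Z + i < Suc (vars t ''u'') * Z" using i by simp
        also have "\<dots> \<le> n * Z" using u by (intro mult_le_mono1) simp
        finally show ?thesis using h by simp
      qed
      then have side: "mem t (vars t ''u'' * Z + i) = side i (vars t ''u'')"
        using tab u i I by (auto simp: table_def Inv_def)
      have mk: "mem t (vars s ''h'' + 2 + vars t ''u'') = of_bool (vars t ''u'' \<in> X)"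
        using X(1) u I h by (auto simp: marks_def Inv_def)
      have I': "same_vars [''u'', ''p''] (vars s) (vars t)" "coins t = coins s"
        "output_tape t = output_tape s" "queries t = queries s" "outputs t = outputs s"
        "vars t ''p'' = vars t ''u'' * Z + i" "mem t (vars s ''t'') = Suc i"
        "mem t (Suc (vars s ''t'')) = vars s ''c''"
        and m: "\<And>a. a < vars s ''t'' \<Longrightarrow> mem t a = mem s a"
        and mw: "\<And>w. w < vars t ''u'' \<Longrightarrow> mem t (vars s ''t'' + 2 + w) = of_bool (w \<in> X - part i j)"
        and qt: "set (query_tape t) = {w \<in> X - part i j. w < vars t ''u''}"
        and st: "steps t \<le> steps s + 4 + 8 * vars t ''u''"
        using I unfolding Inv_def by blast+
      have Suc_set: "{w \<in> X - part i j. w < Suc (vars t ''u'')} =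
          (if vars t ''u'' \<in> X \<and> side i (vars t ''u'') \<noteq> j then insert (vars t ''u'') else id)
            {w \<in> X - part i j. w < vars t ''u''}"
        by (auto simp: part_def less_Suc_eq)
      have inX: "vars t ''u'' \<in> X - part i j \<longleftrightarrow> vars t ''u'' \<in> X \<and> side i (vars t ''u'') \<noteq> j"
        by (simp add: part_def)
      show ?thesis
      proof (cases "vars t ''u'' \<in> X \<and> side i (vars t ''u'') \<noteq> j")
        case True
        then show ?thesis
          using u st mw inX
          by (simp add: mark_def Inv_def v side mk[simplified] I' m qt Suc_set diff_less_mono2
              All_less_Suc del: Diff_iff)
      next
        case False
        then show ?thesis
          using u st mw inX
          by (simp add: mark_def Inv_def v side mk[simplified] I' m qt Suc_set diff_less_mono2
              All_less_Suc del: Diff_iff) blast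
      qed
    qed
    subgoal for t
    proof -
      assume I: "Inv t" and cond: "\<not> bval (Less (V ''u'') (V ''n'')) t"
      have "same_vars [''u'', ''p''] (vars s) (vars t)" using I by (simp add: Inv_def)
      note same = same_varsD[OF this]
      have u_le: "vars t ''u'' \<le> n" using I by (simp add: Inv_def)
      have v: "vars t ''n'' = n" "vars t ''t'' = vars s ''t''" and u: "vars t ''u'' = n"
        using cond vars same u_le by (simp_all del: wp_simps)
      have sv: "same_vars [''u'', ''p'', ''r'', ''t''] (vars s) (vars t)"
        using I by (auto simp: Inv_def same_vars_def)
      have q: "set (query_tape t) = X - part i j"
        using I X(2) unfolding Inv_def u by auto
      have mk: "marks (mem t) (vars s ''t'') (X - part i j)"
        using I unfolding Inv_def u marks_def by simp
      have st: "steps t \<le> steps s + 4 + 8 * n" using I unfolding Inv_def u by simp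
      have m: "\<forall>a<vars s ''t''. mem t a = mem s a" "mem t (vars s ''t'') = Suc i"
          "mem t (Suc (vars s ''t'')) = vars s ''c''"
        and io: "coins t = coins s" "output_tape t = output_tape s" "queries t = queries s"
          "outputs t = outputs s"
        using I unfolding Inv_def by simp_all
      show ?thesis
        by (simp add: q v) (intro conjI impI post; use st in \<open>simp add: sv io m mk q v\<close>)
    qed
    done
qed

lemma wp_output_head:
  assumes vars: "vars s ''n'' = n" and X: "marks (mem s) (vars s ''h'') X" and ot: "output_tape s = []"
    and post: "\<And>t. same_vars [''u''] (vars s) (vars t) \<Longrightarrow> coins t = coins s \<Longrightarrow> query_tape t = query_tape s \<Longrightarrow>
      output_tape t = [] \<Longrightarrow> outputs t = outputs s @ [listing n X] \<Longrightarrow>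
      queries t = queries s \<Longrightarrow> mem t = mem s \<Longrightarrow> steps t \<le> steps s + 10 * n + 10 \<Longrightarrow> P t"
  shows "wp ora output_head P s"
proof -
  define Inv where "Inv t \<longleftrightarrow> same_vars [''u''] (vars s) (vars t) \<and> coins t = coins s \<and> query_tape t = query_tape s \<and>
      output_tape t = listing (vars t ''u'') X \<and> outputs t = outputs s \<and>
      queries t = queries s \<and> mem t = mem s \<and> vars t ''u'' \<le> n \<and>
      steps t \<le> steps s + 4 + 8 * vars t ''u''" for t :: config
  show ?thesis unfolding output_head_def
    apply simp
    apply (rule wp_While[where Inv = Inv and m = "\<lambda>t. n - vars t ''u''"])
    subgoal using vars ot by (simp add: Inv_def)
    subgoal for t
    proof -
      assume I: "Inv t" and cond: "bval (Less (V ''u'') (V ''n'')) t"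
      have "same_vars [''u''] (vars s) (vars t)" using I by (simp add: Inv_def)
      note same = same_varsD[OF this]
      have u_le: "vars t ''u'' \<le> n" using I by (simp add: Inv_def)
      have v: "vars t ''n'' = n" "vars t ''h'' = vars s ''h''"
        and u: "vars t ''u'' < n"
        using cond vars same u_le by (simp_all del: wp_simps)
      have mk: "mem s (vars s ''h'' + 2 + vars t ''u'') = of_bool (vars t ''u'' \<in> X)"
        using X(1) u by (auto simp: marks_def)
      have I': "same_vars [''u''] (vars s) (vars t)" "coins t = coins s"
        "query_tape t = query_tape s" "output_tape t = listing (vars t ''u'') X"
        "queries t = queries s" "outputs t = outputs s" "mem t = mem s"
        and st: "steps t \<le> steps s + 4 + 8 * vars t ''u''"
        using I unfolding Inv_def by blast+
      show ?thesis
        using u st by (cases "vars t ''u'' \<in> X")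
          (simp_all add: mark_def Inv_def v mk[simplified] I' diff_less_mono2)
    qed
    subgoal for t
    proof -
      assume I: "Inv t" and cond: "\<not> bval (Less (V ''u'') (V ''n'')) t"
      have "same_vars [''u''] (vars s) (vars t)" using I by (simp add: Inv_def)
      note same = same_varsD[OF this]
      have u_le: "vars t ''u'' \<le> n" using I by (simp add: Inv_def)
      have "vars t ''n'' = n" and u: "vars t ''u'' = n"
        using cond vars same u_le by (simp_all del: wp_simps)
      then show ?thesis using I unfolding Inv_def u wp_simps by (intro post) simp_all
    qed
    done
qed

section \<open>The queue of pending sets and one round of the main loop\<close>

type_synonym entry = "nat \<times> nat \<times> nat set"

fun queue :: "(nat \<Rightarrow> nat) \<Rightarrow> nat \<Rightarrow> entry list \<Rightarrow> bool" where
  "queue m a [] \<longleftrightarrow> True"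
| "queue m a ((i, c, X) # es) \<longleftrightarrow>
     m a = i \<and> m (Suc a) = c \<and> marks m a X \<and> queue m (a + (n + 2)) es"

lemma queue_append:
  "queue m a (es @ es') \<longleftrightarrow> queue m a es \<and> queue m (a + length es * (n + 2)) es'"
proof (induction es arbitrary: a)
  case (Cons e es)
  have "a + (n + 2) + length es * (n + 2) = a + length (e # es) * (n + 2)" by simp
  with Cons.IH[of "a + (n + 2)"] show ?case by (cases e) (simp only: append_Cons queue.simps conj_assoc)
qed simp

lemma marks_cong:
  "marks m a X \<Longrightarrow> (\<And>b. a + 2 \<le> b \<Longrightarrow> b < a + (n + 2) \<Longrightarrow> m' b = m b) \<Longrightarrow> marks m' a X"
  by (auto simp: marks_def)

lemma queue_cong:
  "queue m a es \<Longrightarrow> (\<And>b. a \<le> b \<Longrightarrow> b < a + length es * (n + 2) \<Longrightarrow> m' b = m b) \<Longrightarrow> queue m' a es"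
proof (induction es arbitrary: a)
  case (Cons e es)
  obtain i c X where e: "e = (i, c, X)" by (cases e)
  have *: "m' b = m b" if "a \<le> b" "b < a + (n + 2) + length es * (n + 2)" for b
    using Cons.prems(2)[of b] that by simp
  have q: "m a = i" "m (Suc a) = c" "marks m a X" "queue m (a + (n + 2)) es"
    using Cons.prems(1) by (simp_all add: e)
  have "queue m' (a + (n + 2)) es"
    by (rule Cons.IH[OF q(4)]) (simp add: *)
  moreover have "marks m' a X"
    by (rule marks_cong[OF q(3)]) (simp add: *)
  moreover have "m' a = m a" "m' (Suc a) = m (Suc a)" by (simp_all add: *)
  ultimately show ?case using q by (simp add: e)
qed simp

text \<open>The children of an entry are divided by the place where they are stored:
  \<open>stay\<close> replaces the head, \<open>fresh\<close> is appended at the tail.\<close>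

definition stay :: "nat \<Rightarrow> entry \<Rightarrow> entry list" where
  "stay Z = (\<lambda>(i, c, X). if i < Z
     then if active i X then if c < k then [(Suc i, Suc c, X)] else [] else [(Suc i, c, X)]
     else [])"

definition fresh :: "nat \<Rightarrow> entry \<Rightarrow> entry list" where
  "fresh Z = (\<lambda>(i, c, X). if i < Z \<and> active i X
     then (if ora (X - part i 1) then [(Suc i, c, X - part i 1)] else [])
       @ (if ora (X - part i 2) then [(Suc i, c, X - part i 2)] else [])
     else [])"

definition entry_ok :: "nat \<Rightarrow> entry \<Rightarrow> bool" where
  "entry_ok Z = (\<lambda>(i, c, X). 1 \<le> i \<and> i \<le> Z \<and> X \<subseteq> {..<n})"

lemma entry_ok_simp [simp]: "entry_ok Z (i, c, X) \<longleftrightarrow> 1 \<le> i \<and> i \<le> Z \<and> X \<subseteq> {..<n}"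
  by (simp add: entry_ok_def)

text \<open>The entries lie contiguously from \<open>h\<close> to \<open>t\<close>, behind the
  table. Memory from \<open>t\<close> on is unconstrained, which leaves room for rejected
  candidates.\<close>

definition ready :: "nat \<Rightarrow> entry list \<Rightarrow> config \<Rightarrow> bool" where
  "ready Z es s \<longleftrightarrow> vars s ''n'' = n \<and> vars s ''k'' = k \<and> vars s ''Z'' = Z \<and> table Z (mem s) \<and>
     n * Z \<le> vars s ''h'' \<and> vars s ''t'' = vars s ''h'' + length es * (n + 2) \<and>
     queue (mem s) (vars s ''h'') es \<and> query_tape s = [] \<and> output_tape s = [] \<and>
     (\<forall>e\<in>set es. entry_ok Z e)"

lemma table_cong:
  assumes "table Z m" "\<And>b. b < n * Z \<Longrightarrow> m' b = m b"
  shows "table Z m'"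
  unfolding table_def
proof (intro allI impI)
  fix u i assume "u < n" "1 \<le> i" "i < Z"
  have "u * Z + i < Suc u * Z" using \<open>i < Z\<close> by simp
  also have "\<dots> \<le> n * Z" using \<open>u < n\<close> by (intro mult_le_mono1) simp
  finally show "m' (u * Z + i) = side i u"
    using assms \<open>u < n\<close> \<open>1 \<le> i\<close> \<open>i < Z\<close> by (simp add: table_def)
qed

lemma marks_less_cong:
  "marks m a X \<Longrightarrow> a + (n + 2) \<le> b \<Longrightarrow> (\<forall>x<b. m' x = m x) \<Longrightarrow> marks m' a X"
  by (erule marks_cong) simp

lemma queue_less_cong:
  "queue m a es \<Longrightarrow> a + length es * (n + 2) \<le> b \<Longrightarrow> (\<forall>x<b. m' x = m x) \<Longrightarrow> queue m' a es"
  by (erule queue_cong) simp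

lemma table_less_cong:
  "table Z m \<Longrightarrow> n * Z \<le> b \<Longrightarrow> (\<forall>x<b. m' x = m x) \<Longrightarrow> table Z m'"
  by (erule table_cong) simp

lemma wp_process_head:
  assumes R: "ready Z ((i, c, X) # es) s"
    and post: "\<And>t. ready Z (stay Z (i, c, X) @ es @ fresh Z (i, c, X)) t \<Longrightarrow>
      outputs t = outputs s @ (if i < Z then [] else [listing n X]) \<Longrightarrow>
      length (queries t) = length (queries s) + (if i < Z \<and> active i X then 2 else 0) \<Longrightarrow>
      steps t \<le> steps s + 40 * n + 80 \<Longrightarrow> P t"
  shows "wp ora process_head P s"
proof -
  define h where "h = vars s ''h''"
  have v: "vars s ''n'' = n" "vars s ''k'' = k" "vars s ''Z'' = Z" "vars s ''h'' = h"
      "vars s ''t'' = h + (n + 2) + length es * (n + 2)"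
    and tab: "table Z (mem s)" and hZ: "n * Z \<le> h"
    and q: "mem s h = i" "mem s (Suc h) = c" "marks (mem s) h X" "queue (mem s) (h + (n + 2)) es"
    and io: "query_tape s = []" "output_tape s = []"
    and i: "1 \<le> i" "i \<le> Z" "X \<subseteq> {..<n}"
    and es: "\<forall>e\<in>set es. entry_ok Z e"
    using R unfolding ready_def h_def by simp_all
  have newX: "X - part i j \<subseteq> {..<n}" for j using i by auto
  have hZ': "n * Z \<le> Suc (Suc (h + n))" using hZ by simp
  define s1 where
    "s1 = s\<lparr>vars := (vars s)(''i'' := i, ''c'' := c), steps := Suc (Suc (Suc (steps s)))\<rparr>"
  show ?thesis
  proof (cases "i < Z")
    case False
    have nil: "stay Z (i, c, X) = []" "fresh Z (i, c, X) = []"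
      using False by (simp_all add: stay_def fresh_def)
    have "wp ora output_head (wp ora pop (wp ora Skip P)) s1"
    proof (rule wp_output_head[where X = X])
      fix t :: config
      assume sv: "same_vars [''u''] (vars s1) (vars t)"
        and t: "query_tape t = query_tape s1" "output_tape t = []"
          "outputs t = outputs s1 @ [listing n X]" "queries t = queries s1"
          "mem t = mem s1" "steps t \<le> steps s1 + 10 * n + 10"
      have v': "vars t ''n'' = n" "vars t ''k'' = k" "vars t ''Z'' = Z" "vars t ''h'' = h"
          "vars t ''t'' = h + (n + 2) + length es * (n + 2)"
        using same_varsD[OF sv] v by (simp_all add: s1_def)
      have q': "queue (mem s) (Suc (Suc (h + n))) es" using q(4) by simp
      show "wp ora pop (wp ora Skip P) t"
        unfolding pop_def wp_incr wp_simps
        by (rule post)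
          (use t in \<open>simp_all add: s1_def ready_def nil v' False es tab hZ' q' io\<close>)
    qed (simp_all add: s1_def v q io)
    then show ?thesis by (simp add: process_head_def s1_def v q False)
  next
    case True
    have "wp ora scan (wp ora (Cond (And (Less (N 0) (V ''a'')) (Less (N 0) (V ''b''))) branch
           (Store (V ''h'') (Plus (V ''i'') (N 1)))) (wp ora Skip P)) s1"
    proof (rule wp_scan[where Z = Z and i = i and X = X])
      fix t1 :: config
      assume sv: "same_vars [''a'', ''b'', ''u'', ''p''] (vars s1) (vars t1)"
        and io1: "same_io s1 t1" and m1': "mem t1 = mem s1"
        and a: "0 < vars t1 ''a'' \<longleftrightarrow> X \<inter> part i 1 \<noteq> {}"
        and b: "0 < vars t1 ''b'' \<longleftrightarrow> X \<inter> part i 2 \<noteq> {}"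
        and st1': "steps t1 \<le> steps s1 + 10 * n + 10"
      have m1: "mem t1 = mem s" and st1: "steps t1 \<le> steps s + 10 * n + 13"
        using m1' st1' by (simp_all add: s1_def)
      have v1: "vars t1 ''n'' = n" "vars t1 ''k'' = k" "vars t1 ''Z'' = Z" "vars t1 ''h'' = h"
          "vars t1 ''t'' = h + (n + 2) + length es * (n + 2)" "vars t1 ''i'' = i" "vars t1 ''c'' = c"
        using same_varsD[OF sv] v by (simp_all add: s1_def)
      have io1': "query_tape t1 = []" "output_tape t1 = []" "outputs t1 = outputs s"
          "queries t1 = queries s"
        using io1 io by (simp_all add: same_io_def s1_def)
      have act: "0 < vars t1 ''a'' \<and> 0 < vars t1 ''b'' \<longleftrightarrow> active i X"
        unfolding a b active_def ..
      show "wp ora (Cond (And (Less (N 0) (V ''a'')) (Less (N 0) (V ''b''))) branch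
           (Store (V ''h'') (Plus (V ''i'') (N 1)))) (wp ora Skip P) t1"
      proof (cases "active i X")
        case inact: False
        have st: "stay Z (i, c, X) = [(Suc i, c, X)]" "fresh Z (i, c, X) = []"
          using True inact by (simp_all add: stay_def fresh_def)
        have tab': "table Z ((mem s)(h := Suc i))"
          by (rule table_less_cong[OF tab hZ]) simp
        have mk': "marks ((mem s)(h := Suc i)) h X"
          by (rule marks_cong[OF q(3)]) simp
        have q': "queue ((mem s)(h := Suc i)) (Suc (Suc (h + n))) es"
          by (rule queue_cong[of "mem s"]) (use q(4) in simp_all)
        have na: "\<not> (0 < vars t1 ''a'' \<and> 0 < vars t1 ''b'')" using act inact by simp
        have "ready Z ([(Suc i, c, X)] @ es @ [])
            (t1\<lparr>mem := (mem s)(h := Suc i), steps := Suc (Suc (Suc (steps t1)))\<rparr>)"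
          unfolding ready_def using es i True
          by (simp add: v1 io1' tab' mk' q' hZ q(2))
        then have "P (t1\<lparr>mem := (mem s)(h := Suc i), steps := Suc (Suc (Suc (steps t1)))\<rparr>)"
          using st1 inact True by (intro post) (simp_all add: st io1')
        then show ?thesis using na by (auto simp: v1 m1)
      next
        case actv: True
        define t where "t = h + (n + 2) + length es * (n + 2)"
        define E where "E j = (if ora (X - part i j) then [(Suc i, c, X - part i j)] else [])" for j
        have fr: "fresh Z (i, c, X) = E 1 @ E 2"
          using True actv by (simp add: fresh_def E_def)
        have E_ok: "\<forall>e\<in>set (E j). entry_ok Z e" for j
          using True newX[of j] by (simp add: E_def)
        have E_queue: "queue m a (E j)"
          if "m a = Suc i" "m (Suc a) = c" "marks m a (X - part i j)" for m a j
          using that by (simp add: E_def)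
        have t_ge: "h + (n + 2) \<le> t" "h + (n + 2) + length es * (n + 2) \<le> t" "n * Z \<le> t"
          using hZ by (simp_all add: t_def)
        have "wp ora (push 1) (wp ora (push 2) (wp ora advance (wp ora Skip (wp ora Skip P)))) (tick t1)"
        proof (rule wp_push[where Z = Z and i = i and X = X])
          fix t2 :: config
          assume sv2: "same_vars [''u'', ''p'', ''r'', ''t''] (vars (tick t1)) (vars t2)"
            and io2': "query_tape t2 = []" "output_tape t2 = output_tape (tick t1)"
              "outputs t2 = outputs (tick t1)" "queries t2 = queries (tick t1) @ [X - part i 1]"
            and m2': "\<forall>a<vars (tick t1) ''t''. mem t2 a = mem (tick t1) a"
              "mem t2 (vars (tick t1) ''t'') = Suc i"
              "mem t2 (Suc (vars (tick t1) ''t'')) = vars (tick t1) ''c''"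
              "marks (mem t2) (vars (tick t1) ''t'') (X - part i 1)"
            and tt2: "vars t2 ''t'' = vars (tick t1) ''t'' + (if ora (X - part i 1) then n + 2 else 0)"
            and st2: "steps t2 \<le> steps (tick t1) + 10 * n + 20"
          have tt: "vars (tick t1) ''t'' = t" using v1 by (simp add: t_def)
          have m2: "\<forall>a<t. mem t2 a = mem s a" using m2'(1) unfolding tt by (simp add: m1)
          have Q1: "queue (mem t2) t (E 1)"
            using m2'(2-4) unfolding tt by (intro E_queue) (simp_all add: v1)
          have v2: "vars t2 ''n'' = n" "vars t2 ''k'' = k" "vars t2 ''Z'' = Z" "vars t2 ''h'' = h"
              "vars t2 ''i'' = i" "vars t2 ''c'' = c" "vars t2 ''t'' = t + length (E 1) * (n + 2)"
            using same_varsD[OF sv2] v1 tt2 unfolding tt by (simp_all add: E_def)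
          note tab2 = table_less_cong[OF tab t_ge(3) m2]
          note q2 = queue_less_cong[OF q(4) t_ge(2) m2]
          note mk2 = marks_less_cong[OF q(3) t_ge(1) m2]
          define t' where "t' = t + length (E 1) * (n + 2)"
          show "wp ora (push 2) (wp ora advance (wp ora Skip (wp ora Skip P))) t2"
          proof (rule wp_push[where Z = Z and i = i and X = X])
            fix t3 :: config
            assume sv3: "same_vars [''u'', ''p'', ''r'', ''t''] (vars t2) (vars t3)"
              and io3': "query_tape t3 = []" "output_tape t3 = output_tape t2"
                "outputs t3 = outputs t2" "queries t3 = queries t2 @ [X - part i 2]"
              and m3': "\<forall>a<vars t2 ''t''. mem t3 a = mem t2 a"
                "mem t3 (vars t2 ''t'') = Suc i"
                "mem t3 (Suc (vars t2 ''t'')) = vars t2 ''c''"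
                "marks (mem t3) (vars t2 ''t'') (X - part i 2)"
              and tt3: "vars t3 ''t'' = vars t2 ''t'' + (if ora (X - part i 2) then n + 2 else 0)"
              and st3: "steps t3 \<le> steps t2 + 10 * n + 20"
            have tt': "vars t2 ''t'' = t'" using v2 by (simp add: t'_def)
            have m3: "\<forall>a<t'. mem t3 a = mem t2 a" using m3'(1) unfolding tt' .
            have "t \<le> t'" by (simp add: t'_def)
            have m3s: "\<forall>a<t. mem t3 a = mem s a"
              using m3 m2 \<open>t \<le> t'\<close> by simp
            have Q2: "queue (mem t3) t' (E 2)"
              using m3'(2-4) unfolding tt' by (intro E_queue) (simp_all add: v2)
            \<comment> \<open>The second push writes only from \<open>t'\<close> on. An accepted
              first candidate lies before \<open>t'\<close> and is preserved; a rejected one is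
              overwritten.\<close>
            have Q1': "queue (mem t3) t (E 1)"
              by (rule queue_less_cong[OF Q1 _ m3]) (simp add: t'_def)
            have q3: "queue (mem t3) (h + (n + 2)) (es @ E 1 @ E 2)"
              using queue_less_cong[OF q(4) t_ge(2) m3s] Q1' Q2
              unfolding queue_append t'_def t_def by simp
            note tab3 = table_less_cong[OF tab t_ge(3) m3s]
            note mk3 = marks_less_cong[OF q(3) t_ge(1) m3s]
            have v3: "vars t3 ''n'' = n" "vars t3 ''k'' = k" "vars t3 ''Z'' = Z" "vars t3 ''h'' = h"
                "vars t3 ''i'' = i" "vars t3 ''c'' = c"
                "vars t3 ''t'' = h + (n + 2) + length (es @ E 1 @ E 2) * (n + 2)"
              using same_varsD[OF sv3] v2 tt3 unfolding tt' t'_def t_def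
              by (simp_all add: E_def)
            have io3: "query_tape t3 = []" "output_tape t3 = []" "outputs t3 = outputs s"
                "length (queries t3) = length (queries s) + 2"
              using io3' io2' io1' by simp_all
            have st4: "steps t3 \<le> steps s + 30 * n + 60" using st3 st2 st1 by simp
            have ok: "\<forall>e\<in>set (es @ E 1 @ E 2). entry_ok Z e" using es E_ok by auto
            show "wp ora advance (wp ora Skip (wp ora Skip P)) t3"
            proof (cases "c < k")
              case ck: True
              have stay: "stay Z (i, c, X) = [(Suc i, Suc c, X)]"
                using True actv ck by (simp add: stay_def)
              define m where "m = (mem t3)(h := Suc i, Suc h := Suc c)"
              have tab4: "table Z m"
                by (rule table_less_cong[OF tab3 hZ]) (simp add: m_def)
              have mk4: "marks m h X" by (rule marks_cong[OF mk3]) (simp add: m_def)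
              have q4: "queue m (h + (n + 2)) (es @ E 1 @ E 2)"
                by (rule queue_cong[OF q3]) (simp add: m_def)
              have "ready Z (stay Z (i, c, X) @ es @ fresh Z (i, c, X)) (t3\<lparr>mem := m, steps := x\<rparr>)" for x
                unfolding ready_def stay fr using ok True i
                by (simp add: v3 io3 tab4 mk4 hZ q4[simplified]) (simp add: m_def)
              then show ?thesis
                using st4 True actv ck
                by (simp add: advance_def v3 m_def) (rule post; simp add: io3)
            next
              case ck: False
              have stay: "stay Z (i, c, X) = []"
                using True actv ck by (simp add: stay_def)
              have "ready Z (stay Z (i, c, X) @ es @ fresh Z (i, c, X))
                  (t3\<lparr>vars := (vars t3)(''h'' := h + (n + 2)), steps := x\<rparr>)" for x
                unfolding ready_def stay fr using ok True i
                by (simp add: v3 io3 tab3 hZ' q3[simplified])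
              then show ?thesis
                using st4 True actv ck
                by (simp add: advance_def v3 pop_def) (rule post; simp add: io3)
            qed
          qed (simp_all add: v2 i[simplified] True tab2 mk2 hZ io2' t_ge[simplified] t_def)
        qed (simp_all add: v1 i[simplified] True tab q m1 hZ io1')
        then show ?thesis using act actv by (simp add: branch_def)
      qed
    qed (simp_all add: s1_def v q io i[simplified] True tab)
    then show ?thesis by (simp add: process_head_def s1_def v q True)
  qed
qed


text \<open>A multiset, because the queue treats the branches in another order than
  \<open>leaves\<close> does.\<close>

definition entry_leaves :: "nat \<Rightarrow> entry \<Rightarrow> nat set multiset" where
  "entry_leaves Z = (\<lambda>(i, c, X). mset (leaves (Z - i) i c X))"

definition entry_calls :: "nat \<Rightarrow> entry \<Rightarrow> nat" where
  "entry_calls Z = (\<lambda>(i, c, X). ncalls (Z - i) i c X)"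

definition entry_iter :: "nat \<Rightarrow> entry \<Rightarrow> nat" where
  "entry_iter Z = (\<lambda>(i, c, X). niter (Z - i) i c X)"

lemmas entry_defs = entry_leaves_def entry_calls_def entry_iter_def stay_def fresh_def

text \<open>The recursion equations of \<open>leaves\<close>, \<open>ncalls\<close> and
  \<open>niter\<close>, read as conservation laws for one round of the loop.\<close>

lemma entry_step:
  assumes "i < Z"
  shows "sum_list (map (entry_leaves Z) (stay Z (i, c, X))) + sum_list (map (entry_leaves Z) (fresh Z (i, c, X)))
      = entry_leaves Z (i, c, X)"
    "sum_list (map (entry_calls Z) (stay Z (i, c, X))) + sum_list (map (entry_calls Z) (fresh Z (i, c, X)))
      + (if active i X then 2 else 0) = entry_calls Z (i, c, X)"
    "sum_list (map (entry_iter Z) (stay Z (i, c, X))) + sum_list (map (entry_iter Z) (fresh Z (i, c, X))) + 1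
      = entry_iter Z (i, c, X)"
proof -
  obtain m where m: "Z - i = Suc m" "Z - Suc i = m" using assms by (metis Suc_diff_Suc)
  show "sum_list (map (entry_leaves Z) (stay Z (i, c, X))) + sum_list (map (entry_leaves Z) (fresh Z (i, c, X)))
      = entry_leaves Z (i, c, X)"
    using assms by (simp add: entry_defs m)
  show "sum_list (map (entry_calls Z) (stay Z (i, c, X))) + sum_list (map (entry_calls Z) (fresh Z (i, c, X)))
      + (if active i X then 2 else 0) = entry_calls Z (i, c, X)"
    using assms by (simp add: entry_defs m)
  show "sum_list (map (entry_iter Z) (stay Z (i, c, X))) + sum_list (map (entry_iter Z) (fresh Z (i, c, X))) + 1
      = entry_iter Z (i, c, X)"
    using assms by (simp add: entry_defs m)
qed

text \<open>The output so far together with the leaves of the pending entries is invariant, and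
  likewise for the calls. The number of pending rounds drops by one in every round; it is both the
  termination measure and the time budget.\<close>

lemma wp_search_all:
  assumes R: "ready Z es s" and out: "outputs s = []"
    and post: "\<And>t Ys. outputs t = map (listing n) Ys \<Longrightarrow>
      mset Ys = sum_list (map (entry_leaves Z) es) \<Longrightarrow>
      length (queries t) = length (queries s) + sum_list (map (entry_calls Z) es) \<Longrightarrow>
      steps t \<le> steps s + (40 * n + 81) * sum_list (map (entry_iter Z) es) + 1 \<Longrightarrow> P t"
  shows "wp ora search_all P s"
proof -
  define K where "K = 40 * n + 81"
  define Inv where "Inv m t \<longleftrightarrow> (\<exists>es' Ys. ready Z es' t \<and> m = sum_list (map (entry_iter Z) es') \<and>
      outputs t = map (listing n) Ys \<and>
      mset Ys + sum_list (map (entry_leaves Z) es') = sum_list (map (entry_leaves Z) es) \<and>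
      length (queries t) + sum_list (map (entry_calls Z) es')
        = length (queries s) + sum_list (map (entry_calls Z) es) \<and>
      steps t + K * m \<le> steps s + K * sum_list (map (entry_iter Z) es))" for m t
  have ready_tick: "ready Z es' (tick t) \<longleftrightarrow> ready Z es' t" for es' t by (simp add: ready_def)
  show ?thesis unfolding search_all_def
  proof (rule wp_While_variant[where Inv = Inv and m = "sum_list (map (entry_iter Z) es)"])
    show "Inv (sum_list (map (entry_iter Z) es)) s"
      unfolding Inv_def using R out by (intro exI[of _ es] exI[of _ "[]"]) simp
  next
    fix m and t :: config
    assume "Inv m t" and cond: "bval (Less (V ''h'') (V ''t'')) t"
    then obtain es' Ys where R': "ready Z es' t" and m: "m = sum_list (map (entry_iter Z) es')"
      and out': "outputs t = map (listing n) Ys"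
      and lv: "mset Ys + sum_list (map (entry_leaves Z) es') = sum_list (map (entry_leaves Z) es)"
      and cl: "length (queries t) + sum_list (map (entry_calls Z) es')
        = length (queries s) + sum_list (map (entry_calls Z) es)"
      and st: "steps t + K * m \<le> steps s + K * sum_list (map (entry_iter Z) es)"
      unfolding Inv_def by blast
    have "es' \<noteq> []" using R' cond by (auto simp: ready_def)
    then obtain i c X es'' where es': "es' = (i, c, X) # es''" by (metis list.exhaust prod_cases3)
    have iZ: "i \<le> Z" using R' by (simp add: ready_def es')
    let ?qs = "stay Z (i, c, X) @ es'' @ fresh Z (i, c, X)"
    show "wp ora process_head (\<lambda>t. \<exists>m'<m. Inv m' t) (tick t)"
    proof (rule wp_process_head)
      show "ready Z ((i, c, X) # es'') (tick t)" using R' unfolding ready_tick es' .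
    next
      fix t'
      assume t': "ready Z ?qs t'"
        "outputs t' = outputs (tick t) @ (if i < Z then [] else [listing n X])"
        "length (queries t') = length (queries (tick t)) + (if i < Z \<and> active i X then 2 else 0)"
        "steps t' \<le> steps (tick t) + 40 * n + 80"
      define m' where "m' = sum_list (map (entry_iter Z) ?qs)"
      have m': "m = m' + 1"
      proof (cases "i < Z")
        case True
        then show ?thesis using entry_step(3)[OF True, of c X] by (simp add: m m'_def es')
      next
        case False
        then show ?thesis using iZ by (simp add: m m'_def es' entry_defs)
      qed
      have st': "steps t' + K * m' \<le> steps s + K * sum_list (map (entry_iter Z) es)"
        using t'(4) st unfolding m' K_def by (simp add: algebra_simps)
      have cl': "length (queries t') + sum_list (map (entry_calls Z) ?qs)
        = length (queries s) + sum_list (map (entry_calls Z) es)"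
      proof (cases "i < Z")
        case True
        then show ?thesis using entry_step(2)[OF True, of c X] cl t'(3) by (simp add: es')
      next
        case False
        then show ?thesis using iZ cl t'(3) by (simp add: es' entry_defs)
      qed
      have "\<exists>Ys. outputs t' = map (listing n) Ys \<and>
          mset Ys + sum_list (map (entry_leaves Z) ?qs) = sum_list (map (entry_leaves Z) es)"
      proof (cases "i < Z")
        case True
        then show ?thesis using entry_step(1)[OF True, of c X] lv t'(2) out'
          by (intro exI[of _ Ys]) (simp add: es' ac_simps)
      next
        case False
        then show ?thesis using iZ lv t'(2) out'
          by (intro exI[of _ "Ys @ [X]"]) (simp add: es' entry_defs)
      qed
      then have "Inv m' t'" unfolding Inv_def using t'(1) cl' st' m'_def by blast
      then show "\<exists>m'<m. Inv m' t'" using m' by (intro exI[of _ m']) simp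
    qed
  next
    fix m and t :: config
    assume "Inv m t" and cond: "\<not> bval (Less (V ''h'') (V ''t'')) t"
    then obtain es' Ys where R': "ready Z es' t" and m: "m = sum_list (map (entry_iter Z) es')"
      and out': "outputs t = map (listing n) Ys"
      and lv: "mset Ys + sum_list (map (entry_leaves Z) es') = sum_list (map (entry_leaves Z) es)"
      and cl: "length (queries t) + sum_list (map (entry_calls Z) es')
        = length (queries s) + sum_list (map (entry_calls Z) es)"
      and st: "steps t + K * m \<le> steps s + K * sum_list (map (entry_iter Z) es)"
      unfolding Inv_def by blast
    have "es' = []" using R' cond by (auto simp: ready_def)
    then show "P (tick t)"
      using out' lv cl st m by (intro post[of _ Ys]) (simp_all add: K_def)
  qed
qed

end

section \<open>Correctness of the initialisation\<close>

text \<open>The program does not initialise \<open>u\<close> here: the value 0 comes from the start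
  configuration.\<close>

lemma wp_query_all:
  assumes s: "vars s ''u'' = 0" "query_tape s = []"
    and post: "\<And>t. same_vars [''u'', ''r''] (vars s) (vars t) \<Longrightarrow>
      vars t ''r'' = of_bool (ora {..<vars s ''n''}) \<Longrightarrow> mem t = mem s \<Longrightarrow> coins t = coins s \<Longrightarrow>
      query_tape t = [] \<Longrightarrow> output_tape t = output_tape s \<Longrightarrow> outputs t = outputs s \<Longrightarrow>
      queries t = queries s @ [{..<vars s ''n''}] \<Longrightarrow> steps t \<le> steps s + 3 * vars s ''n'' + 5 \<Longrightarrow> P t"
  shows "wp ora query_all P s"
proof -
  define n where "n = vars s ''n''"
  define Inv where "Inv t \<longleftrightarrow> same_vars [''u''] (vars s) (vars t) \<and> vars t ''u'' \<le> n \<and>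
      set (query_tape t) = {..<vars t ''u''} \<and> mem t = mem s \<and> coins t = coins s \<and>
      output_tape t = output_tape s \<and> outputs t = outputs s \<and> queries t = queries s \<and>
      steps t \<le> steps s + 3 * vars t ''u''" for t :: config
  have "wp ora (While (Less (V ''u'') (V ''n'')) (Seq (Ask (V ''u'')) (incr ''u'' (N 1))))
      (wp ora (Call ''r'') (wp ora Skip P)) s"
  proof (rule wp_While[where Inv = Inv and m = "\<lambda>t. n - vars t ''u''"])
    show "Inv s" using s by (simp add: Inv_def)
  next
    fix t :: config assume I: "Inv t" and cond: "bval (Less (V ''u'') (V ''n'')) t"
    have "same_vars [''u''] (vars s) (vars t)" using I by (simp add: Inv_def)
    then have "vars t ''n'' = n" by (simp add: same_vars_def n_def)
    with I cond show "wp ora (Seq (Ask (V ''u'')) (incr ''u'' (N 1)))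
        (\<lambda>t'. Inv t' \<and> n - vars t' ''u'' < n - vars t ''u'') (tick t)"
      by (simp add: Inv_def lessThan_Suc diff_less_mono2)
  next
    fix t :: config assume I: "Inv t" and cond: "\<not> bval (Less (V ''u'') (V ''n'')) t"
    have sv: "same_vars [''u''] (vars s) (vars t)" using I by (simp add: Inv_def)
    then have "vars t ''n'' = n" by (simp add: same_vars_def n_def)
    then have u: "vars t ''u'' = n" using I cond by (simp add: Inv_def)
    have "same_vars [''u'', ''r''] (vars s) (vars t)" using sv by (simp add: same_vars_def)
    then show "wp ora (Call ''r'') (wp ora Skip P) (tick t)"
      using I unfolding Inv_def u wp_simps by (intro post) (simp_all add: n_def)
  qed
  then show ?thesis by (simp add: query_all_def)
qed

text \<open>The loop of \<open>size_up\<close> doubles \<open>Q\<close> until it reaches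
  \<open>n\<close>. The least exponent describes this exactly, also for \<open>n \<le> 1\<close>,
  where a logarithm would need rounding and special cases.\<close>

definition depth :: "nat \<Rightarrow> nat" where
  "depth n = (LEAST d. n \<le> 2 ^ d)"

lemma depth_le: "n \<le> 2 ^ depth n"
  unfolding depth_def by (rule LeastI[of _ n]) (simp add: less_imp_le)

lemma less_depth_iff: "d < depth n \<longleftrightarrow> 2 ^ d < n"
proof
  assume "d < depth n"
  then show "2 ^ d < n" unfolding depth_def using not_less_Least[of d "\<lambda>d. n \<le> 2 ^ d"] by auto
next
  assume "2 ^ d < n"
  then have "2 ^ d < (2 :: nat) ^ depth n" using depth_le[of n] by linarith
  then show "d < depth n" by simp
qed

lemma depth_le_double: "2 ^ depth n \<le> 2 * max 1 n"
proof (cases "depth n")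
  case (Suc d)
  then have "2 ^ d < n" using less_depth_iff[of d n] by simp
  then show ?thesis using Suc by simp
qed simp

lemma wp_size_up:
  assumes post: "\<And>t. same_vars [''Q'', ''Z''] (vars s) (vars t) \<Longrightarrow>
      vars t ''Q'' = 2 ^ depth (vars s ''n'') \<Longrightarrow> vars t ''Z'' = 2 ^ depth (vars s ''n'') + vars s ''n'' \<Longrightarrow>
      mem t = mem s \<Longrightarrow> coins t = coins s \<Longrightarrow>
      query_tape t = query_tape s \<Longrightarrow> output_tape t = output_tape s \<Longrightarrow> outputs t = outputs s \<Longrightarrow>
      queries t = queries s \<Longrightarrow> steps t \<le> steps s + 2 * depth (vars s ''n'') + 5 \<Longrightarrow> P t"
  shows "wp ora size_up P s"
proof -
  define n where "n = vars s ''n''"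
  define Inv where "Inv m t \<longleftrightarrow> (\<exists>d\<le>depth n. m = depth n - d \<and> vars t ''Q'' = 2 ^ d \<and>
      steps t \<le> steps s + 1 + 2 * d) \<and> same_vars [''Q''] (vars s) (vars t) \<and>
      mem t = mem s \<and> coins t = coins s \<and> query_tape t = query_tape s \<and>
      output_tape t = output_tape s \<and> outputs t = outputs s \<and> queries t = queries s" for m and t :: config
  have "wp ora (While (Less (V ''Q'') (V ''n'')) (incr ''Q'' (V ''Q'')))
      (wp ora (Assign ''Z'' (Plus (V ''Q'') (V ''n''))) (wp ora Skip P)) (tick (s\<lparr>vars := (vars s)(''Q'' := 1)\<rparr>))"
  proof (rule wp_While_variant[where Inv = Inv and m = "depth n"])
    show "Inv (depth n) (tick (s\<lparr>vars := (vars s)(''Q'' := 1)\<rparr>))"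
      unfolding Inv_def by (intro conjI exI[of _ 0]) simp_all
  next
    fix m and t :: config assume I: "Inv m t" and cond: "bval (Less (V ''Q'') (V ''n'')) t"
    then obtain d where d: "d \<le> depth n" "m = depth n - d" "vars t ''Q'' = 2 ^ d"
        "steps t \<le> steps s + 1 + 2 * d"
      and sv: "same_vars [''Q''] (vars s) (vars t)"
      and io: "mem t = mem s" "coins t = coins s" "query_tape t = query_tape s"
        "output_tape t = output_tape s" "outputs t = outputs s" "queries t = queries s"
      unfolding Inv_def by blast
    have "vars t ''n'' = n" using sv by (simp add: same_vars_def n_def)
    then have "d < depth n" using cond d(3) less_depth_iff by simp
    then have "Inv (depth n - Suc d) (t\<lparr>vars := (vars t)(''Q'' := 2 ^ Suc d), steps := Suc (Suc (steps t))\<rparr>)"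
      unfolding Inv_def using sv io d(4) by (intro conjI exI[of _ "Suc d"]) simp_all
    then show "wp ora (incr ''Q'' (V ''Q'')) (\<lambda>t. \<exists>m'<m. Inv m' t) (tick t)"
      using \<open>d < depth n\<close> d(2,3) by (intro exI[of _ "depth n - Suc d"] | simp add: mult_2)+
  next
    fix m and t :: config assume I: "Inv m t" and cond: "\<not> bval (Less (V ''Q'') (V ''n'')) t"
    then obtain d where d: "d \<le> depth n" "m = depth n - d" "vars t ''Q'' = 2 ^ d"
        "steps t \<le> steps s + 1 + 2 * d"
      and sv: "same_vars [''Q''] (vars s) (vars t)"
      and io: "mem t = mem s" "coins t = coins s" "query_tape t = query_tape s"
        "output_tape t = output_tape s" "outputs t = outputs s" "queries t = queries s"
      unfolding Inv_def by blast
    have n: "vars t ''n'' = n" using sv by (simp add: same_vars_def n_def)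
    then have "\<not> d < depth n" using cond d(3) less_depth_iff by simp
    then have "d = depth n" using d(1) by simp
    moreover have "same_vars [''Q'', ''Z''] (vars s) (vars t)" using sv by (simp add: same_vars_def)
    ultimately show "wp ora (Assign ''Z'' (Plus (V ''Q'') (V ''n''))) (wp ora Skip P) (tick t)"
      using d io n unfolding wp_simps by (intro post) (simp_all add: n_def)
  qed
  then show ?thesis by (simp add: size_up_def)
qed

section \<open>Random descents to the leaves and the table of sides\<close>

definition leaf_of :: "bool list \<Rightarrow> nat" where
  "leaf_of bs = foldl (\<lambda>v b. v + v + of_bool b) 1 bs"

lemma leaf_of_snoc: "leaf_of (bs @ [b]) = leaf_of bs + leaf_of bs + of_bool b"
  by (simp add: leaf_of_def)

lemma leaf_of_bounds: "2 ^ length bs \<le> leaf_of bs \<and> leaf_of bs < 2 * 2 ^ length bs"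
proof (induction bs rule: rev_induct)
  case (snoc b bs)
  then show ?case by (cases b) (simp_all add: leaf_of_snoc)
qed (simp add: leaf_of_def)

text \<open>Descending one more level does not change the ancestors on cuts up to \<open>v\<close>,
  so sides that have been recorded remain correct.\<close>

lemma heap_side_child:
  assumes "1 \<le> i" "i < v" "b \<le> 1"
  shows "heap_side i (v + v + b) = heap_side i v"
proof -
  have "(v + v + b) div 2 = v" using assms by simp
  then have "anc i (v + v + b) = anc i v" "anc (Suc i) (v + v + b) = anc (Suc i) v"
    using assms by (simp_all add: anc_step)
  then show ?thesis by (simp add: heap_side_def)
qed

lemma heap_side_parent:
  assumes "1 \<le> v" "b \<le> 1"
  shows "heap_side v (v + v + b) = b + 1"
proof -
  have "(v + v + b) div 2 = v" using assms by simp
  then have "anc v (v + v + b) = v" using assms by (simp add: anc_step anc_small)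
  moreover have "anc (Suc v) (v + v + b) = v + v + b" using assms by (simp add: anc_small)
  ultimately show ?thesis using assms by (auto simp: heap_side_def)
qed

text \<open>The child of \<open>v\<close> is already on the cut at \<open>i\<close> and differs from
  \<open>i\<close>, so step \<open>i\<close> does not split its cell; the untouched zeros of the row
  are right.\<close>

lemma heap_side_off_path:
  assumes "1 \<le> v" "v < i" "i < v + v + b" "b \<le> 1"
  shows "heap_side i (v + v + b) = 0"
  using assms by (simp add: heap_side_def anc_small)

text \<open>Only the nodes on the path are written, and all other sides rely on fresh memory, hence
  the premise \<open>zero\<close>. The invariant describes the row as if the node reached so far
  were the final leaf.\<close>

lemma wp_walk:
  assumes Q: "vars s ''Q'' = 2 ^ L" and p: "vars s ''p'' = p"
    and zero: "\<And>i. 1 \<le> i \<Longrightarrow> i < 2 ^ L \<Longrightarrow> mem s (p + i) = 0"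
    and post: "\<And>t. same_vars [''v'', ''b''] (vars s) (vars t) \<Longrightarrow>
      vars t ''v'' = leaf_of (stake L (coins s)) \<Longrightarrow> coins t = sdrop L (coins s) \<Longrightarrow>
      mem t p = leaf_of (stake L (coins s)) \<Longrightarrow>
      (\<And>i. 1 \<le> i \<Longrightarrow> i < 2 ^ L \<Longrightarrow> mem t (p + i) = heap_side i (leaf_of (stake L (coins s)))) \<Longrightarrow>
      (\<And>a. a < p \<or> p + 2 ^ L \<le> a \<Longrightarrow> mem t a = mem s a) \<Longrightarrow>
      query_tape t = query_tape s \<Longrightarrow> output_tape t = output_tape s \<Longrightarrow> outputs t = outputs s \<Longrightarrow>
      queries t = queries s \<Longrightarrow> steps t \<le> steps s + 5 * L + 5 \<Longrightarrow> P t"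
  shows "wp ora walk P s"
proof -
  define \<omega> where "\<omega> = coins s"
  define leaf where "leaf d = leaf_of (stake d \<omega>)" for d
  have leaf_Suc: "leaf (Suc d) = leaf d + leaf d + of_bool (\<omega> !! d)" for d
    unfolding leaf_def stake_Suc leaf_of_snoc ..
  have leaf_bd: "2 ^ d \<le> leaf d" "leaf d < 2 * 2 ^ d" for d
    using leaf_of_bounds[of "stake d \<omega>"] by (simp_all add: leaf_def)
  have leaf_pos: "1 \<le> leaf d" for d
    using leaf_bd(1)[of d] by (meson le_trans one_le_numeral one_le_power)
  define Inv where "Inv m t \<longleftrightarrow> (\<exists>d\<le>L. m = L - d \<and> vars t ''v'' = leaf d \<and> coins t = sdrop d \<omega> \<and>
      (\<forall>i. 1 \<le> i \<longrightarrow> i < 2 ^ L \<longrightarrow> mem t (p + i) = (if i < leaf d then heap_side i (leaf d) else 0)) \<and>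
      steps t \<le> steps s + 1 + 5 * d) \<and> same_vars [''v'', ''b''] (vars s) (vars t) \<and>
      (\<forall>a. a < p \<or> p + 2 ^ L \<le> a \<longrightarrow> mem t a = mem s a) \<and>
      query_tape t = query_tape s \<and>
      output_tape t = output_tape s \<and> outputs t = outputs s \<and> queries t = queries s" for m and t :: config
  define body where "body = block
       [Coin ''b'',
        Store (Plus (V ''p'') (V ''v'')) (Plus (V ''b'') (N 1)),
        Assign ''v'' (Plus (Plus (V ''v'') (V ''v'')) (V ''b''))]"
  have "wp ora (While (Less (V ''v'') (V ''Q'')) body)
      (wp ora (Store (V ''p'') (V ''v'')) (wp ora Skip P)) (tick (s\<lparr>vars := (vars s)(''v'' := 1)\<rparr>))"
  proof (rule wp_While_variant[where Inv = Inv and m = L])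
    have l0: "leaf 0 = 1" by (simp add: leaf_def leaf_of_def)
    show "Inv L (tick (s\<lparr>vars := (vars s)(''v'' := 1)\<rparr>))"
      unfolding Inv_def by (intro conjI exI[of _ 0]) (simp_all add: l0 \<omega>_def zero[simplified])
  next
    fix m and t :: config assume I: "Inv m t" and cond: "bval (Less (V ''v'') (V ''Q'')) t"
    then obtain d where d: "d \<le> L" "m = L - d" "vars t ''v'' = leaf d" "coins t = sdrop d \<omega>"
        "steps t \<le> steps s + 1 + 5 * d"
      and mem: "\<And>i. 1 \<le> i \<Longrightarrow> i < 2 ^ L \<Longrightarrow> mem t (p + i) = (if i < leaf d then heap_side i (leaf d) else 0)"
      and sv: "same_vars [''v'', ''b''] (vars s) (vars t)"
      and out: "\<And>a. a < p \<or> p + 2 ^ L \<le> a \<Longrightarrow> mem t a = mem s a"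
      and io: "query_tape t = query_tape s"
        "output_tape t = output_tape s" "outputs t = outputs s" "queries t = queries s"
      unfolding Inv_def by blast
    have v: "vars t ''Q'' = 2 ^ L" "vars t ''p'' = p" using sv Q p by (simp_all add: same_vars_def)
    then have lt: "leaf d < 2 ^ L" using cond d(3) by simp
    then have "(2 :: nat) ^ d < 2 ^ L" using leaf_bd(1)[of d] by linarith
    then have dL: "d < L" by simp
    let ?b = "of_bool (\<omega> !! d) :: nat"
    define t' where "t' = t\<lparr>coins := sdrop (Suc d) \<omega>, mem := (mem t)(p + leaf d := ?b + 1),
      vars := (vars t)(''b'' := ?b, ''v'' := leaf (Suc d)), steps := Suc (Suc (Suc (Suc (Suc (steps t)))))\<rparr>"
    have "mem t' (p + i) = (if i < leaf (Suc d) then heap_side i (leaf (Suc d)) else 0)"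
      if i: "1 \<le> i" "i < 2 ^ L" for i
    proof -
      have b1: "?b \<le> 1" by simp
      consider "i < leaf d" | "i = leaf d" | "leaf d < i" "i < leaf (Suc d)" | "leaf (Suc d) \<le> i" by linarith
      then show ?thesis
      proof cases
        case 1
        then show ?thesis using mem[OF i] heap_side_child[OF i(1) 1 b1] leaf_Suc[of d] by (simp add: t'_def)
      next
        case 2
        then show ?thesis using heap_side_parent[OF leaf_pos[of d] b1] leaf_Suc[of d] leaf_pos[of d]
          by (simp add: t'_def)
      next
        case 3
        then show ?thesis using mem[OF i] heap_side_off_path[OF leaf_pos[of d] 3(1) _ b1] leaf_Suc[of d]
          by (simp add: t'_def)
      next
        case 4
        then have "leaf d < i" using leaf_Suc[of d] leaf_pos[of d] by simp
        then show ?thesis using mem[OF i] 4 by (simp add: t'_def)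
      qed
    qed
    moreover have "mem t' a = mem s a" if "a < p \<or> p + 2 ^ L \<le> a" for a
      using out[OF that] that lt by (auto simp: t'_def)
    ultimately have "Inv (L - Suc d) t'"
      unfolding Inv_def using sv io d(5) dL by (intro conjI exI[of _ "Suc d"]) (simp_all add: t'_def)
    moreover have "L - Suc d < m" using d(2) dL by simp
    ultimately have "\<exists>m'<m. Inv m' t'" by blast
    then show "wp ora body (\<lambda>t. \<exists>m'<m. Inv m' t) (tick t)"
      unfolding body_def t'_def by (cases "\<omega> !! d") (simp_all add: d(3,4) v leaf_Suc)
  next
    fix m and t :: config assume I: "Inv m t" and cond: "\<not> bval (Less (V ''v'') (V ''Q'')) t"
    then obtain d where d: "d \<le> L" "m = L - d" "vars t ''v'' = leaf d" "coins t = sdrop d \<omega>"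
        "steps t \<le> steps s + 1 + 5 * d"
      and mem: "\<And>i. 1 \<le> i \<Longrightarrow> i < 2 ^ L \<Longrightarrow> mem t (p + i) = (if i < leaf d then heap_side i (leaf d) else 0)"
      and sv: "same_vars [''v'', ''b''] (vars s) (vars t)"
      and out: "\<And>a. a < p \<or> p + 2 ^ L \<le> a \<Longrightarrow> mem t a = mem s a"
      and io: "query_tape t = query_tape s"
        "output_tape t = output_tape s" "outputs t = outputs s" "queries t = queries s"
      unfolding Inv_def by blast
    have v: "vars t ''Q'' = 2 ^ L" "vars t ''p'' = p" using sv Q p by (simp_all add: same_vars_def)
    then have "2 ^ L \<le> leaf d" using cond d(3) by simp
    then have "(2 :: nat) ^ L < 2 ^ Suc d" using leaf_bd(2)[of d] by simp
    then have "L < Suc d" by (rule power_less_imp_less_exp[rotated]) simp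
    then have dL: "d = L" using d(1) by simp
    have m': "mem t (p + i) = heap_side i (leaf L)" if "1 \<le> i" "i < 2 ^ L" for i
      using mem[OF that] that leaf_bd(1)[of L] by (simp add: dL)
    \<comment> \<open>The final store goes to \<open>p\<close>, which the frame condition excludes,
      so \<open>a = p\<close> is contradictory.\<close>
    have out': "a = p \<longrightarrow> x = mem s p" if "a < p \<or> p + 2 ^ L \<le> a" for a x
      using that by (metis add_le_same_cancel1 less_irrefl not_less power_eq_0_iff le_zero_eq zero_neq_numeral)
    show "wp ora (Store (V ''p'') (V ''v'')) (wp ora Skip P) (tick t)"
      unfolding wp_simps
      by (rule post; use sv d(5) io in
        \<open>simp add: d(3,4) v dL leaf_def \<omega>_def m'[unfolded leaf_def \<omega>_def] out out'\<close>)
  qed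
  then show ?thesis by (simp add: walk_def body_def)
qed


lemma wp_peel:
  assumes v: "vars s ''Q'' = Q" "vars s ''Z'' = Z" "vars s ''p'' = u * Z" "vars s ''u'' = u" "vars s ''v'' = h u"
    and Z: "Z = Q + n" and u: "u < n"
    and leaf: "\<And>w. w < u \<Longrightarrow> mem s (w * Z) = h w"
    and zero: "\<And>j. j < n \<Longrightarrow> mem s (u * Z + Q + j) = 0"
    and post: "\<And>t. same_vars [''w'', ''q''] (vars s) (vars t) \<Longrightarrow> coins t = coins s \<Longrightarrow>
      (\<And>j. j < n \<Longrightarrow> mem t (u * Z + Q + j) = leaf_side Q h (Q + j) u) \<Longrightarrow>
      (\<And>a. a < u * Z + Q \<or> u * Z + Z \<le> a \<Longrightarrow> mem t a = mem s a) \<Longrightarrow>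
      query_tape t = query_tape s \<Longrightarrow> output_tape t = output_tape s \<Longrightarrow> outputs t = outputs s \<Longrightarrow>
      queries t = queries s \<Longrightarrow> steps t \<le> steps s + 6 * n + 5 \<Longrightarrow> P t"
  shows "wp ora peel P s"
proof -
  define p where "p = u * Z + Q"
  define Inv where "Inv t \<longleftrightarrow> same_vars [''w'', ''q''] (vars s) (vars t) \<and> coins t = coins s \<and>
      vars t ''w'' \<le> u \<and> vars t ''q'' = vars t ''w'' * Z \<and>
      (\<forall>j<n. mem t (p + j) = (if j < vars t ''w'' \<and> h u = h j then 2 else 0)) \<and>
      (\<forall>a. a < p \<or> p + n \<le> a \<longrightarrow> mem t a = mem s a) \<and> query_tape t = query_tape s \<and>
      output_tape t = output_tape s \<and> outputs t = outputs s \<and> queries t = queries s \<and>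
      steps t \<le> steps s + 2 + 6 * vars t ''w''" for t :: config
  define body where "body = block
       [Cond (Eq (Mem (V ''q'')) (V ''v''))
          (Store (Plus (Plus (V ''p'') (V ''Q'')) (V ''w'')) (N 2)) Skip,
        incr ''w'' (N 1), incr ''q'' (V ''Z'')]"
  have "wp ora (While (Less (V ''w'') (V ''u'')) body)
      (wp ora (Store (Plus (Plus (V ''p'') (V ''Q'')) (V ''u'')) (N 1)) (wp ora Skip P))
      (s\<lparr>vars := (vars s)(''w'' := 0, ''q'' := 0), steps := Suc (Suc (steps s))\<rparr>)"
  proof (rule wp_While[where Inv = Inv and m = "\<lambda>t. u - vars t ''w''"])
    show "Inv (s\<lparr>vars := (vars s)(''w'' := 0, ''q'' := 0), steps := Suc (Suc (steps s))\<rparr>)"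
      by (simp add: Inv_def p_def zero)
  next
    fix t :: config assume I: "Inv t" and cond: "bval (Less (V ''w'') (V ''u'')) t"
    define w where "w = vars t ''w''"
    have sv: "same_vars [''w'', ''q''] (vars s) (vars t)" and q: "vars t ''q'' = w * Z"
      and mem: "\<And>j. j < n \<Longrightarrow> mem t (p + j) = (if j < w \<and> h u = h j then 2 else 0)"
      and out: "\<And>a. a < p \<or> p + n \<le> a \<Longrightarrow> mem t a = mem s a"
      and io: "coins t = coins s" "query_tape t = query_tape s"
        "output_tape t = output_tape s" "outputs t = outputs s" "queries t = queries s"
      and st: "steps t \<le> steps s + 2 + 6 * w"
      using I unfolding Inv_def w_def by blast+
    have v': "vars t ''Q'' = Q" "vars t ''Z'' = Z" "vars t ''p'' = u * Z" "vars t ''u'' = u" "vars t ''v'' = h u"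
      using sv v by (simp_all add: same_vars_def)
    have wu: "w < u" using cond v' by (simp add: w_def)
    have "w * Z < p"
    proof -
      have "w * Z < u * Z" using wu u Z by simp
      then show ?thesis unfolding p_def by (rule trans_less_add1)
    qed
    then have mw: "mem t (w * Z) = h w" using out[of "w * Z"] leaf[OF wu] by simp
    define m where "m = (if h w = h u then (mem t)(p + w := 2) else mem t)"
    define t' where "t' = t\<lparr>mem := m, vars := (vars t)(''w'' := Suc w, ''q'' := w * Z + Z), steps := steps t + 6\<rparr>"
    have "m (p + j) = (if j < Suc w \<and> h u = h j then 2 else 0)" if "j < n" for j
      using mem[OF that] by (auto simp: m_def less_Suc_eq)
    moreover have "m a = mem s a" if "a < p \<or> p + n \<le> a" for a
      using out[OF that] that wu u by (auto simp: m_def)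
    ultimately have "Inv t'"
      unfolding Inv_def using sv io st wu by (simp add: t'_def)
    moreover have "u - vars t' ''w'' < u - vars t ''w''" using wu by (simp add: t'_def w_def[symmetric] diff_less_mono2)
    ultimately show "wp ora body (\<lambda>t'. Inv t' \<and> u - vars t' ''w'' < u - vars t ''w'') (tick t)"
      unfolding body_def t'_def m_def
      by (cases "h w = h u") (simp_all add: v' q mw w_def[symmetric] p_def eval_nat_numeral)
  next
    fix t :: config assume I: "Inv t" and cond: "\<not> bval (Less (V ''w'') (V ''u'')) t"
    have sv: "same_vars [''w'', ''q''] (vars s) (vars t)"
      and mem: "\<And>j. j < n \<Longrightarrow> mem t (p + j) = (if j < vars t ''w'' \<and> h u = h j then 2 else 0)"
      and out: "\<And>a. a < p \<or> p + n \<le> a \<Longrightarrow> mem t a = mem s a"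
      and io: "coins t = coins s" "query_tape t = query_tape s"
        "output_tape t = output_tape s" "outputs t = outputs s" "queries t = queries s"
      and st: "steps t \<le> steps s + 2 + 6 * vars t ''w''" and le: "vars t ''w'' \<le> u"
      using I unfolding Inv_def by blast+
    have v': "vars t ''Q'' = Q" "vars t ''Z'' = Z" "vars t ''p'' = u * Z" "vars t ''u'' = u" "vars t ''v'' = h u"
      using sv v by (simp_all add: same_vars_def)
    have w: "vars t ''w'' = u" using cond v' le by simp
    define m where "m = (mem t)(p + u := 1)"
    have m: "m (u * Z + Q + j) = leaf_side Q h (Q + j) u" if "j < n" for j
      using mem[OF that] unfolding m_def p_def[symmetric] by (auto simp: leaf_side_def w)
    have out': "m a = mem s a" if "a < u * Z + Q \<or> u * Z + Z \<le> a" for a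
      using out[of a] that u by (auto simp: m_def p_def Z)
    have st': "steps t + 3 \<le> steps s + 6 * n + 5" using st w u by simp
    have "P (t\<lparr>mem := m, steps := steps t + 3\<rparr>)"
      by (rule post) (use st' in \<open>simp_all add: sv io m out'\<close>)
    then show "wp ora (Store (Plus (Plus (V ''p'') (V ''Q'')) (V ''u'')) (N 1)) (wp ora Skip P) (tick t)"
      by (simp add: v' m_def p_def eval_nat_numeral)
  qed
  then show ?thesis by (simp add: peel_def body_def)
qed

text \<open>Element \<open>u\<close> owns the block of \<open>L\<close> coins that starts at
  position \<open>u * L\<close>; disjoint blocks are the source of independence.\<close>

definition leaf_map :: "nat \<Rightarrow> bool stream \<Rightarrow> nat \<Rightarrow> nat" where
  "leaf_map L \<omega> u = leaf_of (stake L (sdrop (u * L) \<omega>))"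

lemma wp_fill_table:
  assumes v: "vars s ''n'' = n" "vars s ''Q'' = 2 ^ L" "vars s ''Z'' = Z" and Z: "Z = 2 ^ L + n"
    and zero: "mem s = (\<lambda>_. 0)"
    and post: "\<And>t. same_vars [''u'', ''p'', ''v'', ''b'', ''w'', ''q''] (vars s) (vars t) \<Longrightarrow>
      vars t ''p'' = n * Z \<Longrightarrow>
      (\<And>u i. u < n \<Longrightarrow> 1 \<le> i \<Longrightarrow> i < Z \<Longrightarrow> mem t (u * Z + i) = leaf_side (2 ^ L) (leaf_map L (coins s)) i u) \<Longrightarrow>
      query_tape t = query_tape s \<Longrightarrow> output_tape t = output_tape s \<Longrightarrow> outputs t = outputs s \<Longrightarrow>
      queries t = queries s \<Longrightarrow> steps t \<le> steps s + 5 + n * (5 * L + 6 * n + 20) \<Longrightarrow> P t"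
  shows "wp ora fill_table P s"
proof -
  let ?xs = "[''u'', ''p'', ''v'', ''b'', ''w'', ''q'']"
  define Q :: nat where "Q = 2 ^ L"
  define h where "h = leaf_map L (coins s)"
  define K where "K = 5 * L + 6 * n + 20"
  have ZQ: "Z = Q + n" by (simp add: Z Q_def)
  define Inv where "Inv t \<longleftrightarrow> same_vars ?xs (vars s) (vars t) \<and> coins t = sdrop (vars t ''u'' * L) (coins s) \<and>
      vars t ''u'' \<le> n \<and> vars t ''p'' = vars t ''u'' * Z \<and>
      (\<forall>u<vars t ''u''. mem t (u * Z) = h u \<and> (\<forall>i. 1 \<le> i \<longrightarrow> i < Z \<longrightarrow> mem t (u * Z + i) = leaf_side Q h i u)) \<and>
      (\<forall>a\<ge>vars t ''u'' * Z. mem t a = 0) \<and> query_tape t = query_tape s \<and>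
      output_tape t = output_tape s \<and> outputs t = outputs s \<and> queries t = queries s \<and>
      steps t \<le> steps s + 2 + vars t ''u'' * K" for t :: config
  define body where "body = block [walk, peel, incr ''u'' (N 1), incr ''p'' (V ''Z'')]"
  have "wp ora (While (Less (V ''u'') (V ''n'')) body) (wp ora Skip P)
      (s\<lparr>vars := (vars s)(''u'' := 0, ''p'' := 0), steps := Suc (Suc (steps s))\<rparr>)"
  proof (rule wp_While[where Inv = Inv and m = "\<lambda>t. n - vars t ''u''"])
    show "Inv (s\<lparr>vars := (vars s)(''u'' := 0, ''p'' := 0), steps := Suc (Suc (steps s))\<rparr>)"
      by (simp add: Inv_def zero)
  next
    fix t :: config assume I: "Inv t" and cond: "bval (Less (V ''u'') (V ''n'')) t"
    define u where "u = vars t ''u''"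
    have sv: "same_vars ?xs (vars s) (vars t)" and p: "vars t ''p'' = u * Z"
      and co: "coins t = sdrop (u * L) (coins s)"
      and old_rows: "\<And>w. w < u \<Longrightarrow> mem t (w * Z) = h w"
        "\<And>w i. w < u \<Longrightarrow> 1 \<le> i \<Longrightarrow> i < Z \<Longrightarrow> mem t (w * Z + i) = leaf_side Q h i w"
      and z: "\<And>a. u * Z \<le> a \<Longrightarrow> mem t a = 0"
      and io: "query_tape t = query_tape s"
        "output_tape t = output_tape s" "outputs t = outputs s" "queries t = queries s"
      and st: "steps t \<le> steps s + 2 + u * K"
      using I unfolding Inv_def u_def by blast+
    have v': "vars t ''n'' = n" "vars t ''Q'' = 2 ^ L" "vars t ''Z'' = Z"
      using sv v by (simp_all add: same_vars_def)
    have un: "u < n" using cond v' by (simp add: u_def)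
    have hu: "leaf_of (stake L (coins (tick t))) = h u" by (simp add: co h_def leaf_map_def)
    have "wp ora walk (wp ora peel (wp ora (incr ''u'' (N 1)) (wp ora (incr ''p'' (V ''Z'')) (wp ora Skip
        (\<lambda>t'. Inv t' \<and> n - vars t' ''u'' < n - vars t ''u''))))) (tick t)"
    proof (rule wp_walk[where L = L and p = "u * Z"])
      fix t1 :: config
      assume sv1: "same_vars [''v'', ''b''] (vars (tick t)) (vars t1)"
        and v1: "vars t1 ''v'' = leaf_of (stake L (coins (tick t)))"
        and co1: "coins t1 = sdrop L (coins (tick t))"
        and m1: "mem t1 (u * Z) = leaf_of (stake L (coins (tick t)))"
          "\<And>i. 1 \<le> i \<Longrightarrow> i < 2 ^ L \<Longrightarrow> mem t1 (u * Z + i) = heap_side i (leaf_of (stake L (coins (tick t))))"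
          "\<And>a. a < u * Z \<or> u * Z + 2 ^ L \<le> a \<Longrightarrow> mem t1 a = mem (tick t) a"
        and io1: "query_tape t1 = query_tape (tick t)" "output_tape t1 = output_tape (tick t)"
          "outputs t1 = outputs (tick t)" "queries t1 = queries (tick t)"
        and st1: "steps t1 \<le> steps (tick t) + 5 * L + 5"
      have v1': "vars t1 ''n'' = n" "vars t1 ''Q'' = Q" "vars t1 ''Z'' = Z" "vars t1 ''p'' = u * Z" "vars t1 ''u'' = u"
        using sv1 v' p by (simp_all add: same_vars_def Q_def u_def)
      have below: "w * Z + i < u * Z" if "w < u" "i < Z" for w i
      proof -
        have "w * Z + i < Suc w * Z" using that by simp
        also have "\<dots> \<le> u * Z" using that by (intro mult_le_mono1) simp
        finally show ?thesis .
      qed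
      have Zpos: "0 < Z" by (simp add: Z)
      have same_rows: "mem t1 (w * Z + i) = mem t (w * Z + i)" if "w < u" "i < Z" for w i
        using m1(3)[of "w * Z + i"] below[OF that] by simp
      show "wp ora peel (wp ora (incr ''u'' (N 1)) (wp ora (incr ''p'' (V ''Z'')) (wp ora Skip
        (\<lambda>t'. Inv t' \<and> n - vars t' ''u'' < n - vars t ''u'')))) t1"
      proof (rule wp_peel[where Q = Q and Z = Z and n = n and u = u and h = h])
        show "mem t1 (w * Z) = h w" if "w < u" for w
          using same_rows[OF that Zpos] old_rows(1)[OF that] by simp
        show "mem t1 (u * Z + Q + j) = 0" if "j < n" for j
          using m1(3)[of "u * Z + Q + j"] z[of "u * Z + Q + j"] by (simp add: Q_def)
        fix t2 :: config
        assume sv2: "same_vars [''w'', ''q''] (vars t1) (vars t2)" and co2: "coins t2 = coins t1"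
          and m2: "\<And>j. j < n \<Longrightarrow> mem t2 (u * Z + Q + j) = leaf_side Q h (Q + j) u"
            "\<And>a. a < u * Z + Q \<or> u * Z + Z \<le> a \<Longrightarrow> mem t2 a = mem t1 a"
          and io2: "query_tape t2 = query_tape t1" "output_tape t2 = output_tape t1"
            "outputs t2 = outputs t1" "queries t2 = queries t1"
          and st2: "steps t2 \<le> steps t1 + 6 * n + 5"
        have v2: "vars t2 ''u'' = u" "vars t2 ''p'' = u * Z" "vars t2 ''Z'' = Z"
          using sv2 v1' by (simp_all add: same_vars_def)
        have sv2': "same_vars ?xs (vars s) (vars t2)"
          using sv sv1 sv2 by (simp add: same_vars_def)
        have co2': "coins t2 = sdrop (Suc u * L) (coins s)"
          unfolding co2 co1 by (simp add: co sdrop_add add.commute)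
        have old: "mem t2 (w * Z + i) = mem t (w * Z + i)" if "w < u" "i < Z" for w i
          using m2(2)[of "w * Z + i"] below[OF that] same_rows[OF that] by simp
        have Qpos: "0 < Q" by (simp add: Q_def)
        have rows: "mem t2 (w * Z) = h w \<and> (\<forall>i. 1 \<le> i \<longrightarrow> i < Z \<longrightarrow> mem t2 (w * Z + i) = leaf_side Q h i w)"
          if "w < Suc u" for w
        proof (cases "w = u")
          case False
          then have "w < u" using that by simp
          then show ?thesis using old[OF _ Zpos, of w] old[of w] old_rows by simp
        next
          case True
          have "mem t2 (u * Z + i) = leaf_side Q h i u" if i: "1 \<le> i" "i < Z" for i
          proof (cases "i < Q")
            case True
            then show ?thesis
              using m2(2)[of "u * Z + i"] m1(2)[OF i(1)] hu by (simp add: Q_def leaf_side_def)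
          next
            case False
            then obtain j where "i = Q + j" by (metis le_Suc_ex not_less)
            then show ?thesis using m2(1)[of j] i ZQ by (simp add: add.assoc)
          qed
          moreover have "mem t2 (u * Z) = h u" using m2(2)[of "u * Z"] m1(1) hu Qpos by simp
          ultimately show ?thesis using True by simp
        qed
        have zeros: "mem t2 a = 0" if "Suc u * Z \<le> a" for a
          using m2(2)[of a] m1(3)[of a] z[of a] that by (simp add: Z)
        have io2': "query_tape t2 = query_tape s" "output_tape t2 = output_tape s"
            "outputs t2 = outputs s" "queries t2 = queries s"
          using io2 io1 io by simp_all
        have st2': "steps t2 + 3 \<le> steps s + 2 + Suc u * K"
          using st st1 st2 by (simp add: K_def)
        have "Inv (t2\<lparr>vars := (vars t2)(''u'' := Suc u, ''p'' := u * Z + Z), steps := steps t2 + 3\<rparr>)"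
          unfolding Inv_def using sv2' co2' rows zeros io2' st2' un by (simp add: add.commute)
        then show "wp ora (incr ''u'' (N 1)) (wp ora (incr ''p'' (V ''Z'')) (wp ora Skip
            (\<lambda>t'. Inv t' \<and> n - vars t' ''u'' < n - vars t ''u''))) t2"
          using un by (simp add: v2 u_def[symmetric] eval_nat_numeral diff_less_mono2)
      qed (use hu in \<open>simp_all add: v1' v1 un ZQ\<close>)
    qed (use z in \<open>simp_all add: v' p\<close>)
    then show "wp ora body (\<lambda>t'. Inv t' \<and> n - vars t' ''u'' < n - vars t ''u'') (tick t)"
      by (simp add: body_def)
  next
    fix t :: config assume I: "Inv t" and cond: "\<not> bval (Less (V ''u'') (V ''n'')) t"
    have sv: "same_vars ?xs (vars s) (vars t)" using I by (simp add: Inv_def)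
    then have "vars t ''n'' = n" using v by (simp add: same_vars_def)
    then have u: "vars t ''u'' = n" using I cond by (simp add: Inv_def)
    show "wp ora Skip P (tick t)"
      using I unfolding Inv_def u wp_simps
      by (intro post) (simp_all add: Q_def h_def K_def)
  qed
  then show ?thesis by (simp add: fill_table_def body_def)
qed

lemma (in search) wp_init_queue:
  assumes v: "vars s ''n'' = n" "vars s ''k'' = k" "vars s ''Z'' = Z" "vars s ''p'' = n * Z"
    and Z: "1 \<le> Z" and tab: "table Z (mem s)" and io: "query_tape s = []" "output_tape s = []"
    and post: "\<And>t. ready Z [(1, 1, {..<n})] t \<Longrightarrow> outputs t = outputs s \<Longrightarrow> queries t = queries s \<Longrightarrow>
      steps t \<le> steps s + 10 + 3 * n \<Longrightarrow> P t"
  shows "wp ora init_queue P s"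
proof -
  define h where "h = n * Z"
  define Inv where "Inv t \<longleftrightarrow> vars t ''n'' = n \<and> vars t ''k'' = k \<and> vars t ''Z'' = Z \<and>
      vars t ''h'' = h \<and> vars t ''t'' = h + n + 2 \<and> vars t ''u'' \<le> n \<and>
      mem t h = 1 \<and> mem t (Suc h) = 1 \<and> (\<forall>u<vars t ''u''. mem t (h + 2 + u) = 1) \<and>
      (\<forall>a<h. mem t a = mem s a) \<and> query_tape t = [] \<and> output_tape t = [] \<and>
      outputs t = outputs s \<and> queries t = queries s \<and>
      steps t \<le> steps s + 5 + 3 * vars t ''u''" for t :: config
  have "wp ora (While (Less (V ''u'') (V ''n'')) (Seq (Store (mark ''h'') (N 1)) (incr ''u'' (N 1))))
      (wp ora Skip P) (s\<lparr>mem := (mem s)(h := 1, Suc h := 1),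
        vars := (vars s)(''h'' := h, ''t'' := h + n + 2, ''u'' := 0), steps := steps s + 5\<rparr>)"
  proof (rule wp_While[where Inv = Inv and m = "\<lambda>t. n - vars t ''u''"])
    show "Inv (s\<lparr>mem := (mem s)(h := 1, Suc h := 1),
        vars := (vars s)(''h'' := h, ''t'' := h + n + 2, ''u'' := 0), steps := steps s + 5\<rparr>)"
      using v io by (simp add: Inv_def)
  next
    fix t :: config assume "Inv t" and "bval (Less (V ''u'') (V ''n'')) t"
    then show "wp ora (Seq (Store (mark ''h'') (N 1)) (incr ''u'' (N 1)))
        (\<lambda>t'. Inv t' \<and> n - vars t' ''u'' < n - vars t ''u'') (tick t)"
      by (simp add: Inv_def mark_def All_less_Suc diff_less_mono2)
  next
    fix t :: config assume I: "Inv t" and cond: "\<not> bval (Less (V ''u'') (V ''n'')) t"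
    then have u: "vars t ''u'' = n" by (simp add: Inv_def)
    have "table Z (mem t)"
      using I by (intro table_less_cong[OF tab, of h]) (simp_all add: h_def Inv_def)
    moreover have "marks (mem t) h {..<n}" using I unfolding Inv_def u marks_def by simp
    ultimately have "ready Z [(1, 1, {..<n})] (t\<lparr>steps := x\<rparr>)" for x
      using I Z unfolding ready_def Inv_def h_def by simp
    then show "wp ora Skip P (tick t)"
      using I unfolding Inv_def u wp_simps by (intro post) simp_all
  qed
  then show ?thesis using v by (simp add: init_queue_def h_def eval_nat_numeral)
qed

section \<open>The distribution of the leaf assignment\<close>

text \<open>Integrating out the first coin averages over its two values; after \<open>m\<close>
  coins this is the plain average over all bit lists.\<close>

lemma nn_integral_coin_tape_stake:
  fixes F :: "bool list \<Rightarrow> ennreal"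
  shows "(\<integral>\<^sup>+\<omega>. F (stake m \<omega>) \<partial>coin_tape) = (\<Sum>xs\<in>{xs. length xs = m}. F xs) * ennreal ((1 / 2) ^ m)"
proof (induction m arbitrary: F)
  case 0
  interpret prob_space coin_tape
    unfolding coin_tape_def by (intro prob_space.prob_space_stream_space prob_space_measure_pmf)
  show ?case by (simp add: emeasure_space_1)
next
  case (Suc m)
  let ?M = "measure_pmf (bernoulli_pmf (1 / 2))"
  have meas: "(\<lambda>\<omega>. F (stake j \<omega>)) \<in> borel_measurable (stream_space ?M)" for F :: "bool list \<Rightarrow> ennreal" and j
  proof -
    have "stake j \<in> measurable (stream_space ?M) (count_space UNIV)"
      using measurable_stake[of j]
      by (subst measurable_cong_sets[OF sets_stream_space_cong refl, of _ "count_space UNIV"]) auto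
    then show ?thesis by (rule measurable_compose) simp
  qed
  have "(\<integral>\<^sup>+\<omega>. F (stake (Suc m) \<omega>) \<partial>coin_tape)
      = (\<integral>\<^sup>+b. (\<integral>\<^sup>+\<omega>. F (b # stake m \<omega>) \<partial>coin_tape) \<partial>?M)"
    unfolding coin_tape_def
    by (subst prob_space.nn_integral_stream_space[OF prob_space_measure_pmf meas]) simp
  also have "\<dots> = (\<integral>\<^sup>+b. (\<Sum>xs\<in>{xs. length xs = m}. F (b # xs)) * ennreal ((1 / 2) ^ m) \<partial>?M)"
    by (intro nn_integral_cong Suc.IH)
  also have "\<dots> = ((\<Sum>xs\<in>{xs. length xs = m}. F (True # xs)) + (\<Sum>xs\<in>{xs. length xs = m}. F (False # xs)))
      * (ennreal ((1 / 2) ^ m) * ennreal (1 / 2))"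
    by (simp add: distrib_right mult.assoc)
  also have "(\<Sum>xs\<in>{xs. length xs = m}. F (True # xs)) + (\<Sum>xs\<in>{xs. length xs = m}. F (False # xs))
      = (\<Sum>xs\<in>{xs. length xs = Suc m}. F xs)"
  proof -
    have fin: "finite {xs :: bool list. length xs = m}"
      using finite_lists_length_eq[of "UNIV :: bool set" m] by simp
    have eq: "{xs :: bool list. length xs = Suc m} = (#) True ` {xs. length xs = m} \<union> (#) False ` {xs. length xs = m}"
      by (auto simp: length_Suc_conv)
    show ?thesis unfolding eq
      using fin by (subst sum.union_disjoint) (auto simp: sum.reindex)
  qed
  also have "ennreal ((1 / 2) ^ m) * ennreal (1 / 2) = ennreal ((1 / 2) ^ Suc m)"
    by (subst ennreal_mult[symmetric]) (simp_all add: mult.commute)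
  finally show ?case .
qed

lemma leaf_of_inject:
  "length bs = length cs \<Longrightarrow> leaf_of bs = leaf_of cs \<Longrightarrow> bs = cs"
proof (induction bs arbitrary: cs rule: rev_induct)
  case (snoc b bs)
  obtain c cs' where cs: "cs = cs' @ [c]" using snoc.prems(1) by (cases cs rule: rev_cases) auto
  have "leaf_of bs + leaf_of bs + of_bool b = leaf_of cs' + leaf_of cs' + of_bool c"
    using snoc.prems(2) by (simp only: cs leaf_of_snoc)
  then have "b = c" "leaf_of bs = leaf_of cs'" by (cases b; cases c; simp; presburger)+
  then show ?case using snoc.IH[of cs'] snoc.prems(1) cs by simp
qed simp

text \<open>The finite counterpart of \<open>leaf_map\<close>, with blocks cut from a bit list;
  \<open>restrict\<close> makes it a member of \<open>leaf_maps\<close>.\<close>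

definition list_leaf_map :: "nat \<Rightarrow> nat \<Rightarrow> bool list \<Rightarrow> nat \<Rightarrow> nat" where
  "list_leaf_map n L xs = restrict (\<lambda>u. leaf_of (take L (drop (u * L) xs))) {..<n}"

lemma block_le: "u < n \<Longrightarrow> u * L + L \<le> n * (L :: nat)"
  by (metis Suc_leI add.commute mult_Suc mult_le_mono1)

lemma list_leaf_map_stake:
  "list_leaf_map n L (stake (n * L) \<omega>) = restrict (leaf_map L \<omega>) {..<n}"
proof (unfold list_leaf_map_def, rule restrict_ext)
  fix u assume "u \<in> {..<n}"
  then have "L \<le> n * L - u * L" using block_le[of u n L] by simp
  then show "leaf_of (take L (drop (u * L) (stake (n * L) \<omega>))) = leaf_map L \<omega> u"
    by (simp add: drop_stake take_stake leaf_map_def min_absorb1)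
qed

lemma list_leaf_map_in: "length xs = n * L \<Longrightarrow> list_leaf_map n L xs \<in> leaf_maps n (2 ^ L)"
  unfolding list_leaf_map_def leaf_maps_def
proof (rule restrict_PiE_iff[THEN iffD2], rule ballI)
  fix u assume "length xs = n * L" "u \<in> {..<n}"
  then have "length (take L (drop (u * L) xs)) = L" using block_le[of u n L] by simp
  then show "leaf_of (take L (drop (u * L) xs)) \<in> {2 ^ L..<2 * 2 ^ L}"
    using leaf_of_bounds[of "take L (drop (u * L) xs)"] by simp
qed

text \<open>Every block is recovered from its leaf by \<open>leaf_of_inject\<close>, and the blocks
  exhaust the list.\<close>

lemma inj_on_list_leaf_map: "inj_on (list_leaf_map n L) {xs. length xs = n * L}"
proof (rule inj_onI)
  fix xs ys assume len: "xs \<in> {xs. length xs = n * L}" "ys \<in> {xs. length xs = n * L}"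
    and eq: "list_leaf_map n L xs = list_leaf_map n L ys"
  have blocks: "take L (drop (u * L) xs) = take L (drop (u * L) ys)" if "u < n" for u
  proof (rule leaf_of_inject)
    show "length (take L (drop (u * L) xs)) = length (take L (drop (u * L) ys))" using len by simp
    show "leaf_of (take L (drop (u * L) xs)) = leaf_of (take L (drop (u * L) ys))"
      using fun_cong[OF eq, of u] that by (simp add: list_leaf_map_def)
  qed
  show "xs = ys"
  proof (rule nth_equalityI)
    show "length xs = length ys" using len by simp
    fix j assume "j < length xs"
    then have j: "j < n * L" using len by simp
    then have L: "0 < L" by (cases L) auto
    define u where "u = j div L"
    have un: "u < n" using j unfolding u_def by (simp add: less_mult_imp_div_less)
    define r where "r = j mod L"
    have jm: "j = u * L + r" "r < L" using L by (simp_all add: u_def r_def)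
    have nth: "take L (drop (u * L) zs) ! r = zs ! j" if "length zs = n * L" for zs
    proof -
      have "u * L \<le> length zs" using that block_le[OF un, of L] by linarith
      then show ?thesis using jm(2) unfolding jm(1) by simp
    qed
    have "xs ! j = take L (drop (u * L) xs) ! r" using nth[of xs] len by simp
    also have "\<dots> = take L (drop (u * L) ys) ! r" using blocks[OF un] by simp
    also have "\<dots> = ys ! j" using nth[of ys] len by simp
    finally show "xs ! j = ys ! j" .
  qed
qed

text \<open>Distinct bit lists give distinct leaf maps, each of the same weight, so injectivity
  bounds the integral by the average over all leaf maps.\<close>

lemma nn_integral_leaf_map_le:
  fixes G :: "(nat \<Rightarrow> nat) \<Rightarrow> ennreal"
  shows "(\<integral>\<^sup>+\<omega>. G (restrict (leaf_map L \<omega>) {..<n}) \<partial>coin_tape)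
    \<le> (\<Sum>h\<in>leaf_maps n (2 ^ L). G h) * ennreal (1 / (2 ^ L) ^ n)"
proof -
  have "(\<integral>\<^sup>+\<omega>. G (restrict (leaf_map L \<omega>) {..<n}) \<partial>coin_tape)
      = (\<integral>\<^sup>+\<omega>. G (list_leaf_map n L (stake (n * L) \<omega>)) \<partial>coin_tape)"
    by (simp only: list_leaf_map_stake)
  also have "\<dots> = (\<Sum>xs\<in>{xs. length xs = n * L}. G (list_leaf_map n L xs)) * ennreal ((1 / 2) ^ (n * L))"
    by (rule nn_integral_coin_tape_stake)
  also have "(\<Sum>xs\<in>{xs. length xs = n * L}. G (list_leaf_map n L xs))
      = (\<Sum>h\<in>list_leaf_map n L ` {xs. length xs = n * L}. G h)"
    by (rule sum.reindex[OF inj_on_list_leaf_map, symmetric, unfolded o_def])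
  also have "\<dots> * ennreal ((1 / 2) ^ (n * L)) \<le> (\<Sum>h\<in>leaf_maps n (2 ^ L). G h) * ennreal ((1 / 2) ^ (n * L))"
    by (intro mult_right_mono sum_mono2) (auto simp: list_leaf_map_in)
  also have "(1 / 2 :: real) ^ (n * L) = 1 / (2 ^ L) ^ n"
    by (simp add: power_mult[symmetric] power_divide mult.commute)
  finally show ?thesis .
qed

section \<open>The complete program\<close>

text \<open>This passes from the total function \<open>leaf_map\<close> to the extensional functions
  over which the averages run.\<close>

lemma call_bound_restrict:
  assumes "\<And>W. W \<in> \<W> \<Longrightarrow> W \<subseteq> {..<n}"
  shows "call_bound n k Q \<W> (restrict h {..<n}) = call_bound n k Q \<W> h"
proof -
  have im: "restrict h {..<n} ` R = h ` R" if "R \<subseteq> {..<n}" for R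
    using that by (intro image_cong) auto
  have "leaf_covers n k (restrict h {..<n}) W = leaf_covers n k h W" if "W \<in> \<W>" for W
    unfolding leaf_covers_def by (intro Collect_cong) (metis im assms that)
  moreover have "heap_covers k i (restrict h {..<n}) W = heap_covers k i h W" if "W \<in> \<W>" for W i
  proof -
    have "restrict h {..<n} w = h w" if "w \<in> W" for w using assms[OF \<open>W \<in> \<W>\<close>] that by auto
    then show ?thesis unfolding heap_covers_def by simp
  qed
  ultimately show ?thesis unfolding call_bound_def by simp
qed

text \<open>The 1 in \<open>B\<close> is the initial query. With \<open>m = max 1 n\<close> there
  are at most \<open>3 * m * B\<close> rounds of at most \<open>121 * m\<close> steps, and
  everything else takes at most \<open>100 * m\<^sup>2\<close> steps; 600 leaves room above
  \<open>363 + 100\<close>.\<close>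

lemma wp_enumerate_witnesses:
  fixes n k :: nat and \<omega> :: "bool stream" and ora :: "nat set \<Rightarrow> bool" and \<W> :: "nat set set"
  defines "Q \<equiv> 2 ^ depth n" and "h \<equiv> leaf_map (depth n) \<omega>"
  defines "B \<equiv> 1 + call_bound n k Q \<W> h"
  assumes witness: "\<And>W. W \<in> \<W> \<Longrightarrow> W \<subseteq> {..<n} \<and> card W = k"
    and ora: "\<And>X. X \<subseteq> {..<n} \<Longrightarrow> ora X \<longleftrightarrow> (\<exists>W\<in>\<W>. W \<subseteq> X)"
  shows "wp ora enumerate_witnesses (\<lambda>t. (\<exists>Ys. outputs t = map (listing n) Ys \<and>
      distinct Ys \<and> set Ys = \<W>) \<and> length (queries t) \<le> B \<and> steps t \<le> 600 * (max 1 n)\<^sup>2 * B) (start n k \<omega>)"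
    (is "wp ora _ ?P _")
proof -
  define m where "m = max 1 n"
  have max_m: "max (Suc 0) n = m" by (simp add: m_def)
  have m01: "1 \<le> m" "n \<le> m" by (simp_all add: m_def)
  moreover have "m \<le> m\<^sup>2" using m01 by (simp add: power2_eq_square)
  ultimately have m: "1 \<le> m" "n \<le> m" "m \<le> m\<^sup>2" "n \<le> m\<^sup>2" by linarith+
  have m2: "1 \<le> m\<^sup>2" using m by simp
  have L2: "depth n \<le> 2 * m"
    using depth_le_double[of n] less_exp[of "depth n"] unfolding m_def by linarith
  have Q2: "Q \<le> 2 * m" using depth_le_double[of n] by (simp add: Q_def m_def)
  have B1: "1 \<le> B" by (simp add: B_def)
  have small: "c \<le> 600 * m\<^sup>2 * B" if "c \<le> 600 * m\<^sup>2" for c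
    using that B1 by (metis mult.right_neutral mult_le_mono2 order_trans)
  have ora_U: "ora {..<n} \<longleftrightarrow> \<W> \<noteq> {}" using ora[of "{..<n}"] witness by auto
  show ?thesis
    unfolding enumerate_witnesses_def block.simps wp_Seq
  proof (rule wp_query_all)
    fix t1 :: config
    let ?s = "start n k \<omega>"
    assume sv: "same_vars [''u'', ''r''] (vars ?s) (vars t1)"
      and r': "vars t1 ''r'' = of_bool (ora {..<vars ?s ''n''})"
      and "mem t1 = mem ?s" "coins t1 = coins ?s" "query_tape t1 = []"
        "output_tape t1 = output_tape ?s" "outputs t1 = outputs ?s"
        "queries t1 = queries ?s @ [{..<vars ?s ''n''}]" "steps t1 \<le> steps ?s + 3 * vars ?s ''n'' + 5"
    then have t1: "mem t1 = (\<lambda>_. 0)" "coins t1 = \<omega>" "query_tape t1 = []"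
        "output_tape t1 = []" "outputs t1 = []" "length (queries t1) = 1" and st1: "steps t1 \<le> 3 * n + 5"
      and r: "vars t1 ''r'' = of_bool (ora {..<n})"
      by (simp_all add: start_def)
    have v1: "vars t1 ''n'' = n" "vars t1 ''k'' = k"
      using sv by (simp_all add: same_vars_def start_def)
    have st1': "steps t1 \<le> 8 * m\<^sup>2" using st1 m m2 by linarith
    show "wp ora (Cond (Less (N 0) (V ''r''))
          (Cond (Less (N 0) (V ''k'')) (Seq size_up (Seq fill_table (Seq init_queue (Seq search_all Skip)))) Emit) Skip)
        (wp ora Skip ?P) t1"
    proof (cases "ora {..<n}")
      case False
      then have "\<W> = {}" using ora_U by simp
      moreover have "steps t1 + 3 \<le> 600 * m\<^sup>2 * B" using st1' m2 by (intro small) linarith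
      ultimately show ?thesis
        using False t1 B1 by (simp add: r max_m)
    next
      case True
      then have ne: "\<W> \<noteq> {}" using ora_U by simp
      show ?thesis
      proof (cases "0 < k")
        case False
        have "W = {}" if "W \<in> \<W>" for W
          using witness[OF that] False finite_subset[of W "{..<n}"] by auto
        then have "\<W> = {{}}" using ne by auto
        moreover have "steps t1 + 4 \<le> 600 * m\<^sup>2 * B" using st1' m2 by (intro small) linarith
        ultimately show ?thesis
          using False True t1 B1
          by (simp add: r v1 max_m) (intro exI[of _ "[{}]"], simp)
      next
        case kpos: True
        interpret leaf_tree n k Q h ora \<W>
        proof
          show "Q \<le> h u \<and> h u < 2 * Q" for u
            using leaf_of_bounds[of "stake (depth n) (sdrop (u * depth n) \<omega>)"]
            by (simp add: h_def leaf_map_def Q_def)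
        qed (use kpos witness ora in \<open>auto simp: Q_def\<close>)
        define Z where "Z = Q + n"
        have Z1: "1 \<le> Z" using Q by (simp add: Z_def)
        obtain W where W: "W \<in> \<W>" using ne by auto
        have nc: "1 + ncalls (Z - 1) 1 1 {..<n} \<le> B"
          using ncalls_root_le[OF ne] by (simp add: B_def Z_def)
        have "wp ora size_up (wp ora fill_table (wp ora init_queue (wp ora search_all (wp ora Skip (wp ora Skip ?P)))))
            (t1\<lparr>steps := Suc (Suc (steps t1))\<rparr>)"
        proof (rule wp_size_up)
          fix t2 :: config
          let ?t1 = "t1\<lparr>steps := Suc (Suc (steps t1))\<rparr>"
          assume sv2: "same_vars [''Q'', ''Z''] (vars ?t1) (vars t2)"
            and vQ: "vars t2 ''Q'' = 2 ^ depth (vars ?t1 ''n'')"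
              "vars t2 ''Z'' = 2 ^ depth (vars ?t1 ''n'') + vars ?t1 ''n''"
            and "mem t2 = mem ?t1" "coins t2 = coins ?t1" "query_tape t2 = query_tape ?t1"
              "output_tape t2 = output_tape ?t1" "outputs t2 = outputs ?t1" "queries t2 = queries ?t1"
              "steps t2 \<le> steps ?t1 + 2 * depth (vars ?t1 ''n'') + 5"
          then have t2: "mem t2 = (\<lambda>_. 0)" "coins t2 = \<omega>" "query_tape t2 = []"
              "output_tape t2 = []" "outputs t2 = []" "length (queries t2) = 1"
            and st2: "steps t2 \<le> steps t1 + 2 * depth n + 7"
            using t1 v1 by simp_all
          have v2: "vars t2 ''n'' = n" "vars t2 ''k'' = k" "vars t2 ''Q'' = 2 ^ depth n" "vars t2 ''Z'' = Z"
            using sv2 v1 vQ by (simp_all add: same_vars_def Z_def Q_def)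
          show "wp ora fill_table (wp ora init_queue (wp ora search_all (wp ora Skip (wp ora Skip ?P)))) t2"
          proof (rule wp_fill_table[where n = n and L = "depth n" and Z = Z])
            fix t3 :: config
            assume sv3: "same_vars [''u'', ''p'', ''v'', ''b'', ''w'', ''q''] (vars t2) (vars t3)"
              and p3: "vars t3 ''p'' = n * Z"
              and tab: "\<And>u i. u < n \<Longrightarrow> 1 \<le> i \<Longrightarrow> i < Z \<Longrightarrow>
                mem t3 (u * Z + i) = leaf_side (2 ^ depth n) (leaf_map (depth n) (coins t2)) i u"
              and t3': "query_tape t3 = query_tape t2" "output_tape t3 = output_tape t2"
                "outputs t3 = outputs t2" "queries t3 = queries t2"
              and st3: "steps t3 \<le> steps t2 + 5 + n * (5 * depth n + 6 * n + 20)"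
            have v3: "vars t3 ''n'' = n" "vars t3 ''k'' = k" "vars t3 ''Z'' = Z"
              using sv3 v2 by (simp_all add: same_vars_def)
            have tab': "table Z (mem t3)"
              using tab unfolding table_def by (simp add: t2 Q_def h_def)
            show "wp ora init_queue (wp ora search_all (wp ora Skip (wp ora Skip ?P))) t3"
            proof (rule wp_init_queue[OF v3 p3 Z1 tab'])
              fix t4 :: config
              assume R: "ready Z [(1, 1, {..<n})] t4"
                and t4: "outputs t4 = outputs t3" "queries t4 = queries t3" "steps t4 \<le> steps t3 + 10 + 3 * n"
              show "wp ora search_all (wp ora Skip (wp ora Skip ?P)) t4"
              proof (rule wp_search_all[OF R])
                fix t5 :: config and Ys
                assume out: "outputs t5 = map (listing n) Ys"
                  and Ys: "mset Ys = sum_list (map (entry_leaves Z) [(1, 1, {..<n})])"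
                  and q5: "length (queries t5) = length (queries t4) + sum_list (map (entry_calls Z) [(1, 1, {..<n})])"
                  and st5: "steps t5 \<le> steps t4 + (40 * n + 81) * sum_list (map (entry_iter Z) [(1, 1, {..<n})]) + 1"
                have "mset Ys = mset (leaves (Z - 1) 1 1 {..<n})" using Ys by (simp add: entry_leaves_def)
                then have "distinct Ys" "set Ys = \<W>"
                  using root(1,2)[OF Z1[unfolded Z_def] W, folded Z_def]
                  by (metis mset_eq_imp_distinct_iff, metis mset_eq_setD)
                moreover have "length (queries t5) \<le> B"
                  using q5 nc t4 t3' t2 by (simp add: entry_calls_def)
                moreover have "steps t5 + 2 \<le> 600 * m\<^sup>2 * B"
                proof -
                  have "niter (Z - 1) 1 1 {..<n} \<le> Z * B"
                  proof -
                    have "niter (Z - 1) 1 1 {..<n} \<le> (Z - 1 + 1) * (1 + ncalls (Z - 1) 1 1 {..<n})" by (rule niter_le)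
                    also have "\<dots> \<le> Z * B" using nc Z1 by (intro mult_le_mono) simp_all
                    finally show ?thesis .
                  qed
                  also have "\<dots> \<le> 3 * m * B" using Q2 m by (simp add: Z_def)
                  finally have "(40 * n + 81) * niter (Z - 1) 1 1 {..<n} \<le> 121 * m * (3 * m * B)"
                    using m by (intro mult_le_mono) simp_all
                  then have a: "(40 * n + 81) * niter (Z - 1) 1 1 {..<n} \<le> 363 * m\<^sup>2 * B"
                    by (simp add: power2_eq_square)
                  \<comment> \<open>From \<open>depth n \<le> 2 * m\<close>:
                    \<open>10 * m + 6 * m + 20 * m = 36 * m\<close>.\<close>
                  have "n * (5 * depth n + 6 * n + 20) \<le> m * (36 * m)"
                    using m L2 by (intro mult_le_mono) simp_all
                  then have b: "n * (5 * depth n + 6 * n + 20) \<le> 36 * m\<^sup>2" by (simp add: power2_eq_square)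
                  have c: "steps t5 \<le> steps t4 + (40 * n + 81) * niter (Z - 1) 1 1 {..<n} + 1"
                    using st5 by (simp add: entry_iter_def)
                  have "steps t5 + 2 \<le> 100 * m\<^sup>2 + 363 * m\<^sup>2 * B"
                    using a b c t4(3) st3 st2 st1' L2 m m2 by linarith
                  also have "100 * m\<^sup>2 \<le> 100 * m\<^sup>2 * B" using B1 by simp
                  finally show ?thesis unfolding mult.assoc by linarith
                qed
                ultimately show "wp ora Skip (wp ora Skip ?P) t5"
                  using out unfolding wp_simps by (simp add: max_m) blast
              qed (simp add: t4 t3' t2)
            qed (simp_all add: t3' t2)
          qed (simp_all add: v2 t2 Z_def Q_def)
        qed
        then show ?thesis using True kpos by (simp add: r v1)
      qed
    qed
  qed (simp_all add: start_def)
qed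

section \<open>Expected cost\<close>

text \<open>Each dyadic block from \<open>2 ^ L\<close> to \<open>2 ^ Suc L\<close> has
  \<open>2 ^ L\<close> terms, none above \<open>1 / 2 ^ L\<close>.\<close>

lemma harmonic_le_log: "(\<Sum>i=1..<2 ^ L. 1 / real i) \<le> real L"
proof (induction L)
  case (Suc L)
  have "(\<Sum>i=1..<2 ^ Suc L. 1 / real i) = (\<Sum>i=1..<2 ^ L. 1 / real i) + (\<Sum>i=2 ^ L..<2 ^ Suc L. 1 / real i)"
    by (intro sum.atLeastLessThan_concat[symmetric]) auto
  also have "(\<Sum>i=2 ^ L..<2 ^ Suc L. 1 / real i) \<le> (\<Sum>i=(2 :: nat) ^ L..<2 ^ Suc L. 1 / 2 ^ L)"
  proof (rule sum_mono)
    fix i :: nat assume "i \<in> {2 ^ L..<2 ^ Suc L}"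
    then have "real (2 ^ L) \<le> real i" by (simp only: of_nat_le_iff atLeastLessThan_iff)
    moreover have "0 < real (2 ^ L)" by simp
    ultimately have "0 < real i" by linarith
    with \<open>real (2 ^ L) \<le> real i\<close> show "1 / real i \<le> 1 / 2 ^ L" by (intro divide_left_mono) auto
  qed
  also have "(\<Sum>i=(2 :: nat) ^ L..<2 ^ Suc L. 1 / 2 ^ L) = (1 :: real)" by simp
  finally show ?case using Suc.IH by simp
qed simp

text \<open>The bound on the expected calls per witness: the harmonic sum gives the factor
  \<open>L\<close> in the tree part, and the leaf part has no such factor.\<close>

definition call_rate :: "nat \<Rightarrow> nat \<Rightarrow> real" where
  "call_rate k L = 2 * (real k ^ 2 * 2 ^ k * exp (real k) * real L + real k * (2 ^ k * (real k + 1) * exp (real k)))"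

lemma sum_call_bound_le:
  assumes W: "\<And>W. W \<in> \<W> \<Longrightarrow> W \<subseteq> {..<n} \<and> card W = k" and n: "n \<le> 2 ^ L"
  shows "(\<Sum>h\<in>leaf_maps n (2 ^ L). real (call_bound n k (2 ^ L) \<W> h)) \<le> (2 ^ L) ^ n * (real (card \<W>) * call_rate k L)"
proof -
  let ?Q = "2 ^ L :: nat" and ?H = "leaf_maps n (2 ^ L)"
  let ?a = "\<lambda>W i h. real (card (heap_covers k i h W))"
  let ?b = "\<lambda>W h. real (card (leaf_covers n k h W))"
  have one: "(\<Sum>h\<in>?H. 2 * ((\<Sum>i=1..<?Q. ?a W i h) + real k * ?b W h)) \<le> real ?Q ^ n * call_rate k L"
    if "W \<in> \<W>" for W
  proof -
    note w = W[OF that]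
    have "(\<Sum>h\<in>?H. \<Sum>i=1..<?Q. ?a W i h) = (\<Sum>i=1..<?Q. \<Sum>h\<in>?H. ?a W i h)" by (rule sum.swap)
    also have "\<dots> \<le> (\<Sum>i=1..<?Q. real ?Q ^ n * (real k ^ 2 * 2 ^ k * exp (real k) / real i))"
      using w by (intro sum_mono sum_heap_le) auto
    also have "\<dots> = real ?Q ^ n * (real k ^ 2 * 2 ^ k * exp (real k) * (\<Sum>i=1..<?Q. 1 / real i))"
      by (simp add: sum_distrib_left)
    also have "\<dots> \<le> real ?Q ^ n * (real k ^ 2 * 2 ^ k * exp (real k) * real L)"
      by (intro mult_left_mono harmonic_le_log) auto
    finally have 1: "(\<Sum>h\<in>?H. \<Sum>i=1..<?Q. ?a W i h) \<le> real ?Q ^ n * (real k ^ 2 * 2 ^ k * exp (real k) * real L)" .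
    have "(\<Sum>h\<in>?H. ?b W h) \<le> real ?Q ^ n * (2 ^ k * (real k + 1) * exp (real k))"
      using w n by (intro sum_leaf_le) auto
    then have 2: "real k * (\<Sum>h\<in>?H. ?b W h) \<le> real k * (real ?Q ^ n * (2 ^ k * (real k + 1) * exp (real k)))"
      by (rule mult_left_mono) simp
    have "(\<Sum>h\<in>?H. 2 * ((\<Sum>i=1..<?Q. ?a W i h) + real k * ?b W h))
        = 2 * ((\<Sum>h\<in>?H. \<Sum>i=1..<?Q. ?a W i h) + real k * (\<Sum>h\<in>?H. ?b W h))"
      by (simp add: sum.distrib sum_distrib_left[symmetric])
    also have "\<dots> \<le> 2 * (real ?Q ^ n * (real k ^ 2 * 2 ^ k * exp (real k) * real L)
        + real k * (real ?Q ^ n * (2 ^ k * (real k + 1) * exp (real k))))"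
      by (rule mult_left_mono[OF add_mono[OF 1 2]]) simp
    also have "\<dots> = real ?Q ^ n * call_rate k L" by (simp add: call_rate_def algebra_simps)
    finally show ?thesis .
  qed
  have "(\<Sum>h\<in>?H. real (call_bound n k ?Q \<W> h))
      = (\<Sum>h\<in>?H. \<Sum>W\<in>\<W>. 2 * ((\<Sum>i=1..<?Q. ?a W i h) + real k * ?b W h))"
    unfolding call_bound_def by (simp add: sum_distrib_left)
  also have "\<dots> = (\<Sum>W\<in>\<W>. \<Sum>h\<in>?H. 2 * ((\<Sum>i=1..<?Q. ?a W i h) + real k * ?b W h))" by (rule sum.swap)
  also have "\<dots> \<le> (\<Sum>W\<in>\<W>. real ?Q ^ n * call_rate k L)" by (intro sum_mono one)
  finally show ?thesis by (simp add: mult_ac)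
qed

lemma call_rate_nonneg: "0 \<le> call_rate k L"
  by (simp add: call_rate_def)

text \<open>The factor \<open>K\<close> serves the running time, where a common bound is charged for
  every unit of the call bound.\<close>

lemma nn_integral_call_bound_le:
  assumes W: "\<And>W. W \<in> \<W> \<Longrightarrow> W \<subseteq> {..<n} \<and> card W = k"
  shows "(\<integral>\<^sup>+\<omega>. of_nat (K * (1 + call_bound n k (2 ^ depth n) \<W> (leaf_map (depth n) \<omega>))) \<partial>coin_tape)
    \<le> ennreal (real K * (1 + real (card \<W>) * call_rate k (depth n)))"
proof -
  let ?Q = "2 ^ depth n :: nat"
  let ?G = "\<lambda>h. of_nat (K * (1 + call_bound n k ?Q \<W> h)) :: ennreal"
  have "(\<integral>\<^sup>+\<omega>. ?G (leaf_map (depth n) \<omega>) \<partial>coin_tape) = (\<integral>\<^sup>+\<omega>. ?G (restrict (leaf_map (depth n) \<omega>) {..<n}) \<partial>coin_tape)"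
    by (subst call_bound_restrict) (use W in auto)
  also have "\<dots> \<le> (\<Sum>h\<in>leaf_maps n ?Q. ?G h) * ennreal (1 / (2 ^ depth n) ^ n)"
    by (rule nn_integral_leaf_map_le)
  also have "(\<Sum>h\<in>leaf_maps n ?Q. ?G h) = ennreal (\<Sum>h\<in>leaf_maps n ?Q. real (K * (1 + call_bound n k ?Q \<W> h)))"
    unfolding ennreal_of_nat_eq_real_of_nat by (rule sum_ennreal) simp
  also have "\<dots> * ennreal (1 / (2 ^ depth n) ^ n)
      = ennreal ((\<Sum>h\<in>leaf_maps n ?Q. real (K * (1 + call_bound n k ?Q \<W> h))) * (1 / (2 ^ depth n) ^ n))"
    by (rule ennreal_mult[symmetric]) (auto intro!: sum_nonneg)
  also have "\<dots> \<le> ennreal (real K * (1 + real (card \<W>) * call_rate k (depth n)))"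
  proof (rule ennreal_leI)
    have c: "real (card (leaf_maps n ?Q)) = (2 ^ depth n) ^ n"
      by (simp add: leaf_maps_def card_PiE)
    have "(\<Sum>h\<in>leaf_maps n ?Q. real (K * (1 + call_bound n k ?Q \<W> h)))
        = real K * (real (card (leaf_maps n ?Q)) + (\<Sum>h\<in>leaf_maps n ?Q. real (call_bound n k ?Q \<W> h)))"
      by (simp add: sum.distrib sum_distrib_left distrib_left)
    also have "\<dots> \<le> real K * ((2 ^ depth n) ^ n + (2 ^ depth n) ^ n * (real (card \<W>) * call_rate k (depth n)))"
      unfolding c by (intro mult_left_mono add_left_mono sum_call_bound_le W depth_le) auto
    also have "\<dots> = real K * (1 + real (card \<W>) * call_rate k (depth n)) * (2 ^ depth n) ^ n"
      by (simp add: algebra_simps)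
    finally show "(\<Sum>h\<in>leaf_maps n ?Q. real (K * (1 + call_bound n k ?Q \<W> h))) * (1 / (2 ^ depth n) ^ n)
        \<le> real K * (1 + real (card \<W>) * call_rate k (depth n))"
      by (simp add: divide_le_eq)
  qed
  finally show ?thesis .
qed

text \<open>By minimality the depth exceeds \<open>log 2 n\<close> by at most 1 when it is positive;
  the factor 2 absorbs this unit.\<close>

lemma depth_le_log: "real (depth n) \<le> 2 * max 1 (log 2 (real n))"
proof (cases "depth n")
  case (Suc d)
  then have d: "2 ^ d < n" using less_depth_iff[of d n] by simp
  then have "(2 :: real) ^ d < real n" by (metis of_nat_less_iff of_nat_numeral of_nat_power)
  then have "real d \<le> log 2 (real n)"
    using d by (simp add: le_log_iff powr_realpow)
  then show ?thesis using Suc by simp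
qed simp

text \<open>\<open>32 ^ k\<close> is the product of \<open>2 ^ k\<close> for each of
  \<open>k\<close> and \<open>k + 1\<close>, of the \<open>2 ^ k\<close> already present, and of
  \<open>4 ^ k\<close> for \<open>exp k\<close>. The numerical factor 6, and 1 more for the initial
  query, are rounded up to \<open>8 = 2 ^ 3\<close>. The rate is linear in \<open>M\<close>; the
  square is reached by \<open>M \<le> M\<^sup>2\<close>.\<close>

lemma call_rate_le:
  assumes M: "1 \<le> M" "real L \<le> 2 * M" and c: "1 \<le> c" "c' \<le> c" "0 \<le> c'"
  shows "1 + c' * call_rate k L \<le> 2 powr (5 * real k + 3) * M\<^sup>2 * c"
proof -
  have e: "exp (real k) \<le> 4 ^ k"
  proof -
    have "exp (real k) = exp 1 ^ k" by (simp add: exp_of_nat_mult[symmetric])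
    also have "\<dots> \<le> 4 ^ k" using exp_le by (intro power_mono) auto
    finally show ?thesis .
  qed
  have k: "real k \<le> 2 ^ k" "real k + 1 \<le> 2 ^ k"
  proof -
    have "real (Suc k) \<le> real (2 ^ k)" using less_exp[of k] by (simp only: of_nat_le_iff Suc_le_eq)
    then show "real k + 1 \<le> 2 ^ k" "real k \<le> 2 ^ k" by simp_all
  qed
  have kk: "real k * (real k + 1) * (2 ^ k * exp (real k)) \<le> 32 ^ k"
  proof -
    have "real k * (real k + 1) * (2 ^ k * exp (real k)) \<le> 2 ^ k * 2 ^ k * (2 ^ k * 4 ^ k)"
      using k e by (intro mult_mono) auto
    also have "\<dots> = 32 ^ k" by (simp add: power_mult_distrib[symmetric])
    finally show ?thesis .
  qed
  have "call_rate k L = 2 * (2 ^ k * exp (real k)) * (real k * (real k * real L + (real k + 1)))"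
    by (simp add: call_rate_def algebra_simps power2_eq_square)
  also have "\<dots> \<le> 2 * (2 ^ k * exp (real k)) * (real k * ((real k + 1) * (2 * M) + (real k + 1) * M))"
    using M by (intro mult_left_mono add_mono mult_mono) auto
  also have "\<dots> = 6 * M * (real k * (real k + 1) * (2 ^ k * exp (real k)))" by (simp add: algebra_simps)
  also have "\<dots> \<le> 6 * M * 32 ^ k" using kk M by (intro mult_left_mono) auto
  finally have rate: "call_rate k L \<le> 6 * M * 32 ^ k" .
  have M2: "M \<le> M\<^sup>2" using M by (simp add: power2_eq_square)
  have "1 + c' * call_rate k L \<le> 1 + c * (6 * M * 32 ^ k)"
    using rate c call_rate_nonneg[of k L] by (intro add_left_mono mult_mono) auto
  also have "\<dots> \<le> c * (M\<^sup>2 * 32 ^ k) + c * (6 * M\<^sup>2 * 32 ^ k)"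
  proof -
    have "1 * (1 * 1) \<le> c * (M\<^sup>2 * 32 ^ k)"
      using c M M2 by (intro mult_mono) auto
    moreover have "c * (6 * M * 32 ^ k) \<le> c * (6 * M\<^sup>2 * 32 ^ k)"
      using c M2 by (intro mult_left_mono mult_right_mono) auto
    ultimately show ?thesis by (intro add_mono) simp_all
  qed
  also have "\<dots> \<le> 8 * 32 ^ k * M\<^sup>2 * c" using c by (simp add: algebra_simps)
  also have "(8 :: real) * 32 ^ k = 2 powr (5 * real k + 3)"
  proof -
    have "(2 :: real) powr (5 * real k + 3) = 2 powr real (5 * k + 3)" by simp
    also have "\<dots> = 2 ^ (5 * k + 3)" by (rule powr_realpow) simp
    also have "\<dots> = 8 * 32 ^ k" by (simp add: power_add power_mult)
    finally show ?thesis ..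
  qed
  finally show ?thesis .
qed

text \<open>Witnesses as sets of positions, the form in which the machine handles them.\<close>

definition index_witnesses :: "('i, 'a) witness_problem \<Rightarrow> 'i \<Rightarrow> nat set set" where
  "index_witnesses \<Q> I = {S. S \<subseteq> {..<univ_size \<Q> I} \<and> decode \<Q> I S \<in> witnesses \<Q> I}"

lemma decode_subset: "decode \<Q> I S \<subseteq> set (universe \<Q> I)"
  by (auto simp: decode_def)

lemma inj_on_decode:
  assumes "distinct (universe \<Q> I)"
  shows "inj_on (decode \<Q> I) (Pow {..<univ_size \<Q> I})"
proof (rule inj_onI)
  fix S S' assume S: "S \<in> Pow {..<univ_size \<Q> I}" "S' \<in> Pow {..<univ_size \<Q> I}" "decode \<Q> I S = decode \<Q> I S'"
  have "inj_on ((!) (universe \<Q> I)) {..<univ_size \<Q> I}"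
    using assms by (auto simp: inj_on_def nth_eq_iff_index_eq)
  moreover have "(!) (universe \<Q> I) ` S = (!) (universe \<Q> I) ` S'"
    using S by (simp add: decode_def Int_absorb2)
  ultimately show "S = S'" using S by (simp add: inj_on_image_eq_iff)
qed

text \<open>The universe has no repetitions, so positions and elements are interchangeable and the
  problem is transported to \<open>{..<n}\<close> with its oracle and witness sizes.\<close>

lemma index_witness:
  assumes sc: "self_contained_k_witness_problem \<Q>" and I: "I \<in> instances \<Q>"
  shows "bij_betw (decode \<Q> I) (index_witnesses \<Q> I) (witnesses \<Q> I)"
    and "\<And>W. W \<in> index_witnesses \<Q> I \<Longrightarrow> W \<subseteq> {..<univ_size \<Q> I} \<and> card W = param \<Q> I"
    and "\<And>X. X \<subseteq> {..<univ_size \<Q> I} \<Longrightarrow>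
      ORA \<Q> I (decode \<Q> I X) \<longleftrightarrow> (\<exists>W\<in>index_witnesses \<Q> I. W \<subseteq> X)"
proof -
  let ?n = "univ_size \<Q> I" and ?u = "(!) (universe \<Q> I)"
  have dist: "distinct (universe \<Q> I)"
    and wit: "\<And>W. W \<in> witnesses \<Q> I \<Longrightarrow> W \<subseteq> set (universe \<Q> I) \<and> card W = param \<Q> I"
    using sc I by (auto simp: self_contained_k_witness_problem_def)
  have inj: "inj_on ?u {..<?n}" using dist by (auto simp: inj_on_def nth_eq_iff_index_eq)
  have dec: "decode \<Q> I S = ?u ` S" if "S \<subseteq> {..<?n}" for S
    using that by (simp add: decode_def Int_absorb2)
  have pre: "\<exists>S. S \<subseteq> {..<?n} \<and> decode \<Q> I S = W" if "W \<subseteq> set (universe \<Q> I)" for W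
  proof -
    have "W \<subseteq> ?u ` {..<?n}" using that by (auto simp: set_conv_nth)
    then obtain S where "S \<subseteq> {..<?n}" "W = ?u ` S" by (meson subset_imageE)
    then show ?thesis using dec by blast
  qed
  show "bij_betw (decode \<Q> I) (index_witnesses \<Q> I) (witnesses \<Q> I)"
    unfolding bij_betw_def
  proof
    show "inj_on (decode \<Q> I) (index_witnesses \<Q> I)"
      by (rule inj_on_subset[OF inj_on_decode[OF dist]]) (auto simp: index_witnesses_def)
    show "decode \<Q> I ` index_witnesses \<Q> I = witnesses \<Q> I"
    proof
      show "witnesses \<Q> I \<subseteq> decode \<Q> I ` index_witnesses \<Q> I"
      proof
        fix W assume W: "W \<in> witnesses \<Q> I"
        then obtain S where "S \<subseteq> {..<?n}" "decode \<Q> I S = W" using pre wit by blast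
        then show "W \<in> decode \<Q> I ` index_witnesses \<Q> I" using W unfolding index_witnesses_def by blast
      qed
    qed (auto simp: index_witnesses_def)
  qed
  show "W \<subseteq> {..<?n} \<and> card W = param \<Q> I" if "W \<in> index_witnesses \<Q> I" for W
  proof -
    have W: "W \<subseteq> {..<?n}" "decode \<Q> I W \<in> witnesses \<Q> I" using that by (auto simp: index_witnesses_def)
    have "card W = card (decode \<Q> I W)"
      using card_image[OF inj_on_subset[OF inj W(1)]] dec[OF W(1)] by simp
    then show ?thesis using W wit by simp
  qed
  show "ORA \<Q> I (decode \<Q> I X) \<longleftrightarrow> (\<exists>W\<in>index_witnesses \<Q> I. W \<subseteq> X)" if X: "X \<subseteq> {..<?n}" for X
  proof
    assume "ORA \<Q> I (decode \<Q> I X)"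
    then obtain W where W: "W \<in> witnesses \<Q> I" "W \<subseteq> ?u ` X" using dec[OF X] by (auto simp: ORA_def)
    then obtain S where S: "S \<subseteq> X" "W = ?u ` S" by (meson subset_imageE)
    then have "S \<subseteq> {..<?n}" using X by auto
    then have "S \<in> index_witnesses \<Q> I" using W S dec by (simp add: index_witnesses_def)
    then show "\<exists>W\<in>index_witnesses \<Q> I. W \<subseteq> X" using S by blast
  next
    assume "\<exists>W\<in>index_witnesses \<Q> I. W \<subseteq> X"
    then obtain S where S: "S \<subseteq> X" "decode \<Q> I S \<in> witnesses \<Q> I" by (auto simp: index_witnesses_def)
    moreover have "decode \<Q> I S \<subseteq> decode \<Q> I X" using S(1) by (auto simp: decode_def)
    ultimately show "ORA \<Q> I (decode \<Q> I X)" by (auto simp: ORA_def)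
  qed
qed

text \<open>The statement holds for each coin sequence separately; \<open>B\<close> depends on the
  coins through the leaf map and is averaged afterwards.\<close>

lemma enumerate_witnesses_run:
  assumes sc: "self_contained_k_witness_problem \<Q>" and I: "I \<in> instances \<Q>"
  defines "n \<equiv> univ_size \<Q> I"
  defines "B \<equiv> \<lambda>\<omega>. 1 + call_bound n (param \<Q> I) (2 ^ depth n) (index_witnesses \<Q> I) (leaf_map (depth n) \<omega>)"
  shows "\<exists>t. terminates_in enumerate_witnesses \<Q> I \<omega> t \<and> outputs_witnesses_once \<Q> I t \<and>
    length (queries t) \<le> B \<omega> \<and> steps t \<le> 600 * (max 1 n)\<^sup>2 * B \<omega>"
proof -
  note iw = index_witness[OF sc I, folded n_def]
  obtain t Ys where t: "big_step (\<lambda>S. ORA \<Q> I (decode \<Q> I S)) enumerate_witnesses (start n (param \<Q> I) \<omega>) t"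
    and out: "outputs t = map (listing n) Ys" and Ys: "distinct Ys" "set Ys = index_witnesses \<Q> I"
    and bd: "length (queries t) \<le> B \<omega>" "steps t \<le> 600 * (max 1 n)\<^sup>2 * B \<omega>"
    using wp_enumerate_witnesses[OF iw(2,3), of \<omega>] unfolding wp_def B_def by blast
  have sub: "X \<subseteq> {..<n}" if "X \<in> set Ys" for X using iw(2)[of X] that Ys by simp
  have set_out: "set (listing n X) = X" if "X \<in> set Ys" for X using sub[OF that] by auto
  have dec: "map (\<lambda>xs. decode \<Q> I (set xs)) (outputs t) = map (decode \<Q> I) Ys"
    unfolding out map_map o_def using set_out by (intro map_cong refl) simp
  have "outputs_witnesses_once \<Q> I t"
    unfolding outputs_witnesses_once_def dec
  proof (intro conjI ballI)
    fix xs assume "xs \<in> set (outputs t)"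
    then obtain X where X: "X \<in> set Ys" "xs = listing n X" by (auto simp: out)
    then show "distinct xs" "set xs \<subseteq> {..<univ_size \<Q> I}" by (auto simp: n_def)
  next
    show "distinct (map (decode \<Q> I) Ys)" "set (map (decode \<Q> I) Ys) = witnesses \<Q> I"
      using Ys iw(1) by (simp_all add: distinct_map bij_betw_def)
  qed
  then show ?thesis using t bd unfolding terminates_in_def n_def by blast
qed

text \<open>Runs are deterministic once the coins are fixed, so \<open>THE\<close> picks the given
  run, and the infinite branch never occurs.\<close>

lemma expected_le:
  assumes "\<And>\<omega>. \<exists>t. terminates_in A \<Q> I \<omega> t \<and> f t \<le> b \<omega>"
  shows "expected A \<Q> I f \<le> (\<integral>\<^sup>+\<omega>. of_nat (b \<omega>) \<partial>coin_tape)"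
  unfolding expected_def
proof (rule nn_integral_mono)
  fix \<omega>
  obtain t where t: "terminates_in A \<Q> I \<omega> t" "f t \<le> b \<omega>" using assms by blast
  have "(THE t. terminates_in A \<Q> I \<omega> t) = t"
    using t(1) big_step_deterministic unfolding terminates_in_def by (intro the_equality) blast+
  then show "(if \<exists>t. terminates_in A \<Q> I \<omega> t then of_nat (f (THE t. terminates_in A \<Q> I \<omega> t)) else \<infinity>)
      \<le> (of_nat (b \<omega>) :: ennreal)"
    using t by auto
qed


lemma linear_bigo: "(\<lambda>k. a * real k + b) \<in> O(\<lambda>k. real k)"
proof (rule bigoI)
  show "eventually (\<lambda>k. norm (a * real k + b) \<le> (\<bar>a\<bar> + \<bar>b\<bar>) * norm (real k)) sequentially"
  proof (rule eventually_at_top_linorderI[of 1])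
    fix k :: nat assume "1 \<le> k"
    have "norm (a * real k + b) \<le> \<bar>a\<bar> * real k + \<bar>b\<bar> * 1"
      using abs_triangle_ineq[of "a * real k" b] by (simp add: abs_mult)
    also have "\<dots> \<le> \<bar>a\<bar> * real k + \<bar>b\<bar> * real k"
      using \<open>1 \<le> k\<close> by (intro add_left_mono mult_left_mono) auto
    finally show "norm (a * real k + b) \<le> (\<bar>a\<bar> + \<bar>b\<bar>) * norm (real k)" by (simp add: distrib_right)
  qed
qed

lemma nn_integral_run_bound_le:
  assumes sc: "self_contained_k_witness_problem \<Q>" and I: "I \<in> instances \<Q>"
  defines "n \<equiv> univ_size \<Q> I"
  shows "(\<integral>\<^sup>+\<omega>. of_nat (K * (1 + call_bound n (param \<Q> I) (2 ^ depth n) (index_witnesses \<Q> I)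
      (leaf_map (depth n) \<omega>))) \<partial>coin_tape) \<le> ennreal (real K * calls_bound (\<lambda>k. 5 * real k + 3) \<Q> I)"
proof -
  note iw = index_witness[OF sc I, folded n_def]
  have card: "card (index_witnesses \<Q> I) = num_witnesses \<Q> I" using bij_betw_same_card[OF iw(1)] .
  have "1 + real (card (index_witnesses \<Q> I)) * call_rate (param \<Q> I) (depth n)
      \<le> calls_bound (\<lambda>k. 5 * real k + 3) \<Q> I"
    unfolding calls_bound_def n_def[symmetric]
    by (rule call_rate_le) (use depth_le_log[of n] card in auto)
  then show ?thesis
    by (intro order_trans[OF nn_integral_call_bound_le[OF iw(2)]] ennreal_leI mult_left_mono) auto
qed

theorem theorem1:
  fixes \<Q> :: "('i, 'a) witness_problem"
  assumes "self_contained_k_witness_problem \<Q>"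
  shows "\<exists>A.
    (\<forall>I\<in>instances \<Q>. enumerates A \<Q> I) \<and>
    (\<exists>h \<in> O(\<lambda>k. real k). \<forall>I\<in>instances \<Q>.
       expected_calls A \<Q> I \<le> ennreal (calls_bound h \<Q> I)) \<and>
    (\<forall>g \<tau> d. computable g \<and> oracle_time_bound \<Q> \<tau> g d \<longrightarrow>
       (\<exists>h \<in> O(\<lambda>k. real k). \<exists>e. \<forall>I\<in>instances \<Q>.
          expected_time A \<Q> \<tau> I \<le> ennreal (time_bound h g e \<Q> I)))"
proof (intro exI[of _ enumerate_witnesses] conjI allI impI ballI)
  fix I assume "I \<in> instances \<Q>"
  from enumerate_witnesses_run[OF assms this] show "enumerates enumerate_witnesses \<Q> I"
    unfolding enumerates_def by (intro AE_I2) blast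
next
  show "\<exists>h \<in> O(\<lambda>k. real k). \<forall>I\<in>instances \<Q>.
       expected_calls enumerate_witnesses \<Q> I \<le> ennreal (calls_bound h \<Q> I)"
  proof (intro bexI[of _ "\<lambda>k. 5 * real k + 3"] ballI linear_bigo)
    fix I assume I: "I \<in> instances \<Q>"
    show "expected_calls enumerate_witnesses \<Q> I \<le> ennreal (calls_bound (\<lambda>k. 5 * real k + 3) \<Q> I)"
    proof -
      let ?n = "univ_size \<Q> I"
      let ?b = "\<lambda>\<omega>. 1 * (1 + call_bound ?n (param \<Q> I) (2 ^ depth ?n) (index_witnesses \<Q> I) (leaf_map (depth ?n) \<omega>))"
      have "\<exists>t. terminates_in enumerate_witnesses \<Q> I \<omega> t \<and> length (queries t) \<le> ?b \<omega>" for \<omega>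
        using enumerate_witnesses_run[OF assms I, of \<omega>] unfolding mult_1 by blast
      then have "expected_calls enumerate_witnesses \<Q> I \<le> (\<integral>\<^sup>+\<omega>. of_nat (?b \<omega>) \<partial>coin_tape)"
        unfolding expected_calls_def by (rule expected_le)
      also have "\<dots> \<le> ennreal (real 1 * calls_bound (\<lambda>k. 5 * real k + 3) \<Q> I)"
        by (rule nn_integral_run_bound_le[OF assms I])
      finally show ?thesis by simp
    qed
  qed
next
  fix g :: "nat \<Rightarrow> nat" and \<tau> :: "'i \<Rightarrow> 'a set \<Rightarrow> nat" and d :: nat
  assume "computable g \<and> oracle_time_bound \<Q> \<tau> g d"
  then have \<tau>: "1 \<le> \<tau> I X \<and> \<tau> I X \<le> g (param \<Q> I) * max 1 (univ_size \<Q> I) ^ d"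
    if "I \<in> instances \<Q>" "X \<subseteq> set (universe \<Q> I)" for I X
    using that unfolding oracle_time_bound_def by blast
  show "\<exists>h \<in> O(\<lambda>k. real k). \<exists>e. \<forall>I\<in>instances \<Q>.
          expected_time enumerate_witnesses \<Q> \<tau> I \<le> ennreal (time_bound h g e \<Q> I)"
  \<comment> \<open>\<open>13 = 3 + 10\<close>, where 10 pays for the factor
    \<open>1024 = 2 ^ 10\<close> in \<open>K\<close>. The degree \<open>d + 4\<close> consists of
    \<open>d\<close> for an oracle call, 2 for the machine steps and 2 for the squared
    logarithm.\<close>
  proof (intro bexI[of _ "\<lambda>k. 5 * real k + 13"] exI[of _ "d + 4"] ballI linear_bigo)
    fix I assume I: "I \<in> instances \<Q>"
    define n where "n = univ_size \<Q> I"
    define m where "m = max 1 n"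
    define G where "G = g (param \<Q> I)"
    define B where "B \<omega> = 1 + call_bound n (param \<Q> I) (2 ^ depth n) (index_witnesses \<Q> I)
      (leaf_map (depth n) \<omega>)" for \<omega>
    \<comment> \<open>1024 is a power of two above \<open>600 + 1\<close>, the machine steps and the
      oracle time per unit of \<open>B\<close>.\<close>
    define K where "K = 1024 * G * m ^ (d + 2)"
    have m: "1 \<le> m" by (simp add: m_def)
    \<comment> \<open>An oracle call takes at least one step, which excludes \<open>G = 0\<close>;
      hence the steps of the machine itself can be charged to \<open>G\<close> as well.\<close>
    have G: "1 \<le> G" using \<tau>[OF I, of "{}"] by (cases G) (auto simp: G_def)
    have run: "\<exists>t. terminates_in enumerate_witnesses \<Q> I \<omega> t \<and>
        steps t + (\<Sum>S\<leftarrow>queries t. \<tau> I (decode \<Q> I S)) \<le> K * B \<omega>" for \<omega>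
    proof -
      obtain t where t: "terminates_in enumerate_witnesses \<Q> I \<omega> t"
        "length (queries t) \<le> B \<omega>" "steps t \<le> 600 * m\<^sup>2 * B \<omega>"
        using enumerate_witnesses_run[OF assms I, of \<omega>] unfolding B_def n_def m_def by blast
      have "(\<Sum>S\<leftarrow>queries t. \<tau> I (decode \<Q> I S)) \<le> (\<Sum>S\<leftarrow>queries t. G * m ^ d)"
        using \<tau>[OF I decode_subset] unfolding G_def m_def n_def by (intro sum_list_mono) blast
      also have "\<dots> = length (queries t) * (G * m ^ d)" by (simp add: sum_list_triv)
      also have "\<dots> \<le> B \<omega> * (G * m ^ (d + 2))"
        using t(2) m by (intro mult_le_mono power_increasing) auto
      finally have 1: "(\<Sum>S\<leftarrow>queries t. \<tau> I (decode \<Q> I S)) \<le> G * m ^ (d + 2) * B \<omega>" by (simp add: mult.commute)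
      have "1 * m ^ 2 \<le> G * m ^ (d + 2)" using G m by (intro mult_le_mono power_increasing) auto
      then have "600 * m\<^sup>2 * B \<omega> \<le> 600 * (G * m ^ (d + 2)) * B \<omega>" by (intro mult_le_mono) auto
      then have "steps t + (\<Sum>S\<leftarrow>queries t. \<tau> I (decode \<Q> I S)) \<le> 601 * (G * m ^ (d + 2) * B \<omega>)"
        using 1 t(3) unfolding mult.assoc by linarith
      also have "\<dots> \<le> K * B \<omega>" by (simp add: K_def)
      finally show ?thesis using t(1) by blast
    qed
    have "expected_time enumerate_witnesses \<Q> \<tau> I \<le> (\<integral>\<^sup>+\<omega>. of_nat (K * B \<omega>) \<partial>coin_tape)"
      unfolding expected_time_def by (rule expected_le[OF run])
    also have "\<dots> \<le> ennreal (real K * calls_bound (\<lambda>k. 5 * real k + 3) \<Q> I)"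
      unfolding B_def n_def by (rule nn_integral_run_bound_le[OF assms I])
    also have "\<dots> \<le> ennreal (time_bound (\<lambda>k. 5 * real k + 13) g (d + 4) \<Q> I)"
    proof (rule ennreal_leI)
      define w where "w = real (max 1 (num_witnesses \<Q> I))"
      have "max 1 (log 2 (real n)) \<le> real m"
      proof (cases "n = 0")
        case False
        have "real n \<le> 2 powr real n"
          using less_exp[of n] by (simp add: powr_realpow)
        then have "log 2 (real n) \<le> real n" using False by (simp add: log_le_iff)
        then show ?thesis by (simp add: m_def)
      qed (simp add: m_def log_def)
      then have log: "(max 1 (log 2 (real n)))\<^sup>2 \<le> real m ^ 2" by (intro power_mono) auto
      have pw: "2 powr (5 * real (param \<Q> I) + 13) = 1024 * 2 powr (5 * real (param \<Q> I) + 3)"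
      proof -
        have "2 powr (5 * real (param \<Q> I) + 13) = 2 powr (5 * real (param \<Q> I) + 3) * 2 powr 10"
          by (simp only: powr_add[symmetric]) (simp add: add.commute)
        also have "(2 :: real) powr 10 = 1024" using powr_realpow[of 2 10] by simp
        finally show ?thesis by (simp add: mult.commute)
      qed
      have "real K * calls_bound (\<lambda>k. 5 * real k + 3) \<Q> I
          = 1024 * 2 powr (5 * real (param \<Q> I) + 3) * real G * (real m ^ (d + 2) * (max 1 (log 2 (real n)))\<^sup>2) * w"
        by (simp add: K_def calls_bound_def n_def[symmetric] w_def mult_ac)
      also have "\<dots> \<le> 1024 * 2 powr (5 * real (param \<Q> I) + 3) * real G * (real m ^ (d + 2) * real m ^ 2) * w"
        using log by (intro mult_right_mono mult_left_mono) (auto simp: w_def)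
      also have "real m ^ (d + 2) * real m ^ 2 = real m ^ (d + 4)" by (simp add: eval_nat_numeral)
      also have "1024 * 2 powr (5 * real (param \<Q> I) + 3) * real G * real m ^ (d + 4) * w
          = time_bound (\<lambda>k. 5 * real k + 13) g (d + 4) \<Q> I"
        unfolding time_bound_def pw by (simp add: G_def m_def n_def w_def)
      finally show "real K * calls_bound (\<lambda>k. 5 * real k + 3) \<Q> I
          \<le> time_bound (\<lambda>k. 5 * real k + 13) g (d + 4) \<Q> I" .
    qed
    finally show "expected_time enumerate_witnesses \<Q> \<tau> I
        \<le> ennreal (time_bound (\<lambda>k. 5 * real k + 13) g (d + 4) \<Q> I)" .
  qed
qed

end
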